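(* Let $m\ge1$. The map $p\mapsto\mathfrak{G}^{\mathrm{convex}}_p$ is non-decreasing on $[1,\infty)$, and for every $1\le p<\infty$, $$\mathfrak{G}^{\mathrm{convex}}_p\ \ge\ 2^{-3}\pi^2 m^{-(m+2p)/p}\left(\frac{\Gamma(\frac m2+1)\Gamma(p+1)}{\Gamma(\frac m2+p+1)}\right)^{1/p}.$$
   Context: For a non-empty open $\Omega\subset\mathbb{R}^m$ with $|\Omega|<\infty$, $\lambda_1(\Omega)=\inf_{\varphi\in H_0^1(\Omega)\setminus\{0\}}\int_\Omega|D\varphi|^2/\int_\Omega\varphi^2$, $v_\Omega$ is the unique solution of $-\Delta v=1$, $v\in H_0^1(\Omega)$, and $F_p(\Omega)=\|v_\Omega\|_{L^p(\Omega)}\lambda_1(\Omega)/|\Omega|^{1/p}$. $\mathfrak{G}^{\mathrm{convex}}_p=\inf\{F_p(\Omega):\Omega\text{ open, convex in }\mathbb{R}^m,\ 0<|\Omega|<\infty\}$. *)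

theory Defs
  imports "HOL-Analysis.Analysis"
begin

definition partial_deriv :: "'a::euclidean_space \<Rightarrow> ('a \<Rightarrow> real) \<Rightarrow> 'a \<Rightarrow> real" where
  "partial_deriv i f x = frechet_derivative f (at x) i"

definition grad :: "('a::euclidean_space \<Rightarrow> real) \<Rightarrow> 'a \<Rightarrow> 'a" where
  "grad f x = (\<Sum>i\<in>Basis. partial_deriv i f x *\<^sub>R i)"

fun Ck :: "nat \<Rightarrow> ('a::euclidean_space \<Rightarrow> real) \<Rightarrow> bool" where
  "Ck 0 f = continuous_on UNIV f"
| "Ck (Suc k) f = ((\<forall>x. f differentiable (at x)) \<and> (\<forall>i\<in>Basis. Ck k (partial_deriv i f)))"

definition smooth :: "('a::euclidean_space \<Rightarrow> real) \<Rightarrow> bool" where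
  "smooth f \<longleftrightarrow> (\<forall>k. Ck k f)"

definition test_fun :: "'a::euclidean_space set \<Rightarrow> ('a \<Rightarrow> real) \<Rightarrow> bool" where
  "test_fun \<Omega> \<phi> \<longleftrightarrow> smooth \<phi> \<and> compact (closure {x. \<phi> x \<noteq> 0}) \<and> closure {x. \<phi> x \<noteq> 0} \<subseteq> \<Omega>"

text \<open>H^1_0(\<Omega>) = closure of C_c^\<infinity>(\<Omega>) in the H^1(\<Omega>) norm.
  H01 \<Omega> u g: u lies in H^1_0(\<Omega>) and g is its (weak) gradient, i.e. there are test
  functions \<phi>_n with \<phi>_n \<rightarrow> u in L^2(\<Omega>) and grad \<phi>_n \<rightarrow> g in L^2(\<Omega>;R^m).\<close>
definition H01 :: "'a::euclidean_space set \<Rightarrow> ('a \<Rightarrow> real) \<Rightarrow> ('a \<Rightarrow> 'a) \<Rightarrow> bool" where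
  "H01 \<Omega> u g \<longleftrightarrow>
     u \<in> borel_measurable lebesgue \<and> g \<in> borel_measurable lebesgue \<and>
     set_integrable lebesgue \<Omega> (\<lambda>x. (u x)\<^sup>2) \<and>
     set_integrable lebesgue \<Omega> (\<lambda>x. (norm (g x))\<^sup>2) \<and>
     (\<exists>\<phi>::nat \<Rightarrow> 'a \<Rightarrow> real. (\<forall>n. test_fun \<Omega> (\<phi> n)) \<and>
        (\<lambda>n. (LINT x:\<Omega>|lebesgue. (u x - \<phi> n x)\<^sup>2)
             + (LINT x:\<Omega>|lebesgue. (norm (g x - grad (\<phi> n) x))\<^sup>2)) \<longlonglongrightarrow> 0)"

definition lambda1 :: "'a::euclidean_space set \<Rightarrow> real" where
  "lambda1 \<Omega> = Inf {(LINT x:\<Omega>|lebesgue. (norm (g x))\<^sup>2) / (LINT x:\<Omega>|lebesgue. (u x)\<^sup>2)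
                     | u g. H01 \<Omega> u g \<and> (LINT x:\<Omega>|lebesgue. (u x)\<^sup>2) \<noteq> 0}"

text \<open>Torsion function: weak solution v \<in> H^1_0(\<Omega>) of -\<Delta>v = 1.\<close>
definition is_torsion :: "'a::euclidean_space set \<Rightarrow> ('a \<Rightarrow> real) \<Rightarrow> bool" where
  "is_torsion \<Omega> v \<longleftrightarrow> (\<exists>g. H01 \<Omega> v g \<and>
     (\<forall>\<phi> \<psi>. H01 \<Omega> \<phi> \<psi> \<longrightarrow>
        (LINT x:\<Omega>|lebesgue. g x \<bullet> \<psi> x) = (LINT x:\<Omega>|lebesgue. \<phi> x)))"

definition torsion :: "'a::euclidean_space set \<Rightarrow> 'a \<Rightarrow> real" where
  "torsion \<Omega> = (SOME v. is_torsion \<Omega> v)"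

definition Fp :: "real \<Rightarrow> 'a::euclidean_space set \<Rightarrow> real" where
  "Fp p \<Omega> = (LINT x:\<Omega>|lebesgue. \<bar>torsion \<Omega> x\<bar> powr p) powr (1 / p) * lambda1 \<Omega>
              / measure lebesgue \<Omega> powr (1 / p)"

definition G_convex :: "'a::euclidean_space itself \<Rightarrow> real \<Rightarrow> real" where
  "G_convex TYPE('a) p = Inf {Fp p \<Omega> | \<Omega>::'a set. open \<Omega> \<and> convex \<Omega> \<and>
       0 < emeasure lebesgue \<Omega> \<and> emeasure lebesgue \<Omega> < \<infinity>}"

end

theory Submission
  imports Defs
begin

text \<open>Let \<open>E\<close> be the John ellipsoid of the convex set \<open>\<Omega>\<close>, written as \<open>{x. norm (L (x - c)) < 1}\<close> with \<open>L\<close>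
  linear, so that \<open>\<Omega>\<close> lies in the dilate of \<open>E\<close> by the dimension \<open>m\<close>, and put \<open>S = (\<Sum>i\<in>Basis. (norm (L i))\<^sup>2)\<close>.
  The torsion function of \<open>E\<close> is the quadratic \<open>(1 - (norm (L (x - c)))\<^sup>2) / (2 * S)\<close>; by the maximum principle
  it is a lower bound for the torsion function of \<open>\<Omega>\<close>, and its \<open>L\<^sup>p\<close> norm is a Beta integral. In the
  coordinate direction \<open>e\<close> the chords of \<open>\<Omega>\<close> have length at most \<open>2 * m / norm (L e)\<close>, so the one-dimensional
  Poincare inequality, summed over the basis, gives \<open>\<lambda>\<^sub>1 \<ge> pi\<^sup>2 * S / (4 * m\<^sup>2)\<close>. In the product \<open>S\<close>
  cancels, and the volume ratio of \<open>\<Omega>\<close> and \<open>E\<close> is at most \<open>m ^ m\<close>. Working with \<open>L\<close> directly avoids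
  diagonalising the ellipsoid. Monotonicity in \<open>p\<close> is Jensen's inequality, which needs the torsion function to be
  in every \<open>L\<^sup>p\<close>; it is bounded, again by the maximum principle.\<close>

section \<open>Smooth functions and gradients\<close>

text \<open>\<open>H01\<close> is a closure of smooth compactly supported functions, and this shapes
  every argument. The maximum principle wants to test with the positive part of a difference, which
  is not smooth; a smooth function with the same zero set replaces it. Boundary comparison then
  becomes the demand that truncating a test function gives a test function again. For this reason
  the quadratic of the ellipsoid is first lowered by a positive constant: its positive part then has
  compact support inside the domain even where the ellipsoid touches the boundary, and the constant
  tends to 0 at the end.

  \<open>torsion\<close> is a choice operator, so nothing is known of it until a weak solution has
  been constructed. The construction minimises the energy \<open>|grad u|^2 - 2 * u\<close>, which
  is bounded below by the very Poincare inequality that also bounds \<open>lambda1\<close>.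
  Pointwise bounds obtained in this way hold almost everywhere only, which is all that the integrals
  in \<open>Fp\<close> see.\<close>

lemma has_derivative_partial:
  assumes "(f has_derivative f') (at x)"
  shows "partial_deriv i f x = f' i"
  using frechet_derivative_at[OF assms] by (simp add: partial_deriv_def)

lemma grad_inner:
  fixes f :: "'a::euclidean_space \<Rightarrow> real"
  assumes "f differentiable (at x)"
  shows "frechet_derivative f (at x) h = grad f x \<bullet> h"
proof -
  have lin: "linear (frechet_derivative f (at x))"
    using assms by (simp add: linear_frechet_derivative)
  have "frechet_derivative f (at x) h = frechet_derivative f (at x) (\<Sum>i\<in>Basis. (h \<bullet> i) *\<^sub>R i)"
    by (simp add: euclidean_representation)
  also have "\<dots> = (\<Sum>i\<in>Basis. (h \<bullet> i) * frechet_derivative f (at x) i)"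
    by (simp add: linear_sum[OF lin] linear_scale[OF lin])
  also have "\<dots> = grad f x \<bullet> h"
    by (simp add: grad_def partial_deriv_def inner_sum_left mult.commute inner_commute[of h])
  finally show ?thesis .
qed

lemma has_derivative_grad:
  fixes f :: "'a::euclidean_space \<Rightarrow> real"
  assumes "f differentiable (at x)"
  shows "(f has_derivative (\<lambda>h. grad f x \<bullet> h)) (at x)"
proof -
  have "frechet_derivative f (at x) = (\<lambda>h. grad f x \<bullet> h)"
    using grad_inner[OF assms] by auto
  thus ?thesis using assms frechet_derivative_works by metis
qed

lemma grad_eqI:
  fixes f :: "'a::euclidean_space \<Rightarrow> real"
  assumes "(f has_derivative (\<lambda>h. g \<bullet> h)) (at x)"
  shows "grad f x = g"
  unfolding grad_def has_derivative_partial[OF assms]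
  by (simp add: euclidean_representation)

lemma grad_inner_Basis:
  assumes "i \<in> Basis"
  shows "grad f x \<bullet> i = partial_deriv i f x"
proof -
  have "grad f x \<bullet> i = (\<Sum>j\<in>Basis. partial_deriv j f x * (if j = i then 1 else 0))"
    unfolding grad_def using assms by (auto simp: inner_sum_left inner_Basis intro!: sum.cong)
  also have "\<dots> = partial_deriv i f x" using assms by (simp add: if_distrib sum.delta cong: if_cong)
  finally show ?thesis .
qed

lemma norm_grad_sq: "(norm (grad f x))\<^sup>2 = (\<Sum>i\<in>Basis. (partial_deriv i f x)\<^sup>2)"
proof -
  have "(norm (grad f x))\<^sup>2 = (\<Sum>i\<in>Basis. (grad f x \<bullet> i)\<^sup>2)"
    unfolding power2_norm_eq_inner by (subst euclidean_inner) (simp add: power2_eq_square)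
  thus ?thesis by (simp add: grad_inner_Basis)
qed

lemma Ck_SucD: "Ck (Suc k) f \<Longrightarrow> Ck k f"
proof (induction k arbitrary: f)
  case 0
  thus ?case by (auto intro!: differentiable_imp_continuous_on simp: differentiable_on_def
      differentiable_at_withinI)
next
  case (Suc k)
  have "\<forall>i\<in>Basis. Ck k (partial_deriv i f)" using Suc by auto
  thus ?case using Suc.prems by auto
qed

lemma Ck_const: "Ck k (\<lambda>x::'a::euclidean_space. c)"
proof (induction k arbitrary: c)
  case (Suc k)
  have "partial_deriv i (\<lambda>x::'a. c) = (\<lambda>x. 0)" for i
    by (intro ext has_derivative_partial) auto
  thus ?case using Suc by auto
qed auto

lemma Ck_add: "Ck k f \<Longrightarrow> Ck k g \<Longrightarrow> Ck k (\<lambda>x. f x + g x)"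
proof (induction k arbitrary: f g)
  case (Suc k)
  have "partial_deriv i (\<lambda>x. f x + g x) = (\<lambda>x. partial_deriv i f x + partial_deriv i g x)" for i
  proof
    fix x
    have "f differentiable at x" "g differentiable at x" using Suc.prems by auto
    hence "((\<lambda>x. f x + g x) has_derivative
      (\<lambda>h. frechet_derivative f (at x) h + frechet_derivative g (at x) h)) (at x)"
      by (intro has_derivative_add) (auto simp: frechet_derivative_works)
    thus "partial_deriv i (\<lambda>x. f x + g x) x = partial_deriv i f x + partial_deriv i g x"
      by (subst has_derivative_partial) (auto simp: partial_deriv_def)
  qed
  thus ?case using Suc by (auto intro!: derivative_intros)
qed (auto intro!: continuous_intros)

lemma partial_deriv_mult:
  assumes "f differentiable at x" "g differentiable at x"
  shows "partial_deriv i (\<lambda>x. f x * g x) x = f x * partial_deriv i g x + partial_deriv i f x * g x"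
proof -
  have "((\<lambda>x. f x * g x) has_derivative
      (\<lambda>h. f x * frechet_derivative g (at x) h + frechet_derivative f (at x) h * g x)) (at x)"
    using assms by (intro has_derivative_mult) (auto simp: frechet_derivative_works)
  thus ?thesis
    by (subst has_derivative_partial) (auto simp: partial_deriv_def)
qed

lemma Ck_mult: "Ck k f \<Longrightarrow> Ck k g \<Longrightarrow> Ck k (\<lambda>x. f x * g x)"
proof (induction k arbitrary: f g)
  case (Suc k)
  have "partial_deriv i (\<lambda>x. f x * g x) =
      (\<lambda>x. f x * partial_deriv i g x + partial_deriv i f x * g x)" for i
    using Suc.prems by (auto simp: partial_deriv_mult)
  moreover have "Ck k f" "Ck k g" using Suc.prems Ck_SucD by blast+
  ultimately show ?case using Suc by (auto intro!: derivative_intros Ck_add)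
qed (auto intro!: continuous_intros)

text \<open>The chain rule replaces \<open>F j\<close> by \<open>F (Suc j)\<close>, so the induction
  on \<open>k\<close> has to treat the whole tower of derivatives at once; hence the outer function
  is given as a sequence.\<close>

lemma Ck_comp:
  fixes F :: "nat \<Rightarrow> real \<Rightarrow> real"
  assumes F: "\<And>j s. (F j has_real_derivative F (Suc j) s) (at s)"
  shows "Ck k u \<Longrightarrow> Ck k (\<lambda>x. F j (u x))"
proof (induction k arbitrary: j)
  case 0
  have "continuous_on UNIV (F j)"
    by (meson DERIV_isCont F continuous_at_imp_continuous_on)
  thus ?case using 0 by (auto intro: continuous_on_compose2)
next
  case (Suc k)
  have d: "((\<lambda>x. F j (u x)) has_derivative
      (\<lambda>h. frechet_derivative u (at x) h * F (Suc j) (u x))) (at x)" for x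
    using has_derivative_compose[of u "frechet_derivative u (at x)" x UNIV "F j" "(*) (F (Suc j) (u x))"]
      Suc.prems F[of j "u x"]
    by (auto simp: frechet_derivative_works has_field_derivative_def mult.commute)
  have "partial_deriv i (\<lambda>x. F j (u x)) = (\<lambda>x. F (Suc j) (u x) * partial_deriv i u x)" for i
    using has_derivative_partial[OF d] by (auto simp: partial_deriv_def)
  moreover have "Ck k (\<lambda>x. F (Suc j) (u x))" using Suc Ck_SucD by blast
  ultimately show ?case using Suc.prems d by (auto intro!: Ck_mult simp: differentiable_def)
qed

lemma smooth_const: "smooth (\<lambda>x. c)"
  and smooth_add: "smooth f \<Longrightarrow> smooth g \<Longrightarrow> smooth (\<lambda>x. f x + g x)"
  and smooth_mult: "smooth f \<Longrightarrow> smooth g \<Longrightarrow> smooth (\<lambda>x. f x * g x)"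
  by (auto simp: smooth_def Ck_const Ck_add Ck_mult)

lemma smooth_diff: "smooth f \<Longrightarrow> smooth g \<Longrightarrow> smooth (\<lambda>x. f x - g x)"
  using smooth_add[of f "\<lambda>x. (-1) * g x"] smooth_mult[OF smooth_const[of "-1"], of g] by simp

lemma smooth_sum:
  assumes "\<And>i. i \<in> I \<Longrightarrow> smooth (f i)"
  shows "smooth (\<lambda>x. \<Sum>i\<in>I. f i x)"
  using assms by (induction I rule: infinite_finite_induct) (auto intro: smooth_const smooth_add)

lemma smooth_comp:
  fixes F :: "nat \<Rightarrow> real \<Rightarrow> real"
  assumes "\<And>j s. (F j has_real_derivative F (Suc j) s) (at s)" "smooth u"
  shows "smooth (\<lambda>x. F j (u x))"
  using assms by (auto simp: smooth_def intro: Ck_comp)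

lemma smooth_inner: "smooth (\<lambda>x. a \<bullet> x)"
  unfolding smooth_def
proof
  fix k
  have "((\<lambda>x. a \<bullet> x) has_derivative (\<lambda>h. a \<bullet> h)) (at x)" for x
    by (auto intro!: derivative_eq_intros)
  hence "partial_deriv i (\<lambda>x. a \<bullet> x) = (\<lambda>x. a \<bullet> i)" for i
    using has_derivative_partial by blast
  thus "Ck k (\<lambda>x. a \<bullet> x)"
    by (cases k) (auto intro!: Ck_const continuous_intros derivative_intros)
qed

lemma smooth_differentiable: "smooth f \<Longrightarrow> f differentiable (at x)"
  unfolding smooth_def by (metis Ck.simps(2))

lemma smooth_partial_deriv: "smooth f \<Longrightarrow> i \<in> Basis \<Longrightarrow> smooth (partial_deriv i f)"
  unfolding smooth_def by (metis Ck.simps(2))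

lemma smooth_continuous: "smooth f \<Longrightarrow> continuous_on A f"
  unfolding smooth_def by (metis Ck.simps(1) continuous_on_subset subset_UNIV)

lemma continuous_on_grad: "smooth f \<Longrightarrow> continuous_on A (grad f)"
  unfolding grad_def[abs_def]
  by (intro continuous_intros smooth_continuous smooth_partial_deriv)

section \<open>A smooth convex substitute for the positive part\<close>

text \<open>The standard family of smooth functions that are flat at 0, with a polynomial factor in
  \<open>1 / s\<close> so that the family is closed under differentiation.\<close>

definition flat :: "real poly \<Rightarrow> real \<Rightarrow> real" where
  "flat P s = (if s > 0 then poly P (1 / s) * exp (- (1 / s)) else 0)"

lemma tendsto_poly_times_exp_minus:
  "((\<lambda>t::real. poly P t * exp (- t)) \<longlongrightarrow> 0) at_top"
proof -
  have *: "((\<lambda>t::real. coeff P i * (t ^ i / exp t)) \<longlongrightarrow> 0) at_top" for i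
    using tendsto_mult_right_zero[OF tendsto_power_div_exp_0] by blast
  have "((\<lambda>t::real. \<Sum>i\<le>degree P. coeff P i * (t ^ i / exp t)) \<longlongrightarrow> (\<Sum>i\<le>degree P. 0)) at_top"
    by (intro tendsto_sum *)
  moreover have "(\<Sum>i\<le>degree P. coeff P i * (t ^ i / exp t)) = poly P t * exp (- t)" for t
    by (simp add: poly_altdef sum_distrib_right exp_minus divide_inverse mult.assoc)
  ultimately show ?thesis by simp
qed

text \<open>With \<open>t = 1 / s\<close> the derivative of \<open>t\<close> is
  \<open>- t^2\<close>, so differentiating \<open>P(t) * exp (- t)\<close> gives
  \<open>t^2 * (P - P')(t) * exp (- t)\<close>, and \<open>[:0, 0, 1:]\<close> is
  \<open>t^2\<close>. At the origin the difference quotient from the right is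
  \<open>t * P(t) * exp (- t)\<close>, which tends to 0 as \<open>t\<close> grows.\<close>

lemma flat_has_derivative:
  "(flat P has_real_derivative flat ([:0, 0, 1:] * (P - pderiv P)) s) (at s)"
proof -
  consider "s > 0" | "s < 0" | "s = 0" by linarith
  thus ?thesis
  proof cases
    case 1
    have "((\<lambda>s. poly P (1 / s) * exp (- (1 / s))) has_real_derivative
        flat ([:0, 0, 1:] * (P - pderiv P)) s) (at s)"
      using 1 unfolding flat_def
      by (auto intro!: derivative_eq_intros DERIV_chain2[OF poly_DERIV] simp: power2_eq_square field_simps)
    thus ?thesis
      by (rule has_field_derivative_transform_within_open[of _ _ _ "{0<..}"])
        (use 1 in \<open>auto simp: flat_def\<close>)
  next
    case 2
    have "((\<lambda>s. 0) has_real_derivative flat ([:0, 0, 1:] * (P - pderiv P)) s) (at s)"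
      using 2 by (auto simp: flat_def)
    thus ?thesis
      by (rule has_field_derivative_transform_within_open[of _ _ _ "{..<0}"])
        (use 2 in \<open>auto simp: flat_def\<close>)
  next
    case 3
    have r: "((\<lambda>h. flat P h / h) \<longlongrightarrow> 0) (at_right 0)"
    proof -
      have "((\<lambda>h::real. poly ([:0,1:] * P) (1 / h) * exp (- (1 / h))) \<longlongrightarrow> 0) (at_right 0)"
        by (rule filterlim_compose[OF tendsto_poly_times_exp_minus])
          (simp add: filterlim_inverse_at_top_right divide_inverse)
      thus ?thesis
        by (rule Lim_transform_eventually)
          (auto simp: flat_def eventually_at_right_less eventually_at_filter)
    qed
    have l: "((\<lambda>h. flat P h / h) \<longlongrightarrow> 0) (at_left 0)"
      by (rule Lim_transform_eventually[OF tendsto_const])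
        (auto simp: flat_def eventually_at_filter)
    have "((\<lambda>h. flat P h / h) \<longlongrightarrow> 0) (at 0)"
      using l r by (rule filterlim_split_at)
    thus ?thesis using 3 by (simp add: DERIV_def flat_def)
  qed
qed

text \<open>\<open>softplus\<close> vanishes on the negative half line and has derivative between 0 and 1, so composing with it
  truncates test functions to test functions.\<close>

definition softplus :: "real \<Rightarrow> real" where
  "softplus s = (if s > 0 then s * exp (- (1 / s)) else 0)"

text \<open>\<open>softplus\<close> carries the factor \<open>s = 1 / t\<close>, no polynomial in
  \<open>t\<close>, so it lies outside the family \<open>flat\<close>. Its first derivative
  \<open>(1 + 1 / s) * exp (- (1 / s))\<close> belongs to it with polynomial \<open>1 + t\<close>,
  and from there the recursion is that of \<open>flat_has_derivative\<close>.\<close>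

fun softplus_deriv_poly :: "nat \<Rightarrow> real poly" where
  "softplus_deriv_poly 0 = [:1, 1:]"
| "softplus_deriv_poly (Suc j) =
     [:0, 0, 1:] * (softplus_deriv_poly j - pderiv (softplus_deriv_poly j))"

fun softplus_derivs :: "nat \<Rightarrow> real \<Rightarrow> real" where
  "softplus_derivs 0 = softplus"
| "softplus_derivs (Suc j) = flat (softplus_deriv_poly j)"

abbreviation softplus' :: "real \<Rightarrow> real" where
  "softplus' \<equiv> softplus_derivs 1"

lemma softplus'_eq: "softplus' s = (if s > 0 then (1 + 1 / s) * exp (- (1 / s)) else 0)"
  by (simp add: flat_def)

lemma softplus_has_derivative:
  "(softplus has_real_derivative softplus' s) (at s)"
proof -
  consider "s > 0" | "s < 0" | "s = 0" by linarith
  thus ?thesis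
  proof cases
    case 1
    have "((\<lambda>s. s * exp (- (1 / s))) has_real_derivative softplus' s) (at s)"
      using 1 unfolding softplus'_eq
      by (auto intro!: derivative_eq_intros simp: power2_eq_square field_simps)
    thus ?thesis
      by (rule has_field_derivative_transform_within_open[of _ _ _ "{0<..}"])
        (use 1 in \<open>auto simp: softplus_def\<close>)
  next
    case 2
    have "((\<lambda>s. 0) has_real_derivative softplus' s) (at s)"
      using 2 by (auto simp: flat_def)
    thus ?thesis
      by (rule has_field_derivative_transform_within_open[of _ _ _ "{..<0}"])
        (use 2 in \<open>auto simp: softplus_def\<close>)
  next
    case 3
    \<comment> \<open>For \<open>h \<noteq> 0\<close> the quotient \<open>softplus h / h\<close>
      equals \<open>flat 1 h\<close>, which is continuous with value 0 at 0.\<close>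
    have "((\<lambda>h. flat 1 h) \<longlongrightarrow> flat 1 0) (at 0)"
      using DERIV_isCont[OF flat_has_derivative[of 1 0]] by (simp add: isCont_def)
    hence "((\<lambda>h. flat 1 h) \<longlongrightarrow> 0) (at 0)" by (simp add: flat_def)
    hence "((\<lambda>h. softplus h / h) \<longlongrightarrow> 0) (at 0)"
      by (rule Lim_transform_eventually)
        (auto simp: flat_def softplus_def eventually_at_filter)
    thus ?thesis using 3 by (simp add: DERIV_def flat_def softplus_def)
  qed
qed

lemma softplus_derivs_has_derivative:
  "(softplus_derivs j has_real_derivative softplus_derivs (Suc j) s) (at s)"
  using softplus_has_derivative flat_has_derivative by (cases j) auto

lemma smooth_softplus: "smooth u \<Longrightarrow> smooth (\<lambda>x. softplus (u x))"
  using smooth_comp[of softplus_derivs u 0, OF softplus_derivs_has_derivative] by simp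

text \<open>Each differentiation of the cosine is a phase shift by \<open>pi / 2\<close>, which puts
  all derivatives into one formula, as \<open>smooth_comp\<close> requires.\<close>

lemma smooth_cos: "smooth u \<Longrightarrow> smooth (\<lambda>x. cos (u x))"
proof -
  assume u: "smooth u"
  have "((\<lambda>s. cos (s + real j * (pi / 2))) has_real_derivative cos (s + real (Suc j) * (pi / 2))) (at s)"
    for j s
  proof -
    have "cos (s + real (Suc j) * (pi / 2)) = cos ((s + real j * (pi / 2)) + pi / 2)"
      by (simp add: algebra_simps add_divide_distrib)
    also have "\<dots> = - sin (s + real j * (pi / 2))"
      by (subst cos_add) simp
    finally show ?thesis by (auto intro!: derivative_eq_intros)
  qed
  from smooth_comp[of "\<lambda>j s. cos (s + real j * (pi / 2))", OF this u, of 0] show ?thesis by simp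
qed

text \<open>The upper bound is \<open>1 + t \<le> exp t\<close> at \<open>t = 1 / s\<close>.\<close>

lemma softplus'_nonneg: "0 \<le> softplus' s"
  and softplus'_le_1: "softplus' s \<le> 1"
proof -
  show "0 \<le> softplus' s" unfolding softplus'_eq by simp
  have "(1 + 1 / s) * exp (- (1 / s)) \<le> exp (1 / s) * exp (- (1 / s))"
    by (intro mult_right_mono) (auto simp: exp_ge_add_one_self)
  thus "softplus' s \<le> 1" unfolding softplus'_eq by (auto simp: mult_exp_exp)
qed

lemma softplus_nonneg: "0 \<le> softplus s"
  by (simp add: softplus_def)

lemma softplus_eq_0_iff: "softplus s = 0 \<longleftrightarrow> s \<le> 0"
  by (auto simp: softplus_def)

lemma continuous_on_softplus': "continuous_on A softplus'"
  by (meson DERIV_isCont softplus_derivs_has_derivative continuous_at_imp_continuous_on)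

lemma softplus_lipschitz: "\<bar>softplus s - softplus t\<bar> \<le> \<bar>s - t\<bar>"
proof -
  have "norm (softplus s - softplus t) \<le> 1 * norm (s - t)"
    by (rule field_differentiable_bound[of UNIV softplus softplus'])
      (use softplus_has_derivative softplus'_nonneg softplus'_le_1 in
        \<open>auto simp: has_field_derivative_at_within simp del: softplus_derivs.simps One_nat_def\<close>)
  thus ?thesis by simp
qed

lemma grad_softplus:
  assumes "u differentiable (at x)"
  shows "grad (\<lambda>x. softplus (u x)) x = softplus' (u x) *\<^sub>R grad u x"
  by (rule grad_eqI)
    (use has_derivative_compose[OF has_derivative_grad[OF assms],
        of softplus "(*) (softplus' (u x))"] softplus_has_derivative[of "u x"] in
      \<open>auto simp: has_field_derivative_def\<close>)

section \<open>Integration by parts and the directional Poincare inequality\<close>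

lemma lborel_integral_translation:
  fixes f :: "'a::euclidean_space \<Rightarrow> real"
  assumes [measurable]: "f \<in> borel_measurable borel"
  shows "(\<integral>x. f (a + x) \<partial>lborel) = (\<integral>x. f x \<partial>lborel)"
proof -
  have "(\<integral>x. f x \<partial>lborel) = (\<integral>x. f x \<partial>distr lborel borel ((+) a))"
    by (simp add: lborel_distr_plus)
  also have "\<dots> = (\<integral>x. f (a + x) \<partial>lborel)"
    by (rule integral_distr) auto
  finally show ?thesis by simp
qed

lemma lborel_integrable_translation:
  fixes f :: "'a::euclidean_space \<Rightarrow> real"
  assumes "integrable lborel f"
  shows "integrable lborel (\<lambda>x. f (a + x))"
proof -
  have "integrable (distr lborel borel ((+) a)) f"
    using assms by (simp add: lborel_distr_plus)
  thus ?thesis by (rule integrable_distr[rotated]) auto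
qed

lemma integrable_compact_support:
  fixes f :: "'a::euclidean_space \<Rightarrow> 'b::{banach, second_countable_topology}"
  assumes "compact K" "continuous_on K f" "\<And>x. x \<notin> K \<Longrightarrow> f x = 0"
  shows "integrable lborel f"
proof -
  have "f = (\<lambda>x. indicator K x *\<^sub>R f x)"
    using assms(3) by (auto simp: indicator_def)
  thus ?thesis using borel_integrable_compact[OF assms(1,2)] by simp
qed

text \<open>By translation invariance the difference quotients of \<open>F\<close> in direction \<open>e\<close> have integral zero.\<close>

lemma integral_directional_derivative_eq_0:
  fixes F :: "'a::euclidean_space \<Rightarrow> real"
  assumes K: "compact K" "K \<subseteq> U" and F0: "\<And>x. x \<notin> K \<Longrightarrow> F x = 0"
    and D: "\<And>x. x \<in> U \<Longrightarrow> (F has_derivative F' x) (at x)"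
    and cont: "continuous_on U (\<lambda>x. F' x e)"
    and F'0: "\<And>x. x \<notin> K \<Longrightarrow> F' x e = 0"
  shows "integrable lborel (\<lambda>x. F' x e)" "(\<integral>x. F' x e \<partial>lborel) = 0"
proof -
  have contK: "continuous_on K (\<lambda>x. F' x e)" using cont K continuous_on_subset by blast
  show int: "integrable lborel (\<lambda>x. F' x e)"
    using integrable_compact_support[OF K(1) contK F'0] by blast
  \<comment> \<open>\<open>F' x\<close> is known to be a derivative on \<open>U\<close> only. Off
    \<open>K\<close> the function vanishes near \<open>x\<close>, so it is differentiable there too,
    with a derivative that agrees with \<open>F' x\<close> in direction \<open>e\<close>. This
    admits an \<open>F\<close> with a factor that is differentiable on \<open>U\<close>
    alone.\<close>
  have D': "\<exists>G. (F has_derivative G) (at x) \<and> G e = F' x e" for x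
  proof (cases "x \<in> K")
    case True
    thus ?thesis using D K by blast
  next
    case False
    have "((\<lambda>x. 0) has_derivative (\<lambda>h. 0)) (at x)" by auto
    hence "(F has_derivative (\<lambda>h. 0)) (at x)"
      by (rule has_derivative_transform_within_open[where s = "- K"])
        (use False F0 K in \<open>auto simp: compact_imp_closed\<close>)
    thus ?thesis using F'0[OF False] by (intro exI[of _ "\<lambda>h. 0"]) auto
  qed
  have contF: "continuous_on A F" for A
    by (meson D' has_derivative_continuous continuous_at_imp_continuous_on)
  have F_borel[measurable]: "F \<in> borel_measurable borel"
    using contF borel_measurable_continuous_onI by blast
  have intF: "integrable lborel F"
    using integrable_compact_support[OF K(1) contF F0] by blast
  have line: "((\<lambda>\<tau>. F (x + \<tau> *\<^sub>R e)) has_real_derivative F' (x + \<tau> *\<^sub>R e) e) (at \<tau>)" for x \<tau>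
  proof -
    obtain G where G: "(F has_derivative G) (at (x + \<tau> *\<^sub>R e))" "G e = F' (x + \<tau> *\<^sub>R e) e"
      using D' by blast
    have "((\<lambda>\<tau>. x + \<tau> *\<^sub>R e) has_derivative (\<lambda>h. h *\<^sub>R e)) (at \<tau>)"
      by (auto intro!: derivative_eq_intros)
    from has_derivative_compose[OF this G(1)]
    have "((\<lambda>\<tau>. F (x + \<tau> *\<^sub>R e)) has_derivative (\<lambda>h. G (h *\<^sub>R e))) (at \<tau>)" .
    moreover have "(\<lambda>h. G (h *\<^sub>R e)) = (\<lambda>h. F' (x + \<tau> *\<^sub>R e) e * h)"
      using G has_derivative_linear[OF G(1)] by (auto simp: linear_scale)
    ultimately show ?thesis by (simp add: has_field_derivative_def)
  qed
  obtain B where B: "\<And>x. \<bar>F' x e\<bar> \<le> B" "B \<ge> 0"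
  proof -
    have "bounded ((\<lambda>x. F' x e) ` K)"
      using compact_continuous_image[OF contK K(1)] compact_imp_bounded by blast
    then obtain B where "\<And>x. x \<in> K \<Longrightarrow> \<bar>F' x e\<bar> \<le> B"
      unfolding bounded_iff by auto
    hence "\<bar>F' x e\<bar> \<le> max B 0" for x using F'0[of x] by (cases "x \<in> K") fastforce+
    thus ?thesis using that[of "max B 0"] by simp
  qed
  obtain R where R: "K \<subseteq> cball 0 R"
    using compact_imp_bounded[OF K(1)] unfolding bounded_iff by (auto simp: subset_iff)
  define s where "s n = inverse (real (Suc n))" for n
  have s: "s n > 0" "s n \<le> 1" for n by (auto simp: s_def field_simps)
  define q where "q n x = (F (x + s n *\<^sub>R e) - F x) / s n" for n x
  \<comment> \<open>The mean value theorem bounds the quotient by \<open>B\<close>; since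
    \<open>s n \<le> 1\<close>, both \<open>x\<close> and \<open>x + s n *\<^sub>R e\<close> miss
    \<open>K\<close> once \<open>norm x > R + norm e\<close>. This is an integrable majorant
    independent of \<open>n\<close>.\<close>
  have q_bound: "norm (q n x) \<le> B * indicator (cball (0::'a) (R + norm e)) x" for n x
  proof -
    have mv: "\<bar>q n x\<bar> \<le> B"
    proof -
      obtain z where "F (x + s n *\<^sub>R e) - F (x + 0 *\<^sub>R e) = (s n - 0) * F' (x + z *\<^sub>R e) e"
        using MVT2[OF s(1)[of n], of "\<lambda>\<tau>. F (x + \<tau> *\<^sub>R e)" "\<lambda>z. F' (x + z *\<^sub>R e) e"] line by blast
      hence "q n x = F' (x + z *\<^sub>R e) e" using s[of n] by (simp add: q_def)
      thus ?thesis using B by simp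
    qed
    show ?thesis
    proof (cases "x \<in> cball 0 (R + norm e)")
      case True
      thus ?thesis using mv by simp
    next
      case False
      hence x: "norm x > R + norm e" by simp
      have "norm (s n *\<^sub>R e) \<le> norm e" using s[of n] by (simp add: mult_left_le_one_le)
      moreover have "norm x - norm (s n *\<^sub>R e) \<le> norm (x + s n *\<^sub>R e)"
        by (metis add_diff_cancel_right' norm_triangle_ineq4 diff_le_eq add.commute)
      ultimately have "norm (x + s n *\<^sub>R e) > R" using x by linarith
      hence "F (x + s n *\<^sub>R e) = 0" using F0 R by force
      moreover have "norm x > R" using x norm_ge_zero[of e] by linarith
      hence "F x = 0" using F0 R by force
      ultimately show ?thesis using False by (simp add: q_def)
    qed
  qed
  have "(\<lambda>n. \<integral>x. q n x \<partial>lborel) \<longlonglongrightarrow> (\<integral>x. F' x e \<partial>lborel)"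
  proof (rule integral_dominated_convergence)
    show "(\<lambda>x. F' x e) \<in> borel_measurable lborel" using int by auto
    show "q n \<in> borel_measurable lborel" for n unfolding q_def[abs_def] by measurable
    show "integrable lborel (\<lambda>x. B * indicator (cball (0::'a) (R + norm e)) x)"
      using emeasure_lborel_cball_finite[of "0::'a" "R + norm e"]
      by (intro integrable_mult_right integrable_real_indicator) (auto simp: less_top)
    show "AE x in lborel. norm (q n x) \<le> B * indicator (cball (0::'a) (R + norm e)) x" for n
      using q_bound by auto
    show "AE x in lborel. (\<lambda>n. q n x) \<longlonglongrightarrow> F' x e"
    proof (rule AE_I2)
      fix x
      have "((\<lambda>h. (F (x + h *\<^sub>R e) - F x) / h) \<longlongrightarrow> F' x e) (at 0)"
        using line[of x 0] by (simp add: DERIV_def)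
      moreover have "filterlim s (at 0) sequentially"
        unfolding filterlim_at using s(1) LIMSEQ_inverse_real_of_nat
        by (auto simp: s_def[abs_def] intro: eventuallyI)
      ultimately show "(\<lambda>n. q n x) \<longlonglongrightarrow> F' x e"
        unfolding q_def by (rule filterlim_compose)
    qed
  qed
  moreover have "(\<integral>x. q n x \<partial>lborel) = 0" for n
  proof -
    have "(\<integral>x. q n x \<partial>lborel) = ((\<integral>x. F (s n *\<^sub>R e + x) \<partial>lborel) - (\<integral>x. F x \<partial>lborel)) / s n"
      unfolding q_def using lborel_integrable_translation[OF intF, of "s n *\<^sub>R e"] intF
      by (simp add: add.commute)
    thus ?thesis by (simp add: lborel_integral_translation)
  qed
  ultimately show "(\<integral>x. F' x e \<partial>lborel) = 0"
    by (simp add: LIMSEQ_const_iff)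
qed

abbreviation supp :: "('a::euclidean_space \<Rightarrow> real) \<Rightarrow> 'a set" where
  "supp \<phi> \<equiv> closure {x. \<phi> x \<noteq> 0}"

lemma test_funD:
  assumes "test_fun \<Omega> \<phi>"
  shows "smooth \<phi>" "compact (supp \<phi>)" "supp \<phi> \<subseteq> \<Omega>"
  using assms by (auto simp: test_fun_def)

lemma not_in_supp:
  assumes "x \<notin> supp \<phi>"
  shows "\<phi> x = 0" "grad \<phi> x = 0"
proof -
  show "\<phi> x = 0" using assms closure_subset[of "{x. \<phi> x \<noteq> 0}"] by auto
  have "((\<lambda>x. 0) has_derivative (\<lambda>h. 0 \<bullet> h)) (at x)" by auto
  hence "(\<phi> has_derivative (\<lambda>h. 0 \<bullet> h)) (at x)"
    by (rule has_derivative_transform_within_open[where s = "- supp \<phi>"])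
      (use assms closure_subset[of "{x. \<phi> x \<noteq> 0}"] in auto)
  thus "grad \<phi> x = 0" by (rule grad_eqI)
qed

lemma test_fun_outside:
  assumes "test_fun \<Omega> \<phi>" "x \<notin> \<Omega>"
  shows "\<phi> x = 0" "grad \<phi> x = 0"
  using not_in_supp[of x \<phi>] test_funD(3)[OF assms(1)] assms(2) by blast+

lemma integrable_test_fun_cont:
  fixes f :: "'a::euclidean_space \<Rightarrow> 'b::{banach, second_countable_topology}"
  assumes "test_fun \<Omega> \<phi>" "continuous_on UNIV f" "\<And>x. \<phi> x = 0 \<Longrightarrow> grad \<phi> x = 0 \<Longrightarrow> f x = 0"
  shows "integrable lborel f"
  using integrable_compact_support[OF test_funD(2)[OF assms(1)], of f]
    continuous_on_subset[OF assms(2)] assms(3) not_in_supp by blast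

lemma test_fun_continuous:
  assumes "test_fun \<Omega> \<phi>"
  shows "continuous_on A \<phi>" "continuous_on A (grad \<phi>)"
  using test_funD(1)[OF assms] smooth_continuous continuous_on_grad by blast+

text \<open>With \<open>T x = k * tan (k * (a \<bullet> x + b))\<close>, whose derivative along \<open>e\<close> is \<open>k\<^sup>2 + T\<^sup>2\<close>, one integrates
  \<open>0 \<le> (grad \<phi> x \<bullet> e + \<phi> x * T x)\<^sup>2\<close> by parts; no slicing into lines is needed.\<close>

lemma poincare_direction:
  fixes \<phi> :: "'a::euclidean_space \<Rightarrow> real"
  assumes t: "test_fun \<Omega> \<phi>" and ae: "a \<bullet> e = 1"
    and r: "\<And>x. x \<in> \<Omega> \<Longrightarrow> \<bar>a \<bullet> x + b\<bar> \<le> r" and k: "0 < k" "k * r < pi / 2"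
  shows "k\<^sup>2 * (\<integral>x. (\<phi> x)\<^sup>2 \<partial>lborel) \<le> (\<integral>x. (grad \<phi> x \<bullet> e)\<^sup>2 \<partial>lborel)"
proof -
  define \<theta> where "\<theta> x = k * (a \<bullet> x + b)" for x
  define T where "T x = k * tan (\<theta> x)" for x
  define F' where "F' x h = 2 * \<phi> x * (grad \<phi> x \<bullet> h) * T x + (\<phi> x)\<^sup>2 * (k\<^sup>2 + (T x)\<^sup>2) * (a \<bullet> h)" for x h
  define U where "U = {x. cos (\<theta> x) \<noteq> 0}"
  \<comment> \<open>The strict inequality \<open>k * r < pi / 2\<close> keeps the argument of the
    tangent away from its poles on all of \<open>\<Omega>\<close>.\<close>
  have U: "supp \<phi> \<subseteq> U"
  proof
    fix x assume "x \<in> supp \<phi>"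
    hence "x \<in> \<Omega>" using test_funD(3)[OF t] by blast
    hence "\<bar>\<theta> x\<bar> \<le> k * r" using r[of x] k by (simp add: \<theta>_def abs_mult)
    hence "\<theta> x < pi / 2" "- (pi / 2) < \<theta> x" using k by linarith+
    hence "cos (\<theta> x) > 0" by (intro cos_gt_zero_pi) auto
    thus "x \<in> U" by (simp add: U_def)
  qed
  have F'0: "F' x h = 0" if "x \<notin> supp \<phi>" for x h
    using not_in_supp[OF that] by (simp add: F'_def)
  have dT: "(T has_derivative (\<lambda>h. (k\<^sup>2 + (T x)\<^sup>2) * (a \<bullet> h))) (at x)" if "x \<in> U" for x
  proof -
    have c: "cos (\<theta> x) \<noteq> 0" using that by (simp add: U_def)
    have "(tan has_derivative (*) (inverse ((cos (\<theta> x))\<^sup>2))) (at (\<theta> x))"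
      using DERIV_tan[OF c] by (simp add: has_field_derivative_def)
    moreover have "(\<theta> has_derivative (\<lambda>h. k * (a \<bullet> h))) (at x)"
      unfolding \<theta>_def[abs_def] by (auto intro!: derivative_eq_intros)
    ultimately have "((\<lambda>x. tan (\<theta> x)) has_derivative (\<lambda>h. inverse ((cos (\<theta> x))\<^sup>2) * (k * (a \<bullet> h)))) (at x)"
      using has_derivative_compose by blast
    hence "(T has_derivative (\<lambda>h. k * (inverse ((cos (\<theta> x))\<^sup>2) * (k * (a \<bullet> h))))) (at x)"
      unfolding T_def[abs_def] by (rule has_derivative_mult_right)
    moreover have "k * (inverse ((cos (\<theta> x))\<^sup>2) * (k * (a \<bullet> h))) = (k\<^sup>2 + (T x)\<^sup>2) * (a \<bullet> h)" for h
    proof -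
      have "inverse ((cos (\<theta> x))\<^sup>2) = 1 + (tan (\<theta> x))\<^sup>2"
        using tan_sec[OF c] by (simp add: power_inverse)
      thus ?thesis by (simp add: T_def power2_eq_square algebra_simps)
    qed
    ultimately show ?thesis by simp
  qed
  have dF: "((\<lambda>x. (\<phi> x)\<^sup>2 * T x) has_derivative F' x) (at x)" if "x \<in> U" for x
    using has_derivative_mult[OF has_derivative_power[OF
        has_derivative_grad[OF smooth_differentiable[OF test_funD(1)[OF t]]], of 2] dT[OF that]]
    by (rule has_derivative_eq_rhs) (auto simp: F'_def fun_eq_iff algebra_simps)
  have contT: "continuous_on U T"
    using dT has_derivative_continuous continuous_at_imp_continuous_on by blast
  have contF': "continuous_on U (\<lambda>x. F' x e)"
    unfolding F'_def by (intro continuous_intros contT test_fun_continuous[OF t])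
  note div = integral_directional_derivative_eq_0[OF test_funD(2)[OF t] U _ dF contF' F'0]
  have div0: "integrable lborel (\<lambda>x. F' x e)" "(\<integral>x. F' x e \<partial>lborel) = 0"
    using div not_in_supp(1) by (auto simp: power2_eq_square)
  have i1: "integrable lborel (\<lambda>x. (grad \<phi> x \<bullet> e)\<^sup>2)"
    by (rule integrable_test_fun_cont[OF t]) (auto intro!: continuous_intros test_fun_continuous[OF t])
  have i2: "integrable lborel (\<lambda>x. (\<phi> x)\<^sup>2)"
    by (rule integrable_test_fun_cont[OF t]) (auto intro!: continuous_intros test_fun_continuous[OF t])
  have pos: "0 \<le> (grad \<phi> x \<bullet> e)\<^sup>2 - k\<^sup>2 * (\<phi> x)\<^sup>2 + F' x e" for x
  proof -
    have "(grad \<phi> x \<bullet> e)\<^sup>2 - k\<^sup>2 * (\<phi> x)\<^sup>2 + F' x e = (grad \<phi> x \<bullet> e + \<phi> x * T x)\<^sup>2"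
      by (simp add: F'_def ae power2_eq_square algebra_simps)
    thus ?thesis by simp
  qed
  have "0 \<le> (\<integral>x. (grad \<phi> x \<bullet> e)\<^sup>2 - k\<^sup>2 * (\<phi> x)\<^sup>2 + F' x e \<partial>lborel)"
    using pos by (intro integral_nonneg_AE) auto
  also have "\<dots> = (\<integral>x. (grad \<phi> x \<bullet> e)\<^sup>2 \<partial>lborel) - k\<^sup>2 * (\<integral>x. (\<phi> x)\<^sup>2 \<partial>lborel)"
    using i1 i2 div0 by simp
  finally show ?thesis by simp
qed

text \<open>Each product of \<open>partial_deriv i q\<close> with \<open>\<phi>\<close> has compact
  support, so the integral of its derivative in direction \<open>i\<close> vanishes; summing the
  product rule over the basis gives Green's identity.\<close>

lemma integral_grad_laplace:
  fixes \<phi> q :: "'a::euclidean_space \<Rightarrow> real"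
  assumes t: "test_fun \<Omega> \<phi>" and q: "smooth q"
  shows "(\<integral>x. grad q x \<bullet> grad \<phi> x \<partial>lborel) =
         - (\<integral>x. (\<Sum>i\<in>Basis. partial_deriv i (partial_deriv i q) x) * \<phi> x \<partial>lborel)"
proof -
  have z: "integrable lborel (\<lambda>x. partial_deriv i q x * partial_deriv i \<phi> x + partial_deriv i (partial_deriv i q) x * \<phi> x)
     \<and> (\<integral>x. partial_deriv i q x * partial_deriv i \<phi> x + partial_deriv i (partial_deriv i q) x * \<phi> x \<partial>lborel) = 0"
    if i: "i \<in> Basis" for i
  proof -
    define F' where "F' x h = partial_deriv i q x * (grad \<phi> x \<bullet> h) + (grad (partial_deriv i q) x \<bullet> h) * \<phi> x" for x h
    have F'i: "F' x i = partial_deriv i q x * partial_deriv i \<phi> x + partial_deriv i (partial_deriv i q) x * \<phi> x" for x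
      by (simp add: F'_def grad_inner_Basis[OF i])
    have sq: "smooth (partial_deriv i q)" using smooth_partial_deriv[OF q i] .
    have d: "((\<lambda>x. partial_deriv i q x * \<phi> x) has_derivative F' x) (at x)" for x
      unfolding F'_def[abs_def]
      by (rule has_derivative_mult[OF has_derivative_grad[OF smooth_differentiable[OF sq]]
            has_derivative_grad[OF smooth_differentiable[OF test_funD(1)[OF t]]]])
    have c: "continuous_on UNIV (\<lambda>x. F' x i)"
      unfolding F'_def
      by (intro continuous_on_add continuous_on_mult continuous_on_inner continuous_on_const
          smooth_continuous[OF sq] continuous_on_grad[OF sq] test_fun_continuous[OF t])
    have "integrable lborel (\<lambda>x. F' x i)" "(\<integral>x. F' x i \<partial>lborel) = 0"
    proof -
      have F0: "partial_deriv i q x * \<phi> x = 0" "F' x i = 0" if "x \<notin> supp \<phi>" for x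
        using not_in_supp[OF that] by (auto simp: F'_def)
      note * = integral_directional_derivative_eq_0[where F' = F' and e = i,
          OF test_funD(2)[OF t] subset_UNIV F0(1) d c F0(2)]
      show "integrable lborel (\<lambda>x. F' x i)" "(\<integral>x. F' x i \<partial>lborel) = 0"
        by (rule *; assumption)+
    qed
    thus ?thesis by (simp add: F'i)
  qed
  have i1: "integrable lborel (\<lambda>x. partial_deriv i q x * partial_deriv i \<phi> x)" if i: "i \<in> Basis" for i
    by (rule integrable_test_fun_cont[OF t])
      (use smooth_continuous[OF smooth_partial_deriv[OF q i]]
          smooth_continuous[OF smooth_partial_deriv[OF test_funD(1)[OF t] i]] in
        \<open>auto intro!: continuous_on_mult simp: grad_inner_Basis[OF i, symmetric]\<close>)
  have i2: "integrable lborel (\<lambda>x. partial_deriv i (partial_deriv i q) x * \<phi> x)" if i: "i \<in> Basis" for i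
    by (rule integrable_test_fun_cont[OF t])
      (use smooth_continuous[OF smooth_partial_deriv[OF smooth_partial_deriv[OF q i] i]]
          test_fun_continuous[OF t] in \<open>auto intro!: continuous_on_mult\<close>)
  have "grad q x \<bullet> grad \<phi> x = (\<Sum>i\<in>Basis. partial_deriv i q x * partial_deriv i \<phi> x)" for x
    by (subst euclidean_inner) (simp add: grad_inner_Basis)
  hence "(\<integral>x. grad q x \<bullet> grad \<phi> x \<partial>lborel) = (\<Sum>i\<in>Basis. \<integral>x. partial_deriv i q x * partial_deriv i \<phi> x \<partial>lborel)"
    by (simp add: i1)
  also have "\<dots> = (\<Sum>i\<in>Basis. - (\<integral>x. partial_deriv i (partial_deriv i q) x * \<phi> x \<partial>lborel))"
    using z i1 i2 by (intro sum.cong) (auto simp: eq_neg_iff_add_eq_0)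
  also have "\<dots> = - (\<integral>x. (\<Sum>i\<in>Basis. partial_deriv i (partial_deriv i q) x) * \<phi> x \<partial>lborel)"
    by (simp add: sum_distrib_right sum_negf i2)
  finally show ?thesis .
qed

section \<open>Square-integrable functions\<close>

definition L2 :: "'a measure \<Rightarrow> ('a \<Rightarrow> 'b::euclidean_space) \<Rightarrow> bool" where
  "L2 M f \<longleftrightarrow> f \<in> borel_measurable M \<and> integrable M (\<lambda>x. (norm (f x))\<^sup>2)"

lemma L2_D:
  assumes "L2 M f"
  shows "f \<in> borel_measurable M" "integrable M (\<lambda>x. (norm (f x))\<^sup>2)"
  using assms by (auto simp: L2_def)

lemma norm_sq_add_le: "(norm (a + b))\<^sup>2 \<le> 2 * (norm a)\<^sup>2 + 2 * (norm (b::'b::real_inner))\<^sup>2"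
proof -
  have "(norm (a + b))\<^sup>2 + (norm (a - b))\<^sup>2 = 2 * (norm a)\<^sup>2 + 2 * (norm b)\<^sup>2"
    by (simp add: power2_norm_eq_inner inner_add_left inner_add_right inner_diff_left inner_diff_right inner_commute)
  thus ?thesis using zero_le_power2[of "norm (a - b)"] by linarith
qed

lemma L2_add:
  assumes "L2 M f" "L2 M g"
  shows "L2 M (\<lambda>x. f x + g x)"
  unfolding L2_def
proof
  note [measurable] = L2_D(1)[OF assms(1)] L2_D(1)[OF assms(2)]
  show "(\<lambda>x. f x + g x) \<in> borel_measurable M" by measurable
  have "integrable M (\<lambda>x. 2 * (norm (f x))\<^sup>2 + 2 * (norm (g x))\<^sup>2)"
    using assms by (auto simp: L2_def)
  thus "integrable M (\<lambda>x. (norm (f x + g x))\<^sup>2)"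
    by (rule Bochner_Integration.integrable_bound) (auto intro!: AE_I2 norm_sq_add_le)
qed

lemma L2_scaleR:
  assumes "L2 M f"
  shows "L2 M (\<lambda>x. c *\<^sub>R f x)"
  using assms by (auto simp: L2_def power_mult_distrib)

lemma L2_diff:
  assumes "L2 M f" "L2 M g"
  shows "L2 M (\<lambda>x. f x - g x)"
  using L2_add[OF assms(1) L2_scaleR[OF assms(2), of "-1"]] by simp

lemma L2_inner:
  assumes "L2 M f" "L2 M g"
  shows "integrable M (\<lambda>x. f x \<bullet> g x)"
proof -
  note [measurable] = L2_D(1)[OF assms(1)] L2_D(1)[OF assms(2)]
  have cs: "\<bar>a \<bullet> b\<bar> \<le> (norm a)\<^sup>2 + (norm b)\<^sup>2" for a b :: 'b
  proof -
    have "\<bar>a \<bullet> b\<bar> \<le> norm a * norm b" by (rule Cauchy_Schwarz_ineq2)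
    also have "\<dots> \<le> (norm a)\<^sup>2 + (norm b)\<^sup>2"
      using sum_squares_bound[of "norm a" "norm b"] mult_nonneg_nonneg[OF norm_ge_zero norm_ge_zero, of a b]
      by linarith
    finally show ?thesis .
  qed
  have "integrable M (\<lambda>x. (norm (f x))\<^sup>2 + (norm (g x))\<^sup>2)"
    using assms by (auto simp: L2_def)
  thus ?thesis
  proof (rule Bochner_Integration.integrable_bound)
    show "(\<lambda>x. f x \<bullet> g x) \<in> borel_measurable M" by measurable
    show "AE x in M. norm (f x \<bullet> g x) \<le> norm ((norm (f x))\<^sup>2 + (norm (g x))\<^sup>2)"
    proof (rule AE_I2)
      fix x
      show "norm (f x \<bullet> g x) \<le> norm ((norm (f x))\<^sup>2 + (norm (g x))\<^sup>2)"
        using cs[of "f x" "g x"] by simp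
    qed
  qed
qed

lemma L2_dominated:
  assumes "L2 M g" "f \<in> borel_measurable M" "AE x in M. norm (f x) \<le> norm (g x)"
  shows "L2 M f"
  unfolding L2_def
proof
  show m[measurable]: "f \<in> borel_measurable M" by fact
  show "integrable M (\<lambda>x. (norm (f x))\<^sup>2)"
    by (rule Bochner_Integration.integrable_bound[OF L2_D(2)[OF assms(1)]])
      (use assms(3) in \<open>auto intro: power_mono elim!: eventually_mono\<close>)
qed

lemma L2_norm_sq_add:
  assumes "L2 M f" "L2 M g"
  shows "(\<integral>x. (norm (f x + c *\<^sub>R g x))\<^sup>2 \<partial>M) =
    (\<integral>x. (norm (f x))\<^sup>2 \<partial>M) + 2 * c * (\<integral>x. f x \<bullet> g x \<partial>M) + c\<^sup>2 * (\<integral>x. (norm (g x))\<^sup>2 \<partial>M)"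
proof -
  have "(norm (f x + c *\<^sub>R g x))\<^sup>2 = (norm (f x))\<^sup>2 + 2 * c * (f x \<bullet> g x) + c\<^sup>2 * (norm (g x))\<^sup>2" for x
    unfolding power2_norm_eq_inner
    by (simp add: inner_add_left inner_add_right inner_commute power2_eq_square algebra_simps)
  thus ?thesis using L2_inner[OF assms] L2_D(2)[OF assms(1)] L2_D(2)[OF assms(2)] by simp
qed

text \<open>The discriminant criterion, including the degenerate case \<open>c = 0\<close>, which
  occurs for functions that vanish almost everywhere. Besides Cauchy-Schwarz it serves, with
  \<open>a = 0\<close>, to turn a one-sided variational inequality into an equation.\<close>

lemma nonneg_quadratic_imp:
  fixes a b c :: real
  assumes "\<And>t. 0 \<le> a + 2 * t * b + t\<^sup>2 * c" "c \<ge> 0"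
  shows "b\<^sup>2 \<le> a * c"
proof (cases "c = 0")
  case True
  have "b = 0"
  proof (rule ccontr)
    assume "b \<noteq> 0"
    hence "a + 2 * (- (a + 1) / (2 * b)) * b = -1" by (simp add: field_simps)
    thus False using assms(1)[of "- (a + 1) / (2 * b)"] True by simp
  qed
  thus ?thesis using True by simp
next
  case False
  hence "c > 0" using assms by simp
  moreover have "a + 2 * (- b / c) * b + (- b / c)\<^sup>2 * c = a - b\<^sup>2 / c"
    using \<open>c > 0\<close> by (simp add: field_simps power2_eq_square)
  ultimately have "b\<^sup>2 / c \<le> a" using assms(1)[of "- b / c"] by linarith
  thus ?thesis using \<open>c > 0\<close> by (simp add: divide_le_eq)
qed

lemma L2_Cauchy_Schwarz:
  assumes "L2 M f" "L2 M g"
  shows "(\<integral>x. f x \<bullet> g x \<partial>M)\<^sup>2 \<le> (\<integral>x. (norm (f x))\<^sup>2 \<partial>M) * (\<integral>x. (norm (g x))\<^sup>2 \<partial>M)"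
proof (rule nonneg_quadratic_imp)
  show "0 \<le> (\<integral>x. (norm (f x))\<^sup>2 \<partial>M) + 2 * t * (\<integral>x. f x \<bullet> g x \<partial>M) + t\<^sup>2 * (\<integral>x. (norm (g x))\<^sup>2 \<partial>M)" for t
    unfolding L2_norm_sq_add[OF assms, symmetric] by simp
qed simp

lemma power2_tendsto_0D:
  fixes a :: "'a \<Rightarrow> real"
  assumes "((\<lambda>n. (a n)\<^sup>2) \<longlongrightarrow> 0) F"
  shows "(a \<longlongrightarrow> 0) F"
  using tendsto_real_sqrt[OF assms] by (simp add: tendsto_rabs_zero_iff)

lemma L2_tendsto_inner:
  assumes "\<And>n. L2 M (f n)" "L2 M f0" "L2 M h"
    and lim: "(\<lambda>n. \<integral>x. (norm (f0 x - f n x))\<^sup>2 \<partial>M) \<longlonglongrightarrow> 0"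
  shows "(\<lambda>n. \<integral>x. f n x \<bullet> h x \<partial>M) \<longlonglongrightarrow> (\<integral>x. f0 x \<bullet> h x \<partial>M)"
proof -
  have "(\<lambda>n. (\<integral>x. (f0 x - f n x) \<bullet> h x \<partial>M)\<^sup>2) \<longlonglongrightarrow> 0"
  proof (rule tendsto_sandwich[OF _ _ tendsto_const])
    show "(\<lambda>n. (\<integral>x. (norm (f0 x - f n x))\<^sup>2 \<partial>M) * (\<integral>x. (norm (h x))\<^sup>2 \<partial>M)) \<longlonglongrightarrow> 0"
      using tendsto_mult_left_zero[OF lim] .
  qed (auto intro!: always_eventually L2_Cauchy_Schwarz L2_diff assms)
  hence "(\<lambda>n. \<integral>x. (f0 x - f n x) \<bullet> h x \<partial>M) \<longlonglongrightarrow> 0"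
    by (rule power2_tendsto_0D)
  moreover have "(\<integral>x. (f0 x - f n x) \<bullet> h x \<partial>M) = (\<integral>x. f0 x \<bullet> h x \<partial>M) - (\<integral>x. f n x \<bullet> h x \<partial>M)" for n
    using L2_inner[OF assms(1) assms(3)] L2_inner[OF assms(2) assms(3)] by (simp add: inner_diff_left)
  ultimately have "(\<lambda>n. (\<integral>x. f0 x \<bullet> h x \<partial>M) - (\<integral>x. f n x \<bullet> h x \<partial>M)) \<longlonglongrightarrow> 0" by simp
  from tendsto_diff[OF tendsto_const[of "\<integral>x. f0 x \<bullet> h x \<partial>M"] this] show ?thesis by simp
qed

lemma L2_tendsto_norm_sq:
  assumes f: "\<And>n. L2 M (f n)" "L2 M f0"
    and lim: "(\<lambda>n. \<integral>x. (norm (f0 x - f n x))\<^sup>2 \<partial>M) \<longlonglongrightarrow> 0"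
  shows "(\<lambda>n. \<integral>x. (norm (f n x))\<^sup>2 \<partial>M) \<longlonglongrightarrow> (\<integral>x. (norm (f0 x))\<^sup>2 \<partial>M)"
proof -
  let ?N = "\<integral>x. (norm (f0 x))\<^sup>2 \<partial>M"
  have eq: "(\<integral>x. (norm (f n x))\<^sup>2 \<partial>M) =
      (\<integral>x. (norm (f0 x - f n x))\<^sup>2 \<partial>M) + 2 * (\<integral>x. f n x \<bullet> f0 x \<partial>M) - ?N" for n
    using L2_norm_sq_add[OF f(2) f(1)[of n], of "-1"] by (simp add: inner_commute)
  have "(\<lambda>n. \<integral>x. f n x \<bullet> f0 x \<partial>M) \<longlonglongrightarrow> ?N"
    using L2_tendsto_inner[OF f f(2) lim] by (simp only: power2_norm_eq_inner)
  from tendsto_diff[OF tendsto_add[OF lim tendsto_mult[OF tendsto_const[of 2] this]] tendsto_const[of ?N]]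
  show ?thesis by (simp add: eq)
qed

lemma L2_AE_subseq:
  fixes f :: "nat \<Rightarrow> 'a \<Rightarrow> 'b::euclidean_space"
  assumes "\<And>n. L2 M (f n)" "L2 M f0"
    and lim: "(\<lambda>n. \<integral>x. (norm (f0 x - f n x))\<^sup>2 \<partial>M) \<longlonglongrightarrow> 0"
  obtains r :: "nat \<Rightarrow> nat" where "strict_mono r" "AE x in M. (\<lambda>n. f (r n) x) \<longlonglongrightarrow> f0 x"
proof -
  have "\<exists>r::nat\<Rightarrow>nat. strict_mono r \<and> (AE x in M. (\<lambda>n. (norm (f0 x - f (r n) x))\<^sup>2) \<longlonglongrightarrow> 0)"
    by (rule tendsto_L1_AE_subseq) (use lim L2_D(2)[OF L2_diff[OF assms(2,1)]] in auto)
  then obtain r :: "nat \<Rightarrow> nat" where r: "strict_mono r"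
    "AE x in M. (\<lambda>n. (norm (f0 x - f (r n) x))\<^sup>2) \<longlonglongrightarrow> 0" by blast
  have "AE x in M. (\<lambda>n. f (r n) x) \<longlonglongrightarrow> f0 x"
    using r(2)
  proof (rule eventually_mono)
    fix x assume "(\<lambda>n. (norm (f0 x - f (r n) x))\<^sup>2) \<longlonglongrightarrow> 0"
    hence "(\<lambda>n. f0 x - f (r n) x) \<longlonglongrightarrow> 0"
      by (rule tendsto_norm_zero_cancel[OF power2_tendsto_0D])
    from tendsto_diff[OF tendsto_const[of "f0 x"] this] show "(\<lambda>n. f (r n) x) \<longlonglongrightarrow> f0 x" by simp
  qed
  thus ?thesis using that r by blast
qed

text \<open>Riesz-Fischer: a sufficiently fast subsequence converges almost everywhere, and Fatou's
  lemma carries the Cauchy estimate over to the limit, so no majorant for the limit has to be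
  found.\<close>

theorem L2_complete:
  fixes f :: "nat \<Rightarrow> 'a \<Rightarrow> 'b::euclidean_space"
  assumes L: "\<And>n. L2 M (f n)"
    and Cauchy: "\<And>e. e > 0 \<Longrightarrow> \<exists>N. \<forall>m\<ge>N. \<forall>n\<ge>N. (\<integral>x. (norm (f m x - f n x))\<^sup>2 \<partial>M) < e"
  obtains f0 where "L2 M f0" "(\<lambda>n. \<integral>x. (norm (f0 x - f n x))\<^sup>2 \<partial>M) \<longlonglongrightarrow> 0"
proof -
  note [measurable] = L2_D(1)[OF L]
  have "\<forall>k. \<exists>N. \<forall>m\<ge>N. \<forall>n\<ge>N. (\<integral>x. (norm (f m x - f n x))\<^sup>2 \<partial>M) < (1/4) ^ k"
    using Cauchy by simp
  then obtain N where N: "\<And>k m n. m \<ge> N k \<Longrightarrow> n \<ge> N k \<Longrightarrow> (\<integral>x. (norm (f m x - f n x))\<^sup>2 \<partial>M) < (1/4) ^ k"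
    by metis
  \<comment> \<open>Adding up the thresholds makes the indices nondecreasing and at least
    \<open>N k\<close>; the summand \<open>k\<close> makes them tend to infinity.\<close>
  define r where "r k = k + (\<Sum>j\<le>k. N j)" for k
  have rN: "r k \<ge> N k" for k
    using member_le_sum[of k "{..k}" N] by (simp add: r_def trans_le_add2)
  have r_mono: "r k \<le> r (Suc k)" for k by (simp add: r_def)
  have r_ge: "r k \<ge> k" for k by (simp add: r_def)
  define d where "d k x = norm (f (r (Suc k)) x - f (r k) x)" for k x
  have d_int: "(\<integral>x. (d k x)\<^sup>2 \<partial>M) \<le> (1/4) ^ k" for k
    using N[of k "r (Suc k)" "r k"] rN[of k] r_mono[of k] by (simp add: d_def less_imp_le order_trans)
  have d_integrable: "integrable M (\<lambda>x. (d k x)\<^sup>2)" for k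
    using L2_D(2)[OF L2_diff[OF L L]] by (simp add: d_def)
  have [measurable]: "d k \<in> borel_measurable M" for k unfolding d_def[abs_def] by measurable
  \<comment> \<open>The weight \<open>2 ^ k\<close> is chosen between two needs: squared gaps of
    integral at most \<open>(1/4) ^ k\<close> remain summable after weighting, and
    \<open>d \<le> 2 ^ k * d^2 + (1/2) ^ k\<close> turns weighted squares into absolute summability
    of the gaps themselves.\<close>
  have A: "(\<integral>\<^sup>+x. (\<Sum>k. ennreal (2 ^ k * (d k x)\<^sup>2)) \<partial>M) = (\<Sum>k. \<integral>\<^sup>+x. ennreal (2 ^ k * (d k x)\<^sup>2) \<partial>M)"
    by (rule nn_integral_suminf) measurable
  have B: "(\<Sum>k. \<integral>\<^sup>+x. ennreal (2 ^ k * (d k x)\<^sup>2) \<partial>M) = (\<Sum>k. ennreal (2 ^ k * (\<integral>x. (d k x)\<^sup>2 \<partial>M)))"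
  proof (rule suminf_cong)
    fix k
    have "integrable M (\<lambda>x. 2 ^ k * (d k x)\<^sup>2)" using d_integrable[of k] by simp
    from nn_integral_eq_integral[OF this]
    show "(\<integral>\<^sup>+x. ennreal (2 ^ k * (d k x)\<^sup>2) \<partial>M) = ennreal (2 ^ k * (\<integral>x. (d k x)\<^sup>2 \<partial>M))"
      by simp
  qed
  have C: "(\<Sum>k. ennreal (2 ^ k * (\<integral>x. (d k x)\<^sup>2 \<partial>M))) \<le> (\<Sum>k. ennreal ((1/2) ^ k))"
  proof (rule suminf_le)
    fix k
    have "2 ^ k * (\<integral>x. (d k x)\<^sup>2 \<partial>M) \<le> 2 ^ k * (1/4) ^ k"
      using d_int[of k] by simp
    also have "\<dots> = (1/2::real) ^ k" by (simp add: power_mult_distrib[symmetric])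
    finally show "ennreal (2 ^ k * (\<integral>x. (d k x)\<^sup>2 \<partial>M)) \<le> ennreal ((1/2) ^ k)"
      by (rule ennreal_leI)
  qed (rule summableI)+
  have D: "(\<Sum>k. ennreal ((1/2::real) ^ k)) < \<infinity>"
  proof -
    have "(\<Sum>k. ennreal ((1/2::real) ^ k)) = ennreal (\<Sum>k. (1/2) ^ k)"
      by (intro suminf_ennreal2 summable_geometric) auto
    thus ?thesis by simp
  qed
  have "(\<integral>\<^sup>+x. (\<Sum>k. ennreal (2 ^ k * (d k x)\<^sup>2)) \<partial>M) < \<infinity>"
    unfolding A B by (rule order.strict_trans1[OF C D])
  hence "AE x in M. (\<Sum>k. ennreal (2 ^ k * (d k x)\<^sup>2)) \<noteq> \<infinity>"
    by (intro nn_integral_noteq_infinite) (simp_all add: less_top)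
  hence conv: "AE x in M. (\<lambda>k. f (r k) x) \<longlonglongrightarrow> lim (\<lambda>k. f (r k) x)"
  proof (rule eventually_mono)
    fix x assume "(\<Sum>k. ennreal (2 ^ k * (d k x)\<^sup>2)) \<noteq> \<infinity>"
    hence s: "summable (\<lambda>k. 2 ^ k * (d k x)\<^sup>2)"
      by (intro summable_suminf_not_top) auto
    have s2: "summable (\<lambda>k. 2 ^ k * (d k x)\<^sup>2 + (1/2) ^ k)"
      by (intro summable_add s summable_geometric) auto
    have le: "d k x \<le> 2 ^ k * (d k x)\<^sup>2 + (1/2) ^ k" for k
    proof -
      have "0 \<le> (2 ^ k * d k x - 1/2)\<^sup>2" by simp
      hence "2 ^ k * d k x \<le> 2 ^ k * (2 ^ k * (d k x)\<^sup>2) + 1"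
        by (simp add: power2_eq_square algebra_simps)
      also have "\<dots> = 2 ^ k * (2 ^ k * (d k x)\<^sup>2 + (1/2) ^ k)"
        by (simp add: algebra_simps power_mult_distrib[symmetric])
      finally show ?thesis by (rule mult_left_le_imp_le) simp
    qed
    have "summable (\<lambda>k. norm (f (r (Suc k)) x - f (r k) x))"
      by (rule summable_comparison_test'[OF s2, of 0]) (use le in \<open>simp add: d_def\<close>)
    hence "summable (\<lambda>k. f (r (Suc k)) x - f (r k) x)" by (rule summable_norm_cancel)
    hence "convergent (\<lambda>n. \<Sum>k<n. f (r (Suc k)) x - f (r k) x)"
      by (simp add: summable_iff_convergent)
    moreover have "(\<Sum>k<n. f (r (Suc k)) x - f (r k) x) = f (r n) x - f (r 0) x" for n
      by (rule sum_lessThan_telescope)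
    ultimately have "convergent (\<lambda>n. f (r n) x - f (r 0) x)" by simp
    hence "convergent (\<lambda>n. f (r n) x)"
      using convergent_add[OF _ convergent_const, of "\<lambda>n. f (r n) x - f (r 0) x" "f (r 0) x"] by simp
    thus "(\<lambda>k. f (r k) x) \<longlonglongrightarrow> lim (\<lambda>k. f (r k) x)" by (simp add: convergent_LIMSEQ_iff)
  qed
  define f0 where "f0 x = lim (\<lambda>k. f (r k) x)" for x
  have [measurable]: "f0 \<in> borel_measurable M" unfolding f0_def[abs_def] by measurable
  have fatou: "(\<integral>\<^sup>+x. ennreal ((norm (f0 x - f n x))\<^sup>2) \<partial>M) \<le> ennreal ((1/4) ^ k)" if n: "n \<ge> N k" for n k
  proof -
    have "(\<integral>\<^sup>+x. ennreal ((norm (f0 x - f n x))\<^sup>2) \<partial>M) =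
        (\<integral>\<^sup>+x. liminf (\<lambda>j. ennreal ((norm (f (r j) x - f n x))\<^sup>2)) \<partial>M)"
    proof (rule nn_integral_cong_AE, rule eventually_mono[OF conv])
      fix x assume "(\<lambda>k. f (r k) x) \<longlonglongrightarrow> lim (\<lambda>k. f (r k) x)"
      hence "(\<lambda>j. ennreal ((norm (f (r j) x - f n x))\<^sup>2)) \<longlonglongrightarrow> ennreal ((norm (f0 x - f n x))\<^sup>2)"
        unfolding f0_def by (intro tendsto_intros tendsto_ennrealI)
      thus "ennreal ((norm (f0 x - f n x))\<^sup>2) = liminf (\<lambda>j. ennreal ((norm (f (r j) x - f n x))\<^sup>2))"
        by (rule lim_imp_Liminf[OF trivial_limit_sequentially, symmetric])
    qed
    also have "\<dots> \<le> liminf (\<lambda>j. \<integral>\<^sup>+x. ennreal ((norm (f (r j) x - f n x))\<^sup>2) \<partial>M)"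
      by (rule nn_integral_liminf) measurable
    also have "\<dots> \<le> liminf (\<lambda>j. ennreal ((1/4) ^ k))"
    proof (rule Liminf_mono)
      show "\<forall>\<^sub>F j in sequentially. (\<integral>\<^sup>+x. ennreal ((norm (f (r j) x - f n x))\<^sup>2) \<partial>M) \<le> ennreal ((1/4) ^ k)"
        using eventually_ge_at_top[of "N k"]
      proof (rule eventually_mono)
        fix j assume "j \<ge> N k"
        hence "r j \<ge> N k" using r_ge[of j] by simp
        thus "(\<integral>\<^sup>+x. ennreal ((norm (f (r j) x - f n x))\<^sup>2) \<partial>M) \<le> ennreal ((1/4) ^ k)"
          by (subst nn_integral_eq_integral)
            (use N[of k "r j" n] n L2_D(2)[OF L2_diff[OF L L]] in \<open>auto intro!: ennreal_leI less_imp_le\<close>)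
      qed
    qed
    also have "\<dots> = ennreal ((1/4) ^ k)" by (rule Liminf_const) simp
    finally show ?thesis .
  qed
  have diffL: "L2 M (\<lambda>x. f0 x - f (N k) x)" for k
    unfolding L2_def
  proof
    show "integrable M (\<lambda>x. (norm (f0 x - f (N k) x))\<^sup>2)"
      by (rule integrableI_bounded) (use fatou[of k "N k"] in \<open>auto intro: le_less_trans\<close>)
  qed measurable
  have f0: "L2 M f0"
    using L2_add[OF diffL[of 0] L[of "N 0"]] by simp
  have "(\<lambda>n. \<integral>x. (norm (f0 x - f n x))\<^sup>2 \<partial>M) \<longlonglongrightarrow> 0"
  proof (rule LIMSEQ_I)
    fix e :: real assume "e > 0"
    then obtain k where k: "(1/4::real) ^ k < e" using real_arch_pow_inv[of e "1/4"] by auto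
    have "norm ((\<integral>x. (norm (f0 x - f n x))\<^sup>2 \<partial>M) - 0) < e" if "n \<ge> N k" for n
    proof -
      have "ennreal (\<integral>x. (norm (f0 x - f n x))\<^sup>2 \<partial>M) \<le> ennreal ((1/4) ^ k)"
        using fatou[OF that] L2_D(2)[OF L2_diff[OF f0 L[of n]]] by (subst (asm) nn_integral_eq_integral) auto
      thus ?thesis using k by (simp add: ennreal_le_iff)
    qed
    thus "\<exists>no. \<forall>n\<ge>no. norm ((\<integral>x. (norm (f0 x - f n x))\<^sup>2 \<partial>M) - 0) < e" by blast
  qed
  with f0 show ?thesis using that by blast
qed

section \<open>The space H01\<close>

lemma set_integral_lebesgue_on:
  fixes f :: "'a::euclidean_space \<Rightarrow> 'b::{banach, second_countable_topology}"
  assumes "\<Omega> \<in> sets lebesgue"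
  shows "(LINT x:\<Omega>|lebesgue. f x) = integral\<^sup>L (lebesgue_on \<Omega>) f"
    and "set_integrable lebesgue \<Omega> f \<longleftrightarrow> integrable (lebesgue_on \<Omega>) f"
  using assms
  by (auto simp: set_lebesgue_integral_def set_integrable_def integral_restrict_space integrable_restrict_space)

text \<open>Test functions are integrated over the whole space with \<open>lborel\<close>, elements
  of \<open>H01\<close> over \<open>lebesgue_on \<Omega>\<close>; this is the bridge between the two
  settings.\<close>

lemma lebesgue_on_eq_lborel:
  fixes f :: "'a::euclidean_space \<Rightarrow> 'b::{banach, second_countable_topology}"
  assumes "\<Omega> \<in> sets lebesgue" "f \<in> borel_measurable borel" "\<And>x. x \<notin> \<Omega> \<Longrightarrow> f x = 0"
  shows "integral\<^sup>L (lebesgue_on \<Omega>) f = integral\<^sup>L lborel f"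
    and "integrable (lebesgue_on \<Omega>) f \<longleftrightarrow> integrable lborel f"
proof -
  have *: "(\<lambda>x. indicator \<Omega> x *\<^sub>R f x) = f"
    using assms(3) by (auto simp: indicator_def fun_eq_iff)
  have f: "f \<in> borel_measurable lborel" using assms(2) by simp
  show "integral\<^sup>L (lebesgue_on \<Omega>) f = integral\<^sup>L lborel f"
    using assms(1) integral_completion[OF f] by (simp add: integral_restrict_space *)
  show "integrable (lebesgue_on \<Omega>) f \<longleftrightarrow> integrable lborel f"
    using assms(1) integrable_completion[OF f] by (simp add: integrable_restrict_space *)
qed

lemma measurable_lebesgue_onI:
  "f \<in> borel_measurable lebesgue \<Longrightarrow> f \<in> borel_measurable (lebesgue_on \<Omega>)"
  by (rule measurable_restrict_space1)

lemma continuous_measurable_lebesgue_on: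
  fixes f :: "'a::euclidean_space \<Rightarrow> 'b::euclidean_space"
  assumes "continuous_on UNIV f"
  shows "f \<in> borel_measurable (lebesgue_on \<Omega>)"
  using borel_measurable_continuous_onI[OF assms]
  by (intro measurable_lebesgue_onI measurable_completion) simp

lemma test_fun_L2:
  assumes "\<Omega> \<in> sets lebesgue" "test_fun \<Omega> \<phi>"
  shows "L2 (lebesgue_on \<Omega>) \<phi>" "L2 (lebesgue_on \<Omega>) (grad \<phi>)"
proof -
  note c = test_fun_continuous[OF assms(2), of UNIV]
  have c2: "continuous_on UNIV (\<lambda>x. (norm (\<phi> x))\<^sup>2)" "continuous_on UNIV (\<lambda>x. (norm (grad \<phi> x))\<^sup>2)"
    by (intro continuous_on_power continuous_on_norm c)+
  have "integrable lborel (\<lambda>x. (norm (\<phi> x))\<^sup>2)"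
    by (rule integrable_test_fun_cont[OF assms(2) c2(1)]) simp
  moreover have "integrable lborel (\<lambda>x. (norm (grad \<phi> x))\<^sup>2)"
    by (rule integrable_test_fun_cont[OF assms(2) c2(2)]) simp
  ultimately show "L2 (lebesgue_on \<Omega>) \<phi>" "L2 (lebesgue_on \<Omega>) (grad \<phi>)"
    unfolding L2_def
    using lebesgue_on_eq_lborel(2)[OF assms(1) borel_measurable_continuous_onI[OF c2(1)]]
      lebesgue_on_eq_lborel(2)[OF assms(1) borel_measurable_continuous_onI[OF c2(2)]]
      test_fun_outside[OF assms(2)] continuous_measurable_lebesgue_on[OF c(1)]
      continuous_measurable_lebesgue_on[OF c(2)]
    by simp_all
qed

lemma H01E:
  assumes \<Omega>: "\<Omega> \<in> sets lebesgue" and H: "H01 \<Omega> u g"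
  obtains \<phi> where "\<And>n. test_fun \<Omega> (\<phi> n)" "L2 (lebesgue_on \<Omega>) u" "L2 (lebesgue_on \<Omega>) g"
    "(\<lambda>n. \<integral>x. (norm (u x - \<phi> n x))\<^sup>2 \<partial>lebesgue_on \<Omega>) \<longlonglongrightarrow> 0"
    "(\<lambda>n. \<integral>x. (norm (g x - grad (\<phi> n) x))\<^sup>2 \<partial>lebesgue_on \<Omega>) \<longlonglongrightarrow> 0"
proof -
  let ?M = "lebesgue_on \<Omega>"
  from H obtain \<phi> where t: "\<And>n. test_fun \<Omega> (\<phi> n)" and
    lim: "(\<lambda>n. (\<integral>x. (norm (u x - \<phi> n x))\<^sup>2 \<partial>?M) + (\<integral>x. (norm (g x - grad (\<phi> n) x))\<^sup>2 \<partial>?M)) \<longlonglongrightarrow> 0"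
    unfolding H01_def set_integral_lebesgue_on[OF \<Omega>] by auto
  have "(\<lambda>n. \<integral>x. (norm (u x - \<phi> n x))\<^sup>2 \<partial>?M) \<longlonglongrightarrow> 0"
    by (rule tendsto_sandwich[OF _ _ tendsto_const lim]) auto
  moreover have "(\<lambda>n. \<integral>x. (norm (g x - grad (\<phi> n) x))\<^sup>2 \<partial>?M) \<longlonglongrightarrow> 0"
    by (rule tendsto_sandwich[OF _ _ tendsto_const lim]) auto
  moreover have "L2 ?M u" "L2 ?M g"
    using H measurable_lebesgue_onI unfolding H01_def set_integral_lebesgue_on[OF \<Omega>] L2_def by auto
  ultimately show ?thesis using that t by blast
qed

lemma H01I:
  assumes \<Omega>: "\<Omega> \<in> sets lebesgue"
    and m: "u \<in> borel_measurable lebesgue" "g \<in> borel_measurable lebesgue"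
    and L: "L2 (lebesgue_on \<Omega>) u" "L2 (lebesgue_on \<Omega>) g"
    and t: "\<And>n. test_fun \<Omega> (\<phi> n)"
    and lim: "(\<lambda>n. \<integral>x. (norm (u x - \<phi> n x))\<^sup>2 \<partial>lebesgue_on \<Omega>) \<longlonglongrightarrow> 0"
      "(\<lambda>n. \<integral>x. (norm (g x - grad (\<phi> n) x))\<^sup>2 \<partial>lebesgue_on \<Omega>) \<longlonglongrightarrow> 0"
  shows "H01 \<Omega> u g"
proof -
  have "(\<lambda>n. (\<integral>x. (u x - \<phi> n x)\<^sup>2 \<partial>lebesgue_on \<Omega>)
      + (\<integral>x. (norm (g x - grad (\<phi> n) x))\<^sup>2 \<partial>lebesgue_on \<Omega>)) \<longlonglongrightarrow> 0"
    using tendsto_add[OF lim] by simp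
  thus ?thesis
    unfolding H01_def set_integral_lebesgue_on[OF \<Omega>]
    using m L t by (auto simp: L2_def)
qed

lemma H01_test_fun:
  assumes "\<Omega> \<in> sets lebesgue" "test_fun \<Omega> \<phi>"
  shows "H01 \<Omega> \<phi> (grad \<phi>)"
proof (rule H01I[where \<phi> = "\<lambda>n. \<phi>"])
  note c = test_fun_continuous[OF assms(2), of UNIV]
  show "\<phi> \<in> borel_measurable lebesgue" "grad \<phi> \<in> borel_measurable lebesgue"
    using borel_measurable_continuous_onI[OF c(1)] borel_measurable_continuous_onI[OF c(2)]
    by (auto intro: measurable_completion)
qed (use assms test_fun_L2 in auto)

text \<open>Both sides are continuous along the approximating sequence of test functions, so the
  inequality passes to the closure.\<close>

lemma H01_poincare:
  assumes \<Omega>: "\<Omega> \<in> sets lebesgue" and H: "H01 \<Omega> u g"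
    and P: "\<And>\<phi>. test_fun \<Omega> \<phi> \<Longrightarrow> C * (\<integral>x. (\<phi> x)\<^sup>2 \<partial>lborel) \<le> (\<integral>x. (norm (grad \<phi> x))\<^sup>2 \<partial>lborel)"
  shows "C * (\<integral>x. (u x)\<^sup>2 \<partial>lebesgue_on \<Omega>) \<le> (\<integral>x. (norm (g x))\<^sup>2 \<partial>lebesgue_on \<Omega>)"
proof -
  let ?M = "lebesgue_on \<Omega>"
  obtain \<phi> where t: "\<And>n. test_fun \<Omega> (\<phi> n)" and L: "L2 ?M u" "L2 ?M g"
    and lim: "(\<lambda>n. \<integral>x. (norm (u x - \<phi> n x))\<^sup>2 \<partial>?M) \<longlonglongrightarrow> 0"
    "(\<lambda>n. \<integral>x. (norm (g x - grad (\<phi> n) x))\<^sup>2 \<partial>?M) \<longlonglongrightarrow> 0"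
    by (rule H01E[OF \<Omega> H]) (rule that; assumption)
  have "C * (\<integral>x. (norm (\<phi> n x))\<^sup>2 \<partial>?M) \<le> (\<integral>x. (norm (grad (\<phi> n) x))\<^sup>2 \<partial>?M)" for n
  proof -
    note c = test_fun_continuous[OF t[of n], of UNIV]
    have "(\<integral>x. (norm (\<phi> n x))\<^sup>2 \<partial>?M) = (\<integral>x. (norm (\<phi> n x))\<^sup>2 \<partial>lborel)"
      by (rule lebesgue_on_eq_lborel[OF \<Omega>])
        (use test_fun_outside[OF t[of n]] in \<open>auto intro!: borel_measurable_continuous_onI continuous_intros c\<close>)
    moreover have "(\<integral>x. (norm (grad (\<phi> n) x))\<^sup>2 \<partial>?M) = (\<integral>x. (norm (grad (\<phi> n) x))\<^sup>2 \<partial>lborel)"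
      by (rule lebesgue_on_eq_lborel[OF \<Omega>])
        (use test_fun_outside[OF t[of n]] in \<open>auto intro!: borel_measurable_continuous_onI continuous_intros c\<close>)
    ultimately show ?thesis using P[OF t[of n]] by simp
  qed
  moreover have "(\<lambda>n. C * (\<integral>x. (norm (\<phi> n x))\<^sup>2 \<partial>?M)) \<longlonglongrightarrow> C * (\<integral>x. (norm (u x))\<^sup>2 \<partial>?M)"
    by (intro tendsto_mult tendsto_const L2_tendsto_norm_sq test_fun_L2[OF \<Omega> t] L lim)
  moreover have "(\<lambda>n. (\<integral>x. (norm (grad (\<phi> n) x))\<^sup>2 \<partial>?M)) \<longlonglongrightarrow> (\<integral>x. (norm (g x))\<^sup>2 \<partial>?M)"
    by (intro L2_tendsto_norm_sq test_fun_L2[OF \<Omega> t] L lim)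
  ultimately have "C * (\<integral>x. (norm (u x))\<^sup>2 \<partial>?M) \<le> (\<integral>x. (norm (g x))\<^sup>2 \<partial>?M)"
    using LIMSEQ_le by blast
  thus ?thesis by simp
qed

lemma L2_continuous_bounded:
  fixes f :: "'a::euclidean_space \<Rightarrow> 'b::euclidean_space"
  assumes \<Omega>: "\<Omega> \<in> sets lebesgue" "bounded \<Omega>" and c: "continuous_on UNIV f"
  shows "L2 (lebesgue_on \<Omega>) f"
  unfolding L2_def
proof
  show m: "f \<in> borel_measurable (lebesgue_on \<Omega>)" by (rule continuous_measurable_lebesgue_on[OF c])
  have "compact (closure \<Omega>)" using \<Omega> by simp
  hence "bounded (f ` closure \<Omega>)"
    by (intro compact_imp_bounded compact_continuous_image continuous_on_subset[OF c]) auto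
  then obtain B where B: "\<And>x. x \<in> closure \<Omega> \<Longrightarrow> norm (f x) \<le> B"
    unfolding bounded_iff by blast
  have fin: "finite_measure (lebesgue_on \<Omega>)"
    using \<Omega> by (intro finite_measure_lebesgue_on) (simp add: bounded_set_imp_lmeasurable)
  show "integrable (lebesgue_on \<Omega>) (\<lambda>x. (norm (f x))\<^sup>2)"
  proof (rule finite_measure.integrable_const_bound[OF fin, of _ "B\<^sup>2"])
    show "AE x in lebesgue_on \<Omega>. norm ((norm (f x))\<^sup>2) \<le> B\<^sup>2"
    proof (rule AE_I2)
      fix x assume "x \<in> space (lebesgue_on \<Omega>)"
      hence "x \<in> closure \<Omega>" using closure_subset by (auto simp: space_restrict_space)
      thus "norm ((norm (f x))\<^sup>2) \<le> B\<^sup>2" using B power_mono[OF B norm_ge_zero] by simp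
    qed
    show "(\<lambda>x. (norm (f x))\<^sup>2) \<in> borel_measurable (lebesgue_on \<Omega>)" using m by measurable
  qed
qed

definition laplacian :: "('a::euclidean_space \<Rightarrow> real) \<Rightarrow> 'a \<Rightarrow> real" where
  "laplacian q x = (\<Sum>i\<in>Basis. partial_deriv i (partial_deriv i q) x)"

lemma continuous_on_laplacian: "smooth q \<Longrightarrow> continuous_on A (laplacian q)"
  unfolding laplacian_def[abs_def]
  by (intro continuous_on_sum smooth_continuous smooth_partial_deriv)

text \<open>On a bounded \<open>\<Omega>\<close> the gradient and Laplacian of the smooth
  \<open>q\<close> are square-integrable, so Green's identity for test functions survives the limit
  in \<open>L2\<close>.\<close>

lemma H01_grad_laplace:
  fixes u q :: "'a::euclidean_space \<Rightarrow> real"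
  assumes \<Omega>: "\<Omega> \<in> sets lebesgue" "bounded \<Omega>" and H: "H01 \<Omega> u g" and q: "smooth q"
  shows "(\<integral>x. grad q x \<bullet> g x \<partial>lebesgue_on \<Omega>) = - (\<integral>x. laplacian q x * u x \<partial>lebesgue_on \<Omega>)"
proof -
  let ?M = "lebesgue_on \<Omega>"
  obtain \<phi> where t: "\<And>n. test_fun \<Omega> (\<phi> n)" and L: "L2 ?M u" "L2 ?M g"
    and lim: "(\<lambda>n. \<integral>x. (norm (u x - \<phi> n x))\<^sup>2 \<partial>?M) \<longlonglongrightarrow> 0"
    "(\<lambda>n. \<integral>x. (norm (g x - grad (\<phi> n) x))\<^sup>2 \<partial>?M) \<longlonglongrightarrow> 0"
    by (rule H01E[OF \<Omega>(1) H]) (rule that; assumption)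
  have cg: "continuous_on UNIV (grad q)" using continuous_on_grad[OF q] .
  have cl: "continuous_on UNIV (laplacian q)" using continuous_on_laplacian[OF q] .
  have eq: "(\<integral>x. grad (\<phi> n) x \<bullet> grad q x \<partial>?M) = - (\<integral>x. \<phi> n x \<bullet> laplacian q x \<partial>?M)" for n
  proof -
    note c = test_fun_continuous[OF t[of n], of UNIV]
    have "(\<integral>x. grad (\<phi> n) x \<bullet> grad q x \<partial>?M) = (\<integral>x. grad (\<phi> n) x \<bullet> grad q x \<partial>lborel)"
      by (rule lebesgue_on_eq_lborel[OF \<Omega>(1)])
        (use test_fun_outside[OF t[of n]] in \<open>auto intro!: borel_measurable_continuous_onI continuous_on_inner c cg\<close>)
    moreover have "(\<integral>x. \<phi> n x \<bullet> laplacian q x \<partial>?M) = (\<integral>x. \<phi> n x \<bullet> laplacian q x \<partial>lborel)"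
      by (rule lebesgue_on_eq_lborel[OF \<Omega>(1)])
        (use test_fun_outside[OF t[of n]] in \<open>auto intro!: borel_measurable_continuous_onI continuous_on_mult c cl\<close>)
    ultimately show ?thesis
      using integral_grad_laplace[OF t[of n] q]
      by (simp add: laplacian_def mult.commute inner_commute[of "grad (\<phi> n) _"])
  qed
  have "(\<lambda>n. \<integral>x. grad (\<phi> n) x \<bullet> grad q x \<partial>?M) \<longlonglongrightarrow> (\<integral>x. g x \<bullet> grad q x \<partial>?M)"
    by (intro L2_tendsto_inner test_fun_L2[OF \<Omega>(1) t] L lim L2_continuous_bounded \<Omega> cg)
  moreover have "(\<lambda>n. - (\<integral>x. \<phi> n x \<bullet> laplacian q x \<partial>?M)) \<longlonglongrightarrow> - (\<integral>x. u x \<bullet> laplacian q x \<partial>?M)"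
    by (intro tendsto_minus L2_tendsto_inner test_fun_L2[OF \<Omega>(1) t] L lim L2_continuous_bounded \<Omega> cl)
  ultimately have "(\<integral>x. g x \<bullet> grad q x \<partial>?M) = - (\<integral>x. u x \<bullet> laplacian q x \<partial>?M)"
    unfolding eq using LIMSEQ_unique by blast
  thus ?thesis by (simp add: mult.commute inner_commute)
qed

section \<open>The torsion function: existence and comparison\<close>

lemma grad_lincomb:
  assumes "f differentiable (at x)" "g differentiable (at x)"
  shows "grad (\<lambda>x. a * f x + b * g x) x = a *\<^sub>R grad f x + b *\<^sub>R grad g x"
proof (rule grad_eqI)
  have "((\<lambda>x. a * f x + b * g x) has_derivative (\<lambda>h. a * (grad f x \<bullet> h) + b * (grad g x \<bullet> h))) (at x)"
    by (intro has_derivative_add has_derivative_mult_right has_derivative_grad assms)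
  thus "((\<lambda>x. a * f x + b * g x) has_derivative (\<lambda>h. (a *\<^sub>R grad f x + b *\<^sub>R grad g x) \<bullet> h)) (at x)"
    by (simp add: inner_add_left)
qed

lemma test_funI_supp:
  assumes "smooth f" "compact K" "K \<subseteq> \<Omega>" "\<And>x. x \<notin> K \<Longrightarrow> f x = 0"
  shows "test_fun \<Omega> f"
proof -
  have "supp f \<subseteq> K"
    using assms(2,4) by (intro closure_minimal) (auto simp: compact_imp_closed)
  moreover from this have "compact (supp f)"
    using assms(2) by (metis closed_closure compact_Int_closed inf.absorb_iff2)
  ultimately show ?thesis using assms by (auto simp: test_fun_def)
qed

lemma test_fun_lincomb:
  assumes "test_fun \<Omega> f" "test_fun \<Omega> g"
  shows "test_fun \<Omega> (\<lambda>x. a * f x + b * g x)"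
proof (rule test_funI_supp[where K = "supp f \<union> supp g"])
  show "smooth (\<lambda>x. a * f x + b * g x)"
    by (intro smooth_add smooth_mult smooth_const test_funD(1)[OF assms(1)] test_funD(1)[OF assms(2)])
  show "compact (supp f \<union> supp g)" "supp f \<union> supp g \<subseteq> \<Omega>"
    using test_funD[OF assms(1)] test_funD[OF assms(2)] by auto
  show "a * f x + b * g x = 0" if "x \<notin> supp f \<union> supp g" for x
    using that not_in_supp(1)[of x f] not_in_supp(1)[of x g] by simp
qed

lemma grad_test_lincomb:
  assumes "test_fun \<Omega> f" "test_fun \<Omega> g"
  shows "grad (\<lambda>x. a * f x + b * g x) x = a *\<^sub>R grad f x + b *\<^sub>R grad g x"
  by (intro grad_lincomb smooth_differentiable test_funD(1)[OF assms(1)] test_funD(1)[OF assms(2)])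

text \<open>The direct method: for the energy \<open>E\<close>, a minimising sequence of test
  functions is Cauchy in \<open>H01\<close>, and its limit satisfies the Euler-Lagrange equation,
  which is the weak form of the torsion problem.\<close>

theorem torsion_exists:
  fixes \<Omega> :: "'a::euclidean_space set"
  assumes \<Omega>: "\<Omega> \<in> sets lebesgue" "bounded \<Omega>" and C: "C > 0"
    and P: "\<And>\<phi>. test_fun \<Omega> \<phi> \<Longrightarrow> C * (\<integral>x. (\<phi> x)\<^sup>2 \<partial>lborel) \<le> (\<integral>x. (norm (grad \<phi> x))\<^sup>2 \<partial>lborel)"
  shows "\<exists>v. is_torsion \<Omega> v"
proof -
  let ?M = "lebesgue_on \<Omega>"
  define E where "E \<phi> = (\<integral>x. (norm (grad \<phi> x))\<^sup>2 \<partial>?M) - 2 * (\<integral>x. \<phi> x \<partial>?M)" for \<phi> :: "'a \<Rightarrow> real"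
  have one: "L2 ?M (\<lambda>x. 1::real)" by (intro L2_continuous_bounded \<Omega> continuous_on_const)
  have int: "integrable ?M f" if "L2 ?M f" for f :: "'a \<Rightarrow> real"
    using L2_inner[OF that one] by simp
  have tint: "integrable ?M \<phi>" if "test_fun \<Omega> \<phi>" for \<phi>
    using int test_fun_L2(1)[OF \<Omega>(1) that] by blast
  have poin: "C * (\<integral>x. (\<phi> x)\<^sup>2 \<partial>?M) \<le> (\<integral>x. (norm (grad \<phi> x))\<^sup>2 \<partial>?M)" if "test_fun \<Omega> \<phi>" for \<phi>
    by (rule H01_poincare[OF \<Omega>(1) H01_test_fun[OF \<Omega>(1) that] P])
  \<comment> \<open>The linear term is absorbed by
    \<open>2 * \<phi> \<le> C * \<phi>^2 + 1 / C\<close>, whose quadratic part is controlled by the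
    Poincare inequality with the same constant \<open>C\<close>.\<close>
  have bdd: "- measure ?M \<Omega> / C \<le> E \<phi>" if t: "test_fun \<Omega> \<phi>" for \<phi>
  proof -
    have "2 * (\<integral>x. \<phi> x \<partial>?M) = (\<integral>x. 2 * \<phi> x \<partial>?M)" by simp
    also have "\<dots> \<le> (\<integral>x. C * (\<phi> x)\<^sup>2 + 1 / C \<partial>?M)"
    proof (rule integral_mono)
      show "integrable ?M (\<lambda>x. 2 * \<phi> x)" using tint[OF t] by simp
      show "integrable ?M (\<lambda>x. C * (\<phi> x)\<^sup>2 + 1 / C)"
        using L2_D(2)[OF test_fun_L2(1)[OF \<Omega>(1) t]] L2_D(2)[OF one] by simp
      fix x
      have "0 \<le> (C * \<phi> x - 1)\<^sup>2" by simp
      hence "2 * \<phi> x * C \<le> (C * (\<phi> x)\<^sup>2 + 1 / C) * C"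
        using C by (simp add: power2_eq_square algebra_simps)
      thus "2 * \<phi> x \<le> C * (\<phi> x)\<^sup>2 + 1 / C" using C by simp
    qed
    also have "\<dots> = C * (\<integral>x. (\<phi> x)\<^sup>2 \<partial>?M) + measure ?M \<Omega> / C"
      using L2_D(2)[OF test_fun_L2(1)[OF \<Omega>(1) t]] L2_D(2)[OF one] by (simp add: space_restrict_space)
    finally show ?thesis using poin[OF t] by (simp add: E_def)
  qed
  define I where "I = Inf (E ` {\<phi>. test_fun \<Omega> \<phi>})"
  have bb: "bdd_below (E ` {\<phi>. test_fun \<Omega> \<phi>})" using bdd by (intro bdd_belowI2) auto
  have I_le: "I \<le> E \<phi>" if "test_fun \<Omega> \<phi>" for \<phi>
    unfolding I_def using that by (intro cInf_lower bb) auto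
  have "test_fun \<Omega> (\<lambda>x. 0)" by (rule test_funI_supp[where K = "{}"]) (auto simp: smooth_const)
  hence ne: "E ` {\<phi>. test_fun \<Omega> \<phi>} \<noteq> {}" by blast
  have "\<exists>\<phi>. test_fun \<Omega> \<phi> \<and> E \<phi> < I + inverse (real (Suc n))" for n
    using cInf_lessD[OF ne, of "I + inverse (real (Suc n))"] unfolding I_def by fastforce
  then obtain \<phi> where t: "\<And>n. test_fun \<Omega> (\<phi> n)" and En: "\<And>n. E (\<phi> n) < I + inverse (real (Suc n))"
    by metis
  note L = test_fun_L2(1)[OF \<Omega>(1) t] and Lg = test_fun_L2(2)[OF \<Omega>(1) t]
  \<comment> \<open>The midpoint of \<open>\<phi> m\<close> and \<open>\<phi> n\<close> competes for
    the infimum. The linear part of \<open>E\<close> is additive, so the parallelogram law for the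
    gradients makes the energy of the midpoint smaller than the mean energy by a quarter of the
    squared distance of the gradients.\<close>
  have dg: "(\<integral>x. (norm (grad (\<phi> m) x - grad (\<phi> n) x))\<^sup>2 \<partial>?M) \<le> 2 * (inverse (real (Suc m)) + inverse (real (Suc n)))" for m n
  proof -
    let ?h = "\<lambda>x. 1/2 * \<phi> m x + 1/2 * \<phi> n x"
    have th: "test_fun \<Omega> ?h" by (rule test_fun_lincomb[OF t t])
    have gh: "grad ?h x = (1/2) *\<^sub>R grad (\<phi> m) x + (1/2) *\<^sub>R grad (\<phi> n) x" for x
      by (rule grad_test_lincomb[OF t t])
    have par: "(norm (grad ?h x))\<^sup>2 =
        1/2 * (norm (grad (\<phi> m) x))\<^sup>2 + 1/2 * (norm (grad (\<phi> n) x))\<^sup>2 - 1/4 * (norm (grad (\<phi> m) x - grad (\<phi> n) x))\<^sup>2" for x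
      unfolding gh power2_norm_eq_inner
      by (simp add: inner_add_left inner_add_right inner_diff_left inner_diff_right inner_commute field_simps)
    have "(\<integral>x. (norm (grad ?h x))\<^sup>2 \<partial>?M) = 1/2 * (\<integral>x. (norm (grad (\<phi> m) x))\<^sup>2 \<partial>?M)
        + 1/2 * (\<integral>x. (norm (grad (\<phi> n) x))\<^sup>2 \<partial>?M) - 1/4 * (\<integral>x. (norm (grad (\<phi> m) x - grad (\<phi> n) x))\<^sup>2 \<partial>?M)"
      unfolding par using L2_D(2)[OF Lg[of m]] L2_D(2)[OF Lg[of n]] L2_D(2)[OF L2_diff[OF Lg[of m] Lg[of n]]]
      by simp
    moreover have "(\<integral>x. ?h x \<partial>?M) = 1/2 * (\<integral>x. \<phi> m x \<partial>?M) + 1/2 * (\<integral>x. \<phi> n x \<partial>?M)"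
      using tint[OF t[of m]] tint[OF t[of n]] by simp
    ultimately have Eh: "E ?h = 1/2 * E (\<phi> m) + 1/2 * E (\<phi> n) - 1/4 * (\<integral>x. (norm (grad (\<phi> m) x - grad (\<phi> n) x))\<^sup>2 \<partial>?M)"
      unfolding E_def by (simp add: algebra_simps)
    have arith: "X \<le> 2 * (a + b)"
      if "I \<le> Eh" "A < I + a" "B < I + b" "Eh = 1/2 * A + 1/2 * B - 1/4 * X" for Eh A B X a b
      using that by argo
    show ?thesis by (rule arith[OF I_le[OF th] En En Eh])
  qed
  have du: "C * (\<integral>x. (norm (\<phi> m x - \<phi> n x))\<^sup>2 \<partial>?M) \<le> (\<integral>x. (norm (grad (\<phi> m) x - grad (\<phi> n) x))\<^sup>2 \<partial>?M)" for m n
    using poin[OF test_fun_lincomb[OF t[of m] t[of n], of 1 "-1"]] grad_test_lincomb[OF t[of m] t[of n], of 1 "-1"]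
    by simp
  have small: "\<exists>N. \<forall>m\<ge>N. \<forall>n\<ge>N. 2 * (inverse (real (Suc m)) + inverse (real (Suc n))) < e" if e: "e > 0" for e :: real
  proof -
    obtain N where N: "inverse (real (Suc N)) < e / 4"
      using reals_Archimedean[of "e / 4"] e by auto
    have inv: "inverse (real (Suc m)) \<le> inverse (real (Suc N))" if "m \<ge> N" for m
      using that by (intro le_imp_inverse_le) auto
    have arith: "2 * (a + b) < e" if "a \<le> c" "b \<le> c" "c < e / 4" for a b c
      using that by argo
    have "2 * (inverse (real (Suc m)) + inverse (real (Suc n))) < e" if "m \<ge> N" "n \<ge> N" for m n
      by (rule arith[OF inv[OF that(1)] inv[OF that(2)] N])
    thus ?thesis by blast
  qed
  obtain g0 where g0: "L2 ?M g0" "(\<lambda>n. \<integral>x. (norm (g0 x - grad (\<phi> n) x))\<^sup>2 \<partial>?M) \<longlonglongrightarrow> 0"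
  proof (rule L2_complete[of ?M "\<lambda>n. grad (\<phi> n)"])
    show "L2 ?M (grad (\<phi> n))" for n by (rule Lg)
    show "\<exists>N. \<forall>m\<ge>N. \<forall>n\<ge>N. (\<integral>x. (norm (grad (\<phi> m) x - grad (\<phi> n) x))\<^sup>2 \<partial>?M) < e" if "e > 0" for e
      using small[OF that] dg le_less_trans by blast
  qed blast
  obtain v0 where v0: "L2 ?M v0" "(\<lambda>n. \<integral>x. (norm (v0 x - \<phi> n x))\<^sup>2 \<partial>?M) \<longlonglongrightarrow> 0"
  proof (rule L2_complete[of ?M \<phi>])
    show "L2 ?M (\<phi> n)" for n by (rule L)
    show "\<exists>N. \<forall>m\<ge>N. \<forall>n\<ge>N. (\<integral>x. (norm (\<phi> m x - \<phi> n x))\<^sup>2 \<partial>?M) < e" if "e > 0" for e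
    proof -
      have "C * e > 0" using C that by simp
      from small[OF this] obtain N where N: "\<And>m n. m \<ge> N \<Longrightarrow> n \<ge> N \<Longrightarrow>
          2 * (inverse (real (Suc m)) + inverse (real (Suc n))) < C * e" by blast
      have "(\<integral>x. (norm (\<phi> m x - \<phi> n x))\<^sup>2 \<partial>?M) < e" if "m \<ge> N" "n \<ge> N" for m n
      proof -
        have "C * (\<integral>x. (norm (\<phi> m x - \<phi> n x))\<^sup>2 \<partial>?M) < C * e"
          using du[of m n] dg[of m n] N[OF that] by linarith
        thus ?thesis using C by simp
      qed
      thus ?thesis by blast
    qed
  qed blast
  \<comment> \<open>\<open>H01\<close> asks for measurability on the whole space, while completeness
    yields functions measurable on \<open>\<Omega>\<close> only; cutting off by the indicator
    repairs this.\<close>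
  define v where "v x = indicator \<Omega> x * v0 x" for x
  define g where "g x = indicator \<Omega> x *\<^sub>R g0 x" for x
  have \<Omega>': "\<Omega> \<inter> space lebesgue \<in> sets lebesgue" using \<Omega> by simp
  have vm: "v \<in> borel_measurable lebesgue"
    using L2_D(1)[OF v0(1)] borel_measurable_restrict_space_iff[OF \<Omega>', of v0]
    unfolding v_def[abs_def] by (simp add: mult.commute)
  have gm: "g \<in> borel_measurable lebesgue"
    using L2_D(1)[OF g0(1)] borel_measurable_restrict_space_iff[OF \<Omega>', of g0]
    unfolding g_def[abs_def] by simp
  have v_eq: "v x = v0 x" and g_eq: "g x = g0 x" if "x \<in> space ?M" for x
    using that by (auto simp: v_def g_def space_restrict_space)
  have vL: "L2 ?M v" "L2 ?M g"
    using v0(1) g0(1) measurable_lebesgue_onI[OF vm] measurable_lebesgue_onI[OF gm]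
      Bochner_Integration.integrable_cong[OF refl, of ?M "\<lambda>x. (norm (v x))\<^sup>2" "\<lambda>x. (norm (v0 x))\<^sup>2"] v_eq
      Bochner_Integration.integrable_cong[OF refl, of ?M "\<lambda>x. (norm (g x))\<^sup>2" "\<lambda>x. (norm (g0 x))\<^sup>2"] g_eq
    by (auto simp: L2_def)
  have vlim: "(\<lambda>n. \<integral>x. (norm (v x - \<phi> n x))\<^sup>2 \<partial>?M) \<longlonglongrightarrow> 0"
  proof -
    have "(\<integral>x. (norm (v x - \<phi> n x))\<^sup>2 \<partial>?M) = (\<integral>x. (norm (v0 x - \<phi> n x))\<^sup>2 \<partial>?M)" for n
      by (rule Bochner_Integration.integral_cong[OF refl]) (simp add: v_eq)
    thus ?thesis using v0(2) by simp
  qed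
  have glim: "(\<lambda>n. \<integral>x. (norm (g x - grad (\<phi> n) x))\<^sup>2 \<partial>?M) \<longlonglongrightarrow> 0"
  proof -
    have "(\<integral>x. (norm (g x - grad (\<phi> n) x))\<^sup>2 \<partial>?M) = (\<integral>x. (norm (g0 x - grad (\<phi> n) x))\<^sup>2 \<partial>?M)" for n
      by (rule Bochner_Integration.integral_cong[OF refl]) (simp add: g_eq)
    thus ?thesis using g0(2) by simp
  qed
  have H: "H01 \<Omega> v g" by (rule H01I[OF \<Omega>(1) vm gm vL t vlim glim])
  have EL: "(\<integral>x. g x \<bullet> grad \<psi> x \<partial>?M) = (\<integral>x. \<psi> x \<partial>?M)" if \<psi>: "test_fun \<Omega> \<psi>" for \<psi>
  proof -
    let ?b = "(\<integral>x. g x \<bullet> grad \<psi> x \<partial>?M) - (\<integral>x. \<psi> x \<partial>?M)"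
    let ?c = "\<integral>x. (norm (grad \<psi> x))\<^sup>2 \<partial>?M"
    note L\<psi> = test_fun_L2[OF \<Omega>(1) \<psi>]
    \<comment> \<open>Varying \<open>\<phi> n\<close> by \<open>s * \<psi>\<close> cannot go below
      \<open>I\<close>, and the defect of \<open>\<phi> n\<close> vanishes in the limit. What
      remains is a nonnegative quadratic in \<open>s\<close> without constant term, so its linear
      coefficient \<open>?b\<close> is 0.\<close>
    have "0 \<le> 0 + 2 * s * ?b + s\<^sup>2 * ?c" for s
    proof (rule LIMSEQ_le)
      have "(\<lambda>n. \<integral>x. grad (\<phi> n) x \<bullet> grad \<psi> x \<partial>?M) \<longlonglongrightarrow> (\<integral>x. g x \<bullet> grad \<psi> x \<partial>?M)"
        by (rule L2_tendsto_inner[OF Lg vL(2) L\<psi>(2) glim])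
      thus "(\<lambda>n. inverse (real (Suc n)) + 2 * s * ((\<integral>x. grad (\<phi> n) x \<bullet> grad \<psi> x \<partial>?M) - (\<integral>x. \<psi> x \<partial>?M)) + s\<^sup>2 * ?c)
          \<longlonglongrightarrow> 0 + 2 * s * ?b + s\<^sup>2 * ?c"
        by (intro tendsto_add tendsto_mult tendsto_diff tendsto_const LIMSEQ_inverse_real_of_nat)
      show "(\<lambda>n. 0::real) \<longlonglongrightarrow> 0" by simp
      have "0 \<le> inverse (real (Suc n)) + 2 * s * ((\<integral>x. grad (\<phi> n) x \<bullet> grad \<psi> x \<partial>?M) - (\<integral>x. \<psi> x \<partial>?M)) + s\<^sup>2 * ?c" for n
      proof -
        have "I \<le> E (\<lambda>x. 1 * \<phi> n x + s * \<psi> x)" by (rule I_le[OF test_fun_lincomb[OF t \<psi>]])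
        also have "\<dots> = E (\<phi> n) + 2 * s * ((\<integral>x. grad (\<phi> n) x \<bullet> grad \<psi> x \<partial>?M) - (\<integral>x. \<psi> x \<partial>?M)) + s\<^sup>2 * ?c"
          unfolding E_def grad_test_lincomb[OF t \<psi>] scaleR_one L2_norm_sq_add[OF Lg L\<psi>(2)]
          using tint[OF t[of n]] tint[OF \<psi>] by (simp add: algebra_simps)
        finally show ?thesis using En[of n] by linarith
      qed
      thus "\<exists>N. \<forall>n\<ge>N. 0 \<le> inverse (real (Suc n)) + 2 * s * ((\<integral>x. grad (\<phi> n) x \<bullet> grad \<psi> x \<partial>?M) - (\<integral>x. \<psi> x \<partial>?M)) + s\<^sup>2 * ?c"
        by blast
    qed
    from nonneg_quadratic_imp[OF this] have "?b\<^sup>2 \<le> 0" by simp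
    thus ?thesis by simp
  qed
  have "(\<integral>x. g x \<bullet> \<psi> x \<partial>?M) = (\<integral>x. u x \<partial>?M)" if u: "H01 \<Omega> u \<psi>" for u \<psi>
  proof -
    obtain \<eta> where \<eta>: "\<And>n. test_fun \<Omega> (\<eta> n)" and L\<eta>: "L2 ?M u" "L2 ?M \<psi>"
      and lim: "(\<lambda>n. \<integral>x. (norm (u x - \<eta> n x))\<^sup>2 \<partial>?M) \<longlonglongrightarrow> 0"
      "(\<lambda>n. \<integral>x. (norm (\<psi> x - grad (\<eta> n) x))\<^sup>2 \<partial>?M) \<longlonglongrightarrow> 0"
      by (rule H01E[OF \<Omega>(1) u]) (rule that; assumption)
    have "(\<lambda>n. \<integral>x. grad (\<eta> n) x \<bullet> g x \<partial>?M) \<longlonglongrightarrow> (\<integral>x. \<psi> x \<bullet> g x \<partial>?M)"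
      by (rule L2_tendsto_inner[OF test_fun_L2(2)[OF \<Omega>(1) \<eta>] L\<eta>(2) vL(2) lim(2)])
    moreover have "(\<lambda>n. \<integral>x. \<eta> n x \<bullet> 1 \<partial>?M) \<longlonglongrightarrow> (\<integral>x. u x \<bullet> 1 \<partial>?M)"
      by (rule L2_tendsto_inner[OF test_fun_L2(1)[OF \<Omega>(1) \<eta>] L\<eta>(1) one lim(1)])
    moreover have "(\<integral>x. grad (\<eta> n) x \<bullet> g x \<partial>?M) = (\<integral>x. \<eta> n x \<bullet> 1 \<partial>?M)" for n
      using EL[OF \<eta>[of n]] by (simp add: inner_commute)
    ultimately have "(\<integral>x. \<psi> x \<bullet> g x \<partial>?M) = (\<integral>x. u x \<bullet> 1 \<partial>?M)"
      using LIMSEQ_unique by simp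
    thus ?thesis by (simp add: inner_commute)
  qed
  hence "is_torsion \<Omega> v"
    unfolding is_torsion_def set_integral_lebesgue_on[OF \<Omega>(1)] using H by blast
  thus ?thesis by blast
qed

text \<open>Truncating the approximating test functions gives approximations of the truncated
  function. The factor \<open>softplus'\<close> in their gradients multiplies a field that is merely
  square-integrable, so convergence of \<open>\<phi> n\<close> in \<open>L2\<close> does not suffice
  directly; an almost everywhere convergent subsequence and dominated convergence do.\<close>

lemma H01_softplus:
  fixes \<Omega> :: "'a::euclidean_space set"
  assumes \<Omega>: "\<Omega> \<in> sets lebesgue" "bounded \<Omega>" and H: "H01 \<Omega> v g" and q: "smooth q"
    and \<sigma>: "\<bar>\<sigma>\<bar> = 1"
    and T: "\<And>\<phi>. test_fun \<Omega> \<phi> \<Longrightarrow> test_fun \<Omega> (\<lambda>x. softplus (\<sigma> * (\<phi> x - q x)))"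
  shows "H01 \<Omega> (\<lambda>x. softplus (\<sigma> * (v x - q x)))
           (\<lambda>x. (\<sigma> * softplus' (\<sigma> * (v x - q x))) *\<^sub>R (g x - grad q x))"
    (is "H01 \<Omega> ?u ?G")
proof -
  let ?M = "lebesgue_on \<Omega>"
  obtain \<phi>0 where t0: "\<And>n. test_fun \<Omega> (\<phi>0 n)" and L: "L2 ?M v" "L2 ?M g"
    and lim0: "(\<lambda>n. \<integral>x. (norm (v x - \<phi>0 n x))\<^sup>2 \<partial>?M) \<longlonglongrightarrow> 0"
    "(\<lambda>n. \<integral>x. (norm (g x - grad (\<phi>0 n) x))\<^sup>2 \<partial>?M) \<longlonglongrightarrow> 0"
    by (rule H01E[OF \<Omega>(1) H]) (rule that; assumption)
  obtain r :: "nat \<Rightarrow> nat" where r: "strict_mono r" "AE x in ?M. (\<lambda>n. \<phi>0 (r n) x) \<longlonglongrightarrow> v x"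
    by (rule L2_AE_subseq[OF test_fun_L2(1)[OF \<Omega>(1) t0] L(1) lim0(1)]) (rule that; assumption)
  define \<phi> where "\<phi> n = \<phi>0 (r n)" for n
  have t: "test_fun \<Omega> (\<phi> n)" for n using t0 by (simp add: \<phi>_def)
  have AE: "AE x in ?M. (\<lambda>n. \<phi> n x) \<longlonglongrightarrow> v x" using r(2) by (simp add: \<phi>_def)
  have lim: "(\<lambda>n. \<integral>x. (norm (v x - \<phi> n x))\<^sup>2 \<partial>?M) \<longlonglongrightarrow> 0"
    "(\<lambda>n. \<integral>x. (norm (g x - grad (\<phi> n) x))\<^sup>2 \<partial>?M) \<longlonglongrightarrow> 0"
    using LIMSEQ_subseq_LIMSEQ[OF lim0(1) r(1)] LIMSEQ_subseq_LIMSEQ[OF lim0(2) r(1)]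
    by (simp_all add: \<phi>_def o_def)
  have cq: "continuous_on UNIV q" using smooth_continuous[OF q] .
  have cgq: "continuous_on UNIV (grad q)" using continuous_on_grad[OF q] .
  have Lq: "L2 ?M q" "L2 ?M (grad q)" by (intro L2_continuous_bounded \<Omega> cq cgq)+
  have sp_meas: "softplus \<in> borel_measurable borel" "softplus' \<in> borel_measurable borel"
    by (rule borel_measurable_continuous_onI, rule continuous_at_imp_continuous_on,
        use DERIV_isCont[OF softplus_has_derivative] in blast)
      (rule borel_measurable_continuous_onI[OF continuous_on_softplus'])
  note [measurable] = sp_meas
  have vm: "v \<in> borel_measurable lebesgue" "g \<in> borel_measurable lebesgue"
    using H by (auto simp: H01_def)
  have qm: "q \<in> borel_measurable lebesgue" "grad q \<in> borel_measurable lebesgue"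
    using borel_measurable_continuous_onI[OF cq] borel_measurable_continuous_onI[OF cgq]
    by (auto intro: measurable_completion)
  have um: "?u \<in> borel_measurable lebesgue"
    using vm qm by measurable
  have Gm: "?G \<in> borel_measurable lebesgue"
    using vm qm by measurable
  define \<psi> where "\<psi> n x = softplus (\<sigma> * (\<phi> n x - q x))" for n x
  have t\<psi>: "test_fun \<Omega> (\<psi> n)" for n using T[OF t[of n]] by (simp add: \<psi>_def[abs_def])
  have g\<psi>: "grad (\<psi> n) x = (\<sigma> * softplus' (\<sigma> * (\<phi> n x - q x))) *\<^sub>R (grad (\<phi> n) x - grad q x)" for n x
  proof -
    have df: "\<phi> n differentiable at x" "q differentiable at x"
      using smooth_differentiable test_funD(1)[OF t] q by blast+
    have e: "(\<lambda>x. \<sigma> * (\<phi> n x - q x)) = (\<lambda>x. \<sigma> * \<phi> n x + (-\<sigma>) * q x)"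
      by (auto simp: algebra_simps)
    have gr: "grad (\<lambda>x. \<sigma> * (\<phi> n x - q x)) x = \<sigma> *\<^sub>R (grad (\<phi> n) x - grad q x)"
      unfolding e grad_lincomb[OF df] by (simp add: scaleR_diff_right)
    have "(\<lambda>x. \<sigma> * (\<phi> n x - q x)) differentiable at x"
      using df by (intro derivative_intros)
    from grad_softplus[OF this] show ?thesis
      unfolding \<psi>_def[abs_def] gr by (simp add: mult.commute)
  qed
  have lip: "\<bar>softplus (\<sigma> * a) - softplus (\<sigma> * b)\<bar> \<le> \<bar>a - b\<bar>" for a b
    using softplus_lipschitz[of "\<sigma> * a" "\<sigma> * b"] \<sigma> by (simp add: right_diff_distrib[symmetric] abs_mult)
  have sp1: "\<bar>softplus' s\<bar> \<le> 1" for s using softplus'_nonneg[of s] softplus'_le_1[of s] by simp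
  have Lvq: "L2 ?M (\<lambda>x. v x - q x)" by (rule L2_diff[OF L(1) Lq(1)])
  have Lgq: "L2 ?M (\<lambda>x. g x - grad q x)" by (rule L2_diff[OF L(2) Lq(2)])
  have Lu: "L2 ?M ?u"
  proof (rule L2_dominated[OF Lvq measurable_lebesgue_onI[OF um]], rule AE_I2)
    fix x show "norm (softplus (\<sigma> * (v x - q x))) \<le> norm (v x - q x)"
      using lip[of "v x - q x" 0] by (simp add: softplus_def)
  qed
  have LG: "L2 ?M ?G"
  proof (rule L2_dominated[OF Lgq measurable_lebesgue_onI[OF Gm]], rule AE_I2)
    fix x show "norm ((\<sigma> * softplus' (\<sigma> * (v x - q x))) *\<^sub>R (g x - grad q x)) \<le> norm (g x - grad q x)"
      using sp1 \<sigma> by (simp add: abs_mult mult_left_le_one_le del: softplus_derivs.simps One_nat_def)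
  qed
  have lu: "(\<lambda>n. \<integral>x. (norm (?u x - \<psi> n x))\<^sup>2 \<partial>?M) \<longlonglongrightarrow> 0"
  proof (rule tendsto_sandwich[OF _ _ tendsto_const lim(1)])
    show "\<forall>\<^sub>F n in sequentially. (\<integral>x. (norm (?u x - \<psi> n x))\<^sup>2 \<partial>?M) \<le> (\<integral>x. (norm (v x - \<phi> n x))\<^sup>2 \<partial>?M)"
    proof (rule always_eventually, rule allI, rule integral_mono)
      fix n x
      show "integrable ?M (\<lambda>x. (norm (?u x - \<psi> n x))\<^sup>2)"
        by (rule L2_D(2)[OF L2_diff[OF Lu test_fun_L2(1)[OF \<Omega>(1) t\<psi>]]])
      show "integrable ?M (\<lambda>x. (norm (v x - \<phi> n x))\<^sup>2)"
        by (rule L2_D(2)[OF L2_diff[OF L(1) test_fun_L2(1)[OF \<Omega>(1) t]]])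
      show "(norm (?u x - \<psi> n x))\<^sup>2 \<le> (norm (v x - \<phi> n x))\<^sup>2"
        using lip[of "v x - q x" "\<phi> n x - q x"] by (intro power_mono) (simp_all add: \<psi>_def)
    qed
  qed auto
  \<comment> \<open>The difference of gradients is split in two: \<open>d n\<close> has the varying
    factor and the fixed field \<open>g - grad q\<close>, and the rest has a factor at most 1 and
    the field \<open>g - grad (\<phi> n)\<close>, which tends to 0.\<close>
  define d where "d n x = (softplus' (\<sigma> * (v x - q x)) - softplus' (\<sigma> * (\<phi> n x - q x))) *\<^sub>R (g x - grad q x)" for n x
  have \<phi>m: "\<phi> n \<in> borel_measurable ?M" "grad (\<phi> n) \<in> borel_measurable ?M" for n
    using test_fun_L2[OF \<Omega>(1) t[of n]] by (auto simp: L2_def)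
  have dm: "d n \<in> borel_measurable ?M" for n
    using \<phi>m[of n] measurable_lebesgue_onI[OF vm(1)] measurable_lebesgue_onI[OF vm(2)]
      measurable_lebesgue_onI[OF qm(1)] measurable_lebesgue_onI[OF qm(2)]
    unfolding d_def[abs_def] by measurable
  have dle: "norm (d n x) \<le> norm (g x - grad q x)" for n x
  proof -
    have "\<bar>softplus' a - softplus' b\<bar> \<le> 1" for a b
      using softplus'_nonneg[of a] softplus'_le_1[of a] softplus'_nonneg[of b] softplus'_le_1[of b] by linarith
    thus ?thesis unfolding d_def
      by (simp add: mult_left_le_one_le del: softplus_derivs.simps One_nat_def)
  qed
  have Ld: "L2 ?M (d n)" for n
    by (rule L2_dominated[OF Lgq dm]) (use dle in auto)
  have ld: "(\<lambda>n. \<integral>x. (norm (d n x))\<^sup>2 \<partial>?M) \<longlonglongrightarrow> (\<integral>x. 0 \<partial>?M)"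
  proof (rule integral_dominated_convergence[where w = "\<lambda>x. (norm (g x - grad q x))\<^sup>2"])
    show "integrable ?M (\<lambda>x. (norm (g x - grad q x))\<^sup>2)" by (rule L2_D(2)[OF Lgq])
    show "(\<lambda>x. (norm (d n x))\<^sup>2) \<in> borel_measurable ?M" for n using dm[of n] by measurable
    show "AE x in ?M. norm ((norm (d n x))\<^sup>2) \<le> (norm (g x - grad q x))\<^sup>2" for n
      using dle by (auto intro: power_mono)
    show "AE x in ?M. (\<lambda>n. (norm (d n x))\<^sup>2) \<longlonglongrightarrow> 0"
      using AE
    proof (rule eventually_mono)
      fix x assume "(\<lambda>n. \<phi> n x) \<longlonglongrightarrow> v x"
      hence "(\<lambda>n. \<sigma> * (\<phi> n x - q x)) \<longlonglongrightarrow> \<sigma> * (v x - q x)" by (intro tendsto_intros)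
      hence "(\<lambda>n. softplus' (\<sigma> * (\<phi> n x - q x))) \<longlonglongrightarrow> softplus' (\<sigma> * (v x - q x))"
        using isCont_tendsto_compose[OF DERIV_isCont[OF softplus_derivs_has_derivative]] by blast
      hence "(\<lambda>n. (norm (d n x))\<^sup>2) \<longlonglongrightarrow>
        (norm ((softplus' (\<sigma> * (v x - q x)) - softplus' (\<sigma> * (v x - q x))) *\<^sub>R (g x - grad q x)))\<^sup>2"
        unfolding d_def by (intro tendsto_power tendsto_norm tendsto_scaleR tendsto_diff tendsto_const)
      thus "(\<lambda>n. (norm (d n x))\<^sup>2) \<longlonglongrightarrow> 0" by simp
    qed
  qed simp
  have lG: "(\<lambda>n. \<integral>x. (norm (?G x - grad (\<psi> n) x))\<^sup>2 \<partial>?M) \<longlonglongrightarrow> 0"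
  proof (rule tendsto_sandwich[OF _ _ tendsto_const])
    have "(\<lambda>n. 2 * (\<integral>x. (norm (d n x))\<^sup>2 \<partial>?M) + 2 * (\<integral>x. (norm (g x - grad (\<phi> n) x))\<^sup>2 \<partial>?M)) \<longlonglongrightarrow> 2 * (\<integral>x. 0 \<partial>?M) + 2 * 0"
      by (intro tendsto_add tendsto_mult tendsto_const ld lim)
    thus "(\<lambda>n. 2 * (\<integral>x. (norm (d n x))\<^sup>2 \<partial>?M) + 2 * (\<integral>x. (norm (g x - grad (\<phi> n) x))\<^sup>2 \<partial>?M)) \<longlonglongrightarrow> 0"
      by simp
    have pt: "(norm (?G x - grad (\<psi> n) x))\<^sup>2 \<le> 2 * (norm (d n x))\<^sup>2 + 2 * (norm (g x - grad (\<phi> n) x))\<^sup>2" for n x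
    proof -
      have "?G x - grad (\<psi> n) x = \<sigma> *\<^sub>R (d n x + softplus' (\<sigma> * (\<phi> n x - q x)) *\<^sub>R (g x - grad (\<phi> n) x))"
        unfolding g\<psi> d_def by (simp add: algebra_simps del: softplus_derivs.simps One_nat_def)
      hence "(norm (?G x - grad (\<psi> n) x))\<^sup>2 = (norm (d n x + softplus' (\<sigma> * (\<phi> n x - q x)) *\<^sub>R (g x - grad (\<phi> n) x)))\<^sup>2"
        using \<sigma> by (simp del: softplus_derivs.simps One_nat_def)
      also have "\<dots> \<le> 2 * (norm (d n x))\<^sup>2 + 2 * (norm (softplus' (\<sigma> * (\<phi> n x - q x)) *\<^sub>R (g x - grad (\<phi> n) x)))\<^sup>2"
        by (rule norm_sq_add_le)
      also have "\<dots> \<le> 2 * (norm (d n x))\<^sup>2 + 2 * (norm (g x - grad (\<phi> n) x))\<^sup>2"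
        using sp1 by (intro add_left_mono mult_left_mono power_mono)
          (simp_all add: mult_left_le_one_le del: softplus_derivs.simps One_nat_def)
      finally show ?thesis .
    qed
    have "(\<integral>x. (norm (?G x - grad (\<psi> n) x))\<^sup>2 \<partial>?M) \<le>
        2 * (\<integral>x. (norm (d n x))\<^sup>2 \<partial>?M) + 2 * (\<integral>x. (norm (g x - grad (\<phi> n) x))\<^sup>2 \<partial>?M)" for n
    proof -
      have i: "integrable ?M (\<lambda>x. (norm (d n x))\<^sup>2)" "integrable ?M (\<lambda>x. (norm (g x - grad (\<phi> n) x))\<^sup>2)"
        using L2_D(2)[OF Ld] L2_D(2)[OF L2_diff[OF L(2) test_fun_L2(2)[OF \<Omega>(1) t]]] by blast+
      have "(\<integral>x. (norm (?G x - grad (\<psi> n) x))\<^sup>2 \<partial>?M) \<le>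
          (\<integral>x. 2 * (norm (d n x))\<^sup>2 + 2 * (norm (g x - grad (\<phi> n) x))\<^sup>2 \<partial>?M)"
      proof (rule integral_mono)
        show "integrable ?M (\<lambda>x. (norm (?G x - grad (\<psi> n) x))\<^sup>2)"
          by (rule L2_D(2)[OF L2_diff[OF LG test_fun_L2(2)[OF \<Omega>(1) t\<psi>]]])
        show "integrable ?M (\<lambda>x. 2 * (norm (d n x))\<^sup>2 + 2 * (norm (g x - grad (\<phi> n) x))\<^sup>2)"
          using i by simp
      qed (rule pt)
      also have "\<dots> = 2 * (\<integral>x. (norm (d n x))\<^sup>2 \<partial>?M) + 2 * (\<integral>x. (norm (g x - grad (\<phi> n) x))\<^sup>2 \<partial>?M)"
        using i by simp
      finally show ?thesis .
    qed
    thus "\<forall>\<^sub>F n in sequentially. (\<integral>x. (norm (?G x - grad (\<psi> n) x))\<^sup>2 \<partial>?M) \<le>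
        2 * (\<integral>x. (norm (d n x))\<^sup>2 \<partial>?M) + 2 * (\<integral>x. (norm (g x - grad (\<phi> n) x))\<^sup>2 \<partial>?M)" by simp
  qed auto
  show ?thesis by (rule H01I[OF \<Omega>(1) um Gm Lu LG t\<psi> lu lG])
qed

text \<open>With \<open>\<sigma> = 1\<close> this compares the torsion function with a supersolution, with \<open>\<sigma> = -1\<close> with a
  subsolution; the hypothesis on test functions encodes the boundary comparison.\<close>

theorem torsion_comparison:
  fixes \<Omega> :: "'a::euclidean_space set"
  assumes \<Omega>: "\<Omega> \<in> sets lebesgue" "bounded \<Omega>" and C: "C > 0"
    and P: "\<And>\<phi>. test_fun \<Omega> \<phi> \<Longrightarrow> C * (\<integral>x. (\<phi> x)\<^sup>2 \<partial>lborel) \<le> (\<integral>x. (norm (grad \<phi> x))\<^sup>2 \<partial>lborel)"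
    and v: "is_torsion \<Omega> v" and q: "smooth q" and \<sigma>: "\<bar>\<sigma>\<bar> = 1"
    and T: "\<And>\<phi>. test_fun \<Omega> \<phi> \<Longrightarrow> test_fun \<Omega> (\<lambda>x. softplus (\<sigma> * (\<phi> x - q x)))"
    and lap: "\<And>x. x \<in> \<Omega> \<Longrightarrow> \<sigma> * (laplacian q x + 1) \<le> 0"
  shows "AE x in lebesgue_on \<Omega>. \<sigma> * (v x - q x) \<le> 0"
proof -
  let ?M = "lebesgue_on \<Omega>"
  obtain g where H: "H01 \<Omega> v g" and weak: "\<And>u \<psi>. H01 \<Omega> u \<psi> \<Longrightarrow> (\<integral>x. g x \<bullet> \<psi> x \<partial>?M) = (\<integral>x. u x \<partial>?M)"
    using v unfolding is_torsion_def set_integral_lebesgue_on[OF \<Omega>(1)] by blast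
  define u where "u x = softplus (\<sigma> * (v x - q x))" for x
  define s where "s x = softplus' (\<sigma> * (v x - q x))" for x
  define G where "G x = (\<sigma> * s x) *\<^sub>R (g x - grad q x)" for x
  have Hu: "H01 \<Omega> u G"
    unfolding u_def[abs_def] G_def[abs_def] s_def by (rule H01_softplus[OF \<Omega> H q \<sigma> T])
  have L: "L2 ?M u" "L2 ?M G" "L2 ?M g"
    using H01E[OF \<Omega>(1) Hu] H01E[OF \<Omega>(1) H] by blast+
  have Lq: "L2 ?M (grad q)" "L2 ?M (laplacian q)" "L2 ?M (\<lambda>x. 1::real)"
    by (intro L2_continuous_bounded \<Omega> continuous_on_grad q continuous_on_laplacian continuous_on_const)+
  have iu: "integrable ?M u" "integrable ?M (\<lambda>x. laplacian q x * u x)"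
    using L2_inner[OF L(1) Lq(3)] L2_inner[OF Lq(2) L(1)] by simp_all
  have ig: "integrable ?M (\<lambda>x. g x \<bullet> G x)" "integrable ?M (\<lambda>x. grad q x \<bullet> G x)"
    using L2_inner[OF L(3) L(2)] L2_inner[OF Lq(1) L(2)] by simp_all
  have u0: "u x \<ge> 0" for x by (simp add: u_def softplus_nonneg)
  \<comment> \<open>The equations are tested with the truncation \<open>u\<close> itself. Since
    \<open>\<sigma> * \<sigma> = 1\<close>, the pairing of \<open>G\<close> with
    \<open>\<sigma> * (g - grad q)\<close> is \<open>s * |g - grad q|^2\<close>, and this dominates
    \<open>|G|^2 = s^2 * |g - grad q|^2\<close> because \<open>s\<close> lies between 0 and
    1.\<close>
  have "(\<integral>x. (norm (G x))\<^sup>2 \<partial>?M) \<le> (\<integral>x. \<sigma> * (g x \<bullet> G x - grad q x \<bullet> G x) \<partial>?M)"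
  proof (rule integral_mono)
    show "integrable ?M (\<lambda>x. (norm (G x))\<^sup>2)" by (rule L2_D(2)[OF L(2)])
    show "integrable ?M (\<lambda>x. \<sigma> * (g x \<bullet> G x - grad q x \<bullet> G x))" using ig by simp
    fix x
    have s01: "0 \<le> s x" "s x \<le> 1" unfolding s_def by (rule softplus'_nonneg softplus'_le_1)+
    have \<sigma>2: "\<sigma> * \<sigma> = 1" using \<sigma> by (metis abs_mult_self_eq mult_1)
    have "(norm (G x))\<^sup>2 = (s x)\<^sup>2 * (norm (g x - grad q x))\<^sup>2"
      using \<sigma> by (simp add: G_def abs_mult power_mult_distrib)
    also have "\<dots> \<le> s x * (norm (g x - grad q x))\<^sup>2"
      using s01 by (intro mult_right_mono) (simp_all add: power2_eq_square mult_left_le_one_le)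
    also have "\<dots> = \<sigma> * (g x \<bullet> G x - grad q x \<bullet> G x)"
    proof -
      have "\<sigma> * (g x \<bullet> G x - grad q x \<bullet> G x) = \<sigma> * ((g x - grad q x) \<bullet> G x)" by (simp add: inner_diff_left)
      also have "\<dots> = (\<sigma> * \<sigma>) * (s x * ((g x - grad q x) \<bullet> (g x - grad q x)))" by (simp add: G_def)
      finally show ?thesis unfolding \<sigma>2 power2_norm_eq_inner by simp
    qed
    finally show "(norm (G x))\<^sup>2 \<le> \<sigma> * (g x \<bullet> G x - grad q x \<bullet> G x)" .
  qed
  also have "\<dots> = \<sigma> * ((\<integral>x. g x \<bullet> G x \<partial>?M) - (\<integral>x. grad q x \<bullet> G x \<partial>?M))"
    using ig by simp
  also have "\<dots> = \<sigma> * ((\<integral>x. u x \<partial>?M) + (\<integral>x. laplacian q x * u x \<partial>?M))"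
    using weak[OF Hu] H01_grad_laplace[OF \<Omega> Hu q] by simp
  also have "\<dots> = (\<integral>x. \<sigma> * (laplacian q x + 1) * u x \<partial>?M)"
    using iu by (simp add: algebra_simps)
  also have "\<dots> \<le> (\<integral>x. 0 \<partial>?M)"
  proof (rule integral_mono)
    have "integrable ?M (\<lambda>x. \<sigma> * (laplacian q x * u x) + \<sigma> * u x)" using iu by simp
    thus "integrable ?M (\<lambda>x. \<sigma> * (laplacian q x + 1) * u x)" by (simp add: algebra_simps)
    show "\<sigma> * (laplacian q x + 1) * u x \<le> 0" if "x \<in> space ?M" for x
      by (rule mult_nonpos_nonneg[OF lap u0]) (use that in \<open>simp add: space_restrict_space\<close>)
  qed simp
  finally have "(\<integral>x. (norm (G x))\<^sup>2 \<partial>?M) \<le> 0" by simp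
  \<comment> \<open>With no energy left, Poincare forces \<open>u\<close> to vanish almost
    everywhere, and \<open>softplus\<close> vanishes exactly on the nonpositive half line.\<close>
  hence "C * (\<integral>x. (u x)\<^sup>2 \<partial>?M) \<le> 0"
    using H01_poincare[OF \<Omega>(1) Hu P] by linarith
  hence "(\<integral>x. (u x)\<^sup>2 \<partial>?M) \<le> 0" using C by (simp add: mult_le_0_iff)
  hence "(\<integral>x. (u x)\<^sup>2 \<partial>?M) = 0"
    by (intro antisym integral_nonneg_AE) auto
  hence "AE x in ?M. (u x)\<^sup>2 = 0"
    using integral_nonneg_eq_0_iff_AE[of ?M "\<lambda>x. (u x)\<^sup>2"] L2_D(2)[OF L(1)] by simp
  thus ?thesis
    by (rule eventually_mono) (simp add: u_def softplus_eq_0_iff)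
qed

section \<open>The John ellipsoid\<close>

text \<open>Indexing matrices by the standard basis makes \<open>det\<close> available on an arbitrary Euclidean space.\<close>

typedef (overloaded) ('a::euclidean_space) basis_idx = "Basis :: 'a set"
  using nonempty_Basis by blast

lemma bij_Rep_basis_idx: "bij_betw Rep_basis_idx UNIV (Basis :: 'a::euclidean_space set)"
  unfolding bij_betw_def
  by (metis Rep_basis_idx_inject injI type_definition.Rep_range[OF type_definition_basis_idx])

instance basis_idx :: (euclidean_space) finite
proof
  show "finite (UNIV :: 'a basis_idx set)"
    using bij_betw_finite[OF bij_Rep_basis_idx] by simp
qed

lemma card_basis_idx: "CARD('a::euclidean_space basis_idx) = DIM('a)"
  by (rule bij_betw_same_card[OF bij_Rep_basis_idx])

definition to_vec :: "'a::euclidean_space \<Rightarrow> real ^ 'a basis_idx" where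
  "to_vec x = (\<chi> i. x \<bullet> Rep_basis_idx i)"

definition of_vec :: "real ^ 'a::euclidean_space basis_idx \<Rightarrow> 'a" where
  "of_vec v = (\<Sum>i\<in>UNIV. v $ i *\<^sub>R Rep_basis_idx i)"

lemma linear_to_vec: "linear to_vec"
  by (rule linearI) (auto simp: to_vec_def vec_eq_iff inner_add_left)

lemma linear_of_vec: "linear of_vec"
  by (rule linearI) (auto simp: of_vec_def sum.distrib scaleR_add_left scaleR_sum_right)

lemma of_vec_to_vec: "of_vec (to_vec x) = x"
proof -
  have "of_vec (to_vec x) = (\<Sum>i\<in>UNIV. (x \<bullet> Rep_basis_idx i) *\<^sub>R Rep_basis_idx i)"
    by (simp add: of_vec_def to_vec_def)
  also have "\<dots> = (\<Sum>b\<in>Basis. (x \<bullet> b) *\<^sub>R b)"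
    by (rule sum.reindex_bij_betw[OF bij_Rep_basis_idx])
  finally show ?thesis by (simp add: euclidean_representation)
qed

lemma to_vec_of_vec: "to_vec (of_vec v) = v"
proof -
  have ortho: "Rep_basis_idx i \<bullet> Rep_basis_idx j = (if i = j then 1 else 0)" for i j :: "'a basis_idx"
    using Rep_basis_idx[of i] Rep_basis_idx[of j] by (auto simp: inner_Basis Rep_basis_idx_inject)
  show ?thesis
    by (simp add: to_vec_def of_vec_def vec_eq_iff inner_sum_left ortho if_distrib cong: if_cong)
qed

lemma inner_to_vec: "to_vec x \<bullet> to_vec y = x \<bullet> y"
proof -
  have "to_vec x \<bullet> to_vec y = (\<Sum>i\<in>UNIV. (x \<bullet> Rep_basis_idx i) * (y \<bullet> Rep_basis_idx i))"
    by (simp add: inner_vec_def to_vec_def)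
  also have "\<dots> = (\<Sum>b\<in>Basis. (x \<bullet> b) * (y \<bullet> b))"
    by (rule sum.reindex_bij_betw[OF bij_Rep_basis_idx])
  finally show ?thesis by (simp add: euclidean_inner[of x y])
qed

lemma norm_to_vec: "norm (to_vec x) = norm x"
  by (simp add: norm_eq_sqrt_inner inner_to_vec)

text \<open>Its absolute value stands in for volume: it measures the image of the unit ball under
  \<open>f\<close>, up to a constant factor, and it is this quantity that the John ellipsoid
  maximises.\<close>

definition edet :: "('a::euclidean_space \<Rightarrow> 'a) \<Rightarrow> real" where
  "edet f = det (matrix (to_vec \<circ> f \<circ> of_vec))"

lemma linear_conj: "linear f \<Longrightarrow> linear (to_vec \<circ> f \<circ> of_vec)"
  by (intro linear_compose linear_to_vec linear_of_vec)

lemma edet_compose: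
  assumes "linear f" "linear g"
  shows "edet (f \<circ> g) = edet f * edet g"
proof -
  have "to_vec \<circ> (f \<circ> g) \<circ> of_vec = (to_vec \<circ> f \<circ> of_vec) \<circ> (to_vec \<circ> g \<circ> of_vec)"
    by (auto simp: fun_eq_iff of_vec_to_vec)
  thus ?thesis
    unfolding edet_def
    by (simp add: matrix_compose[OF linear_conj[OF assms(2)] linear_conj[OF assms(1)]] det_mul
        del: o_apply)
qed

lemma edet_nz_iff_inj:
  assumes "linear f"
  shows "edet f \<noteq> 0 \<longleftrightarrow> inj f"
proof -
  have "inj (to_vec \<circ> f \<circ> of_vec) \<longleftrightarrow> inj f"
  proof
    assume i: "inj (to_vec \<circ> f \<circ> of_vec)"
    show "inj f"
    proof (rule injI)
      fix x y assume "f x = f y"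
      hence "(to_vec \<circ> f \<circ> of_vec) (to_vec x) = (to_vec \<circ> f \<circ> of_vec) (to_vec y)"
        by (simp add: of_vec_to_vec)
      hence "to_vec x = to_vec y" using i by (simp only: inj_eq)
      thus "x = y" by (metis of_vec_to_vec)
    qed
  next
    assume "inj f"
    moreover have "inj (to_vec :: 'a \<Rightarrow> _)" by (metis injI of_vec_to_vec)
    moreover have "inj (of_vec :: _ \<Rightarrow> 'a)" by (metis injI to_vec_of_vec)
    ultimately show "inj (to_vec \<circ> f \<circ> of_vec)" by (intro inj_compose)
  qed
  thus ?thesis unfolding edet_def using det_nz_iff_inj[OF linear_conj[OF assms]] by simp
qed

text \<open>For a unit vector \<open>e\<close> this scales by \<open>a\<close> along
  \<open>e\<close> and by \<open>b\<close> on the orthogonal complement, without choosing a basis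
  adapted to \<open>e\<close>.\<close>

definition stretch :: "real \<Rightarrow> real \<Rightarrow> 'a::real_inner \<Rightarrow> 'a \<Rightarrow> 'a" where
  "stretch a b e x = b *\<^sub>R x + ((a - b) * (x \<bullet> e)) *\<^sub>R e"

lemma linear_stretch: "linear (stretch a b e)"
  by (rule linearI) (auto simp: stretch_def algebra_simps inner_add_left)

lemma det_stretch_axis:
  fixes k :: "'n::finite"
  shows "det (matrix (stretch a b (axis k 1 :: real ^ 'n))) = a * b ^ (CARD('n) - 1)"
proof -
  let ?D = "matrix (stretch a b (axis k 1 :: real ^ 'n))"
  have ent: "?D $ i $ j = (if i = j then (if i = k then a else b) else 0)" for i j
  proof -
    have nth: "(axis l 1 :: real ^ 'n) $ i = (if i = l then 1 else 0)" for l i by (simp add: axis_def)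
    show ?thesis by (auto simp: matrix_def stretch_def inner_axis_axis nth)
  qed
  have "det ?D = (\<Prod>i\<in>UNIV. ?D $ i $ i)"
    by (rule det_diagonal) (simp add: ent)
  also have "\<dots> = (\<Prod>i\<in>UNIV. if i = k then a else b)" by (simp add: ent)
  also have "\<dots> = a * (\<Prod>i\<in>UNIV - {k}. if i = k then a else b)"
    by (subst prod.remove[of UNIV k]) auto
  also have "(\<Prod>i\<in>UNIV - {k}. if i = k then a else b) = (\<Prod>i\<in>UNIV - {k}. b)"
    by (rule prod.cong) auto
  also have "\<dots> = b ^ (CARD('n) - 1)" by (simp add: card_Diff_singleton)
  finally show ?thesis .
qed

text \<open>An orthogonal map \<open>f\<close> taking a coordinate axis to \<open>e\<close>
  conjugates the stretch to a diagonal matrix, and the nonzero determinant of \<open>f\<close>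
  cancels.\<close>

lemma edet_stretch:
  fixes e :: "'a::euclidean_space"
  assumes e: "norm e = 1"
  shows "edet (stretch a b e) = a * b ^ (DIM('a) - 1)"
proof -
  obtain k :: "'a basis_idx" where True by blast
  have ax: "norm (axis k 1 :: real ^ 'a basis_idx) = 1" by simp
  obtain f :: "real ^ 'a basis_idx \<Rightarrow> real ^ 'a basis_idx" where f: "orthogonal_transformation f" "f (axis k 1) = to_vec e"
  proof (rule orthogonal_transformation_exists)
    show "norm (axis k (1::real)) = norm (to_vec e)" using ax e by (simp add: norm_to_vec)
  qed blast
  have lf: "linear f" using f(1) by (simp add: orthogonal_transformation_def)
  have conj: "to_vec \<circ> stretch a b e \<circ> of_vec = stretch a b (to_vec e)"
  proof
    fix y
    have "of_vec y \<bullet> e = y \<bullet> to_vec e" by (metis inner_to_vec to_vec_of_vec)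
    thus "(to_vec \<circ> stretch a b e \<circ> of_vec) y = stretch a b (to_vec e) y"
      by (simp add: stretch_def linear_add[OF linear_to_vec] linear_scale[OF linear_to_vec] to_vec_of_vec)
  qed
  have inter: "stretch a b (to_vec e) \<circ> f = f \<circ> stretch a b (axis k 1)"
  proof
    fix y
    have "f y \<bullet> to_vec e = y \<bullet> axis k 1"
      using f by (metis orthogonal_transformation_def)
    thus "(stretch a b (to_vec e) \<circ> f) y = (f \<circ> stretch a b (axis k 1)) y"
      by (simp add: stretch_def linear_add[OF lf] linear_scale[OF lf] f(2))
  qed
  have "det (matrix (stretch a b (to_vec e))) * det (matrix f) =
      det (matrix f) * det (matrix (stretch a b (axis k 1)))"
    using arg_cong[OF inter, of "\<lambda>h. det (matrix h)"]
    by (simp add: matrix_compose[OF lf linear_stretch] matrix_compose[OF linear_stretch lf] det_mul)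
  moreover have "det (matrix f) \<noteq> 0"
    using det_nz_iff_inj[OF lf] orthogonal_transformation_inj[OF f(1)] by simp
  ultimately have "det (matrix (stretch a b (to_vec e))) = det (matrix (stretch a b (axis k 1)))"
    by simp
  thus ?thesis unfolding edet_def conj by (simp add: det_stretch_axis card_basis_idx)
qed

text \<open>The Leibniz expansion is a polynomial in the matrix entries, and each entry is
  continuous and linear in \<open>A\<close>. Attaining the maximal volume on a compact set rests on
  this.\<close>

lemma continuous_on_edet: "continuous_on S (\<lambda>A :: 'a::euclidean_space \<Rightarrow>\<^sub>L 'a. edet (blinfun_apply A))"
proof -
  have "edet (blinfun_apply A) = (\<Sum>p | p permutes (UNIV :: 'a basis_idx set). of_int (sign p) *
      (\<Prod>i\<in>UNIV. blinfun_apply A (of_vec (axis (p i) 1)) \<bullet> Rep_basis_idx i))" for A :: "'a \<Rightarrow>\<^sub>L 'a"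
    by (simp add: edet_def det_def matrix_def to_vec_def)
  thus ?thesis by (simp only:) (intro continuous_intros)
qed

text \<open>The two sides are the support functions, at a unit vector with component \<open>s\<close> along the axis, of the
  ellipsoid with centre \<open>t\<close> and semi-axes \<open>1 + t\<close>, \<open>b\<close> and of the convex hull of the unit ball and a point at distance
  \<open>d\<close>. The value of \<open>b\<close> makes the ellipsoid touch the hull where the tangent cone meets the ball.\<close>

lemma john_scalar_ineq:
  fixes d t s b :: real
  assumes d: "d > 1" and t: "t > 0" "1 + 2 * t \<le> d" and s: "-1 \<le> s" "s \<le> 1"
    and b: "b\<^sup>2 = 1 - 2 * t / (d - 1)"
  shows "t * s + sqrt (b\<^sup>2 + ((1 + t)\<^sup>2 - b\<^sup>2) * s\<^sup>2) \<le> max 1 (d * s)"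
proof -
  define y where "y = 2 * t / (d - 1)"
  have ty: "t = y * (d - 1) / 2" using d by (simp add: y_def)
  have by2: "b\<^sup>2 = 1 - y" using b by (simp add: y_def)
  show ?thesis
  proof (cases "d * s \<le> 1")
    case True
    have "t * s \<le> 1"
    proof (cases "s \<ge> 0")
      case True
      thus ?thesis using \<open>d * s \<le> 1\<close> mult_right_mono[of t d s] t by linarith
    next
      case False
      thus ?thesis using t mult_pos_neg[of t s] by linarith
    qed
    \<comment> \<open>The zeros of the difference are the contacts with the ball:
      \<open>s = -1\<close> at the pole opposite to the far point, and \<open>s = 1 / d\<close>
      where the tangent cone meets the ball. The second case has the same zero
      \<open>s = 1 / d\<close>, so the two bounds fit together there.\<close>
    have "(1 - t * s)\<^sup>2 - (b\<^sup>2 + ((1 + t)\<^sup>2 - b\<^sup>2) * s\<^sup>2) = y * ((s + 1) * (1 - d * s))"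
      unfolding by2 ty by (simp add: field_simps power2_eq_square)
    moreover have "0 \<le> y * ((s + 1) * (1 - d * s))"
      using d t s True by (intro mult_nonneg_nonneg) (auto simp: y_def)
    ultimately have "sqrt (b\<^sup>2 + ((1 + t)\<^sup>2 - b\<^sup>2) * s\<^sup>2) \<le> 1 - t * s"
      using \<open>t * s \<le> 1\<close> by (intro real_le_lsqrt) auto
    thus ?thesis by linarith
  next
    case False
    hence "s > 0" using d by (meson linorder_not_less mult_nonneg_nonpos order.trans zero_le_one less_imp_le)
    have "((d - t) * s)\<^sup>2 - (b\<^sup>2 + ((1 + t)\<^sup>2 - b\<^sup>2) * s\<^sup>2) = b\<^sup>2 * ((d * s)\<^sup>2 - 1)"
      unfolding by2 ty by (simp add: field_simps power2_eq_square)
    moreover have "0 \<le> b\<^sup>2 * ((d * s)\<^sup>2 - 1)"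
      using False by (intro mult_nonneg_nonneg) (auto simp: one_le_power)
    ultimately have "sqrt (b\<^sup>2 + ((1 + t)\<^sup>2 - b\<^sup>2) * s\<^sup>2) \<le> (d - t) * s"
      using \<open>s > 0\<close> t by (intro real_le_lsqrt) auto
    thus ?thesis by (simp add: algebra_simps)
  qed
qed

text \<open>A point outside \<open>K\<close> could be separated from the unit ball and from
  \<open>p\<close> by a hyperplane with unit normal \<open>w\<close>. In direction \<open>w\<close>
  the support function of the ellipsoid would then exceed that of ball and point together, against
  \<open>john_scalar_ineq\<close> with \<open>s = w \<bullet> e\<close>.\<close>

lemma stretched_ball_subset:
  fixes K :: "'a::euclidean_space set"
  assumes K: "closed K" "convex K" "cball 0 1 \<subseteq> K" "p \<in> K"
    and d: "d = norm p" "d > 1" and t: "t > 0" "1 + 2 * t \<le> d"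
    and b: "b\<^sup>2 = 1 - 2 * t / (d - 1)" and x: "norm x \<le> 1"
  shows "t *\<^sub>R (p /\<^sub>R d) + stretch (1 + t) b (p /\<^sub>R d) x \<in> K"
proof (rule ccontr)
  define e where "e = p /\<^sub>R d"
  define z where "z = t *\<^sub>R e + stretch (1 + t) b e x"
  have e: "norm e = 1" using d(2) by (simp add: e_def d(1)[symmetric])
  assume "\<not> ?thesis"
  hence "z \<notin> K" by (simp add: z_def e_def)
  then obtain u \<beta> where u: "u \<bullet> z < \<beta>" "\<And>y. y \<in> K \<Longrightarrow> u \<bullet> y > \<beta>"
    using separating_hyperplane_closed_point[OF K(2,1)] by blast
  have "u \<noteq> 0" using u K(4) by (metis inner_zero_left order.asym)
  define w where "w = - (u /\<^sub>R norm u)"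
  have w: "norm w = 1" using \<open>u \<noteq> 0\<close> by (simp add: w_def)
  have wz: "w \<bullet> y < w \<bullet> z" if "y \<in> K" for y
  proof -
    have "u \<bullet> z < u \<bullet> y" using u that by force
    thus ?thesis using \<open>u \<noteq> 0\<close> by (simp add: w_def divide_strict_right_mono)
  qed
  define s where "s = w \<bullet> e"
  have s: "-1 \<le> s" "s \<le> 1"
    using Cauchy_Schwarz_ineq2[of w e] w e by (auto simp: s_def)
  have "w \<bullet> w < w \<bullet> z" using w K(3) by (intro wz) auto
  hence 1: "1 < w \<bullet> z" using w by (simp add: norm_eq_1)
  have "w \<bullet> p = d * s" using d(2) by (simp add: s_def e_def)
  hence 2: "d * s < w \<bullet> z" using wz[OF K(4)] by simp
  have "w \<bullet> z = t * s + x \<bullet> stretch (1 + t) b e w"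
    by (simp add: z_def stretch_def s_def inner_add_right inner_commute algebra_simps)
  also have "\<dots> \<le> t * s + norm (stretch (1 + t) b e w)"
    using norm_cauchy_schwarz[of x "stretch (1 + t) b e w"] x
      mult_right_mono[OF x norm_ge_zero, of "stretch (1 + t) b e w"] by simp
  also have "norm (stretch (1 + t) b e w) = sqrt (b\<^sup>2 + ((1 + t)\<^sup>2 - b\<^sup>2) * s\<^sup>2)"
  proof -
    have ee: "e \<bullet> e = 1" "w \<bullet> w = 1" "w \<bullet> e = s" "e \<bullet> w = s"
      using e w by (auto simp: norm_eq_1 s_def inner_commute)
    have "stretch (1 + t) b e w \<bullet> stretch (1 + t) b e w = b\<^sup>2 + ((1 + t)\<^sup>2 - b\<^sup>2) * s\<^sup>2"
      by (simp add: stretch_def inner_add_left inner_add_right ee power2_eq_square algebra_simps)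
    thus ?thesis by (simp add: norm_eq_sqrt_inner)
  qed
  also have "t * s + sqrt (b\<^sup>2 + ((1 + t)\<^sup>2 - b\<^sup>2) * s\<^sup>2) \<le> max 1 (d * s)"
    by (rule john_scalar_ineq[OF d(2) t s b])
  finally show False using 1 2 by simp
qed

text \<open>This is where the dimension enters as John's factor. To first order in \<open>t\<close>
  the volume factor is \<open>1 + t * (1 - \<kappa>)\<close> with
  \<open>\<kappa> = (m - 1) / (d - 1)\<close>, and \<open>\<kappa> < 1\<close> holds precisely
  because \<open>d > m\<close>. The estimate is made for the square, where Bernoulli's inequality
  applies to \<open>b^2 = 1 - y\<close>.\<close>

lemma john_volume_gain:
  fixes d :: real
  assumes "m \<ge> 1" "d > real m"
  obtains t b where "t > 0" "1 + 2 * t \<le> d" "b\<^sup>2 = 1 - 2 * t / (d - 1)" "b \<ge> 0"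
    "(1 + t) * b ^ (m - 1) > 1"
proof -
  have d: "d > 1" using assms by linarith
  define \<kappa> where "\<kappa> = real (m - 1) / (d - 1)"
  have \<kappa>: "0 \<le> \<kappa>" "\<kappa> < 1" using assms d by (auto simp: \<kappa>_def of_nat_diff)
  \<comment> \<open>The first bound keeps the second-order term below the first-order gain; the
    second gives \<open>1 + 2 * t \<le> d\<close> and \<open>y \<le> 1\<close>.\<close>
  define t where "t = min ((1 - \<kappa>) / 4) ((d - 1) / 4)"
  have t: "t > 0" "t \<le> (1 - \<kappa>) / 4" "t \<le> (d - 1) / 4"
    unfolding t_def using \<kappa> d by (simp_all only: min.cobounded1 min.cobounded2) auto
  define y where "y = 2 * t / (d - 1)"
  have y: "0 \<le> y" "y \<le> 1" using t d by (auto simp: y_def field_simps)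
  define b where "b = sqrt (1 - y)"
  have b2: "b\<^sup>2 = 1 - y" using y by (simp add: b_def)
  have b0: "b \<ge> 0" using y by (simp add: b_def)
  have "1 + real (m - 1) * (- y) \<le> (1 + - y) ^ (m - 1)"
    using y by (intro Bernoulli_inequality) auto
  moreover have "real (m - 1) * y = 2 * t * \<kappa>" by (simp add: y_def \<kappa>_def)
  ultimately have bern: "1 - 2 * t * \<kappa> \<le> (b\<^sup>2) ^ (m - 1)" unfolding b2 by simp
  have "1 < (1 + 2 * t) * (1 - 2 * t * \<kappa>)"
  proof -
    have "2 * t * \<kappa> \<le> 2 * t" using t \<kappa> by (simp add: mult_left_le)
    hence "2 * t * \<kappa> < 1 - \<kappa>" using t(2) \<kappa>(2) by argo
    hence "0 < 2 * t * (1 - \<kappa> - 2 * t * \<kappa>)" using t by simp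
    thus ?thesis by (simp add: algebra_simps)
  qed
  also have "\<dots> \<le> (1 + t)\<^sup>2 * (b\<^sup>2) ^ (m - 1)"
  proof (rule mult_mono)
    show "1 + 2 * t \<le> (1 + t)\<^sup>2" by (simp add: power2_eq_square algebra_simps)
    show "0 \<le> 1 - 2 * t * \<kappa>"
    proof -
      have "t * \<kappa> \<le> t" using t \<kappa> by (simp add: mult_left_le)
      thus ?thesis using t(2) \<kappa> by argo
    qed
  qed (use bern in auto)
  also have "\<dots> = ((1 + t) * b ^ (m - 1))\<^sup>2" by (simp add: power_mult_distrib power_mult[symmetric] mult.commute)
  finally have "(1 + t) * b ^ (m - 1) > 1"
    using power2_less_imp_less[of 1 "(1 + t) * b ^ (m - 1)"] t b0 by simp
  thus ?thesis using that[of t b] t d b2 b0 by (simp add: y_def)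
qed

text \<open>Among all affine images \<open>c + A x\<close> of the unit ball inside \<open>K\<close>,
  one of maximal \<open>\<bar>edet A\<bar>\<close> is taken, and \<open>L\<close> is the inverse of
  \<open>A\<close>. A point of \<open>K\<close> too far away in these coordinates would allow a
  stretched ball of larger determinant.\<close>

theorem john_ellipsoid:
  fixes K :: "'a::euclidean_space set"
  assumes K: "compact K" "convex K" and int: "interior K \<noteq> {}"
  obtains c and L :: "'a \<Rightarrow> 'a" where "linear L" "inj L"
    "\<And>x. norm (L (x - c)) \<le> 1 \<Longrightarrow> x \<in> K" "\<And>x. x \<in> K \<Longrightarrow> norm (L (x - c)) \<le> DIM('a)"
proof -
  define S where "S = {(c, A :: 'a \<Rightarrow>\<^sub>L 'a). \<forall>x\<in>cball 0 1. c + blinfun_apply A x \<in> K}"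
  obtain R where R: "\<And>x. x \<in> K \<Longrightarrow> norm x \<le> R"
    using compact_imp_bounded[OF K(1)] unfolding bounded_iff by blast
  have "closed S"
  proof -
    have "S = (\<Inter>x\<in>cball 0 1. (\<lambda>(c, A). c + blinfun_apply A x) -` K)" by (auto simp: S_def)
    moreover have "closed ((\<lambda>(c, A :: 'a \<Rightarrow>\<^sub>L 'a). c + blinfun_apply A x) -` K)" for x
      unfolding case_prod_beta'
      by (intro closed_vimage compact_imp_closed[OF K(1)] continuous_intros)
    ultimately show ?thesis by auto
  qed
  moreover have "bounded S"
  proof -
    have "norm (c, A) \<le> R + 2 * R" if "(c, A) \<in> S" for c A
    proof -
      have "c + blinfun_apply A 0 \<in> K" using that by (force simp: S_def dest!: bspec[of _ _ 0])
      hence c: "norm c \<le> R" using R[of c] by simp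
      hence R0: "R \<ge> 0" using norm_ge_zero order.trans by blast
      have "norm A \<le> 2 * R"
      proof (rule norm_blinfun_bound)
        show "0 \<le> 2 * R" using R0 by simp
        fix x
        show "norm (blinfun_apply A x) \<le> 2 * R * norm x"
        proof (cases "x = 0")
          case False
          have "c + blinfun_apply A (x /\<^sub>R norm x) \<in> K" using that False by (auto simp: S_def)
          hence "norm (c + blinfun_apply A (x /\<^sub>R norm x)) \<le> R" by (rule R)
          hence "norm (blinfun_apply A (x /\<^sub>R norm x)) \<le> 2 * R"
            using c norm_triangle_ineq4[of "c + blinfun_apply A (x /\<^sub>R norm x)" c] by simp
          thus ?thesis using False by (simp add: blinfun.scaleR_right field_simps)
        qed simp
      qed
      thus ?thesis using norm_Pair_le[of c A] c by linarith
    qed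
    thus ?thesis unfolding bounded_iff by (intro exI[of _ "R + 2 * R"]) auto
  qed
  ultimately have "compact S" by (simp add: compact_eq_bounded_closed)
  obtain c0 r where r: "r > 0" "cball c0 r \<subseteq> K"
    using int by (metis ex_in_conv mem_interior_cball)
  have lin: "linear (blinfun_apply A)" for A :: "'a \<Rightarrow>\<^sub>L 'a"
    using blinfun.bounded_linear_right bounded_linear.linear by blast
  define A0 :: "'a \<Rightarrow>\<^sub>L 'a" where "A0 = r *\<^sub>R id_blinfun"
  have A0: "(c0, A0) \<in> S"
  proof -
    have "c0 + r *\<^sub>R x \<in> K" if "norm x \<le> 1" for x
      using r that by (intro subsetD[OF r(2)]) (auto simp: dist_norm mult_left_le)
    thus ?thesis by (auto simp: S_def A0_def blinfun.scaleR_left)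
  qed
  \<comment> \<open>A small ball inside \<open>K\<close> competes with nonzero determinant, so the
    maximiser is invertible.\<close>
  have "inj (blinfun_apply A0)" using r by (auto simp: inj_def A0_def blinfun.scaleR_left)
  hence d0: "edet (blinfun_apply A0) \<noteq> 0" using edet_nz_iff_inj[OF lin] by blast
  have "continuous_on S (\<lambda>x. \<bar>edet (blinfun_apply (snd x))\<bar>)"
    by (intro continuous_on_rabs continuous_on_compose2[OF continuous_on_edet[of UNIV]] continuous_on_snd
        continuous_on_id subset_UNIV)
  from continuous_attains_sup[OF \<open>compact S\<close> _ this] A0
  obtain c A where cA: "(c, A) \<in> S"
    and max: "\<And>c' A'. (c', A') \<in> S \<Longrightarrow> \<bar>edet (blinfun_apply A')\<bar> \<le> \<bar>edet (blinfun_apply A)\<bar>"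
    by (metis empty_iff prod.collapse snd_conv)
  have dA: "edet (blinfun_apply A) \<noteq> 0" using max[OF A0] d0 by auto
  hence injA: "inj (blinfun_apply A)" using edet_nz_iff_inj[OF lin] by blast
  obtain L where L: "linear L" "\<And>x. L (blinfun_apply A x) = x" "\<And>x. blinfun_apply A (L x) = x"
    using linear_injective_isomorphism[OF lin injA] by blast
  have injL: "inj L" by (metis L(3) injI)
  have "x \<in> K" if "norm (L (x - c)) \<le> 1" for x
  proof -
    have "c + blinfun_apply A (L (x - c)) \<in> K" using cA that by (auto simp: S_def)
    thus ?thesis by (simp add: L)
  qed
  moreover have "norm (L (x - c)) \<le> DIM('a)" if xK: "x \<in> K" for x
  proof (rule ccontr)
    assume far: "\<not> ?thesis"
    define p where "p = L (x - c)"
    define d where "d = norm p"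
    have d: "d > real DIM('a)" using far by (simp add: d_def p_def)
    hence d1: "d > 1" using DIM_positive[where 'a = 'a] by linarith
    have "DIM('a) \<ge> 1" using DIM_positive[where 'a = 'a] by linarith
    from john_volume_gain[OF this d] obtain t b where tb: "t > 0" "1 + 2 * t \<le> d"
      "b\<^sup>2 = 1 - 2 * t / (d - 1)" "b \<ge> 0" "(1 + t) * b ^ (DIM('a) - 1) > 1" by blast
    define e where "e = p /\<^sub>R d"
    have e: "norm e = 1" using d1 by (simp add: e_def d_def[symmetric])
    \<comment> \<open>\<open>K\<close> is pulled back to the coordinates in which the maximal
      ellipsoid is the unit ball and the far point is \<open>p\<close>.\<close>
    define K' where "K' = {y. c + blinfun_apply A y \<in> K}"
    have K'1: "closed K'"
    proof -
      have "K' = (\<lambda>y. c + blinfun_apply A y) -` K" by (auto simp: K'_def)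
      thus ?thesis
        by (simp only:) (intro closed_vimage compact_imp_closed[OF K(1)] continuous_intros)
    qed
    have K'2: "convex K'"
    proof (rule convexI)
      fix y z and u v :: real
      assume h: "y \<in> K'" "z \<in> K'" "0 \<le> u" "0 \<le> v" "u + v = 1"
      have "u *\<^sub>R (c + blinfun_apply A y) + v *\<^sub>R (c + blinfun_apply A z) \<in> K"
        using h convexD[OF K(2)] by (simp add: K'_def)
      moreover have "u *\<^sub>R (c + blinfun_apply A y) + v *\<^sub>R (c + blinfun_apply A z)
          = (u + v) *\<^sub>R c + blinfun_apply A (u *\<^sub>R y + v *\<^sub>R z)"
        by (simp add: blinfun.add_right blinfun.scaleR_right algebra_simps)
      ultimately show "u *\<^sub>R y + v *\<^sub>R z \<in> K'" using h by (simp add: K'_def)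
    qed
    have K'3: "cball 0 1 \<subseteq> K'" using cA by (auto simp: K'_def S_def)
    have K'4: "p \<in> K'" using xK by (simp add: K'_def p_def L)
    define D where "D = Blinfun (stretch (1 + t) b e)"
    have bl: "bounded_linear (stretch (1 + t) b e)"
      using linear_stretch linear_conv_bounded_linear by blast
    have D: "blinfun_apply D = stretch (1 + t) b e"
      unfolding D_def by (rule bounded_linear_Blinfun_apply[OF bl])
    have "(c + blinfun_apply A (t *\<^sub>R e), A o\<^sub>L D) \<in> S"
    proof -
      have "c + blinfun_apply A (t *\<^sub>R e) + blinfun_apply A (stretch (1 + t) b e y) \<in> K" if "norm y \<le> 1" for y
        using stretched_ball_subset[OF K'1 K'2 K'3 K'4 d_def d1 tb(1,2,3) that]
        unfolding K'_def e_def[symmetric] by (simp add: blinfun.add_right add.assoc)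
      thus ?thesis by (auto simp: S_def D)
    qed
    from max[OF this] have "\<bar>edet (blinfun_apply A \<circ> stretch (1 + t) b e)\<bar> \<le> \<bar>edet (blinfun_apply A)\<bar>"
      by (simp add: D blinfun_compose.rep_eq)
    hence "\<bar>edet (blinfun_apply A)\<bar> * ((1 + t) * b ^ (DIM('a) - 1)) \<le> \<bar>edet (blinfun_apply A)\<bar>"
      using tb by (simp add: edet_compose[OF lin linear_stretch] edet_stretch[OF e] abs_mult)
    thus False using tb(5) dA by (simp add: mult_le_cancel_left2)
  qed
  ultimately show ?thesis using that[OF L(1) injL] by blast
qed

section \<open>Volumes and means\<close>

text \<open>An unbounded convex set that contains a ball around \<open>c\<close> also contains,
  along a segment from \<open>c\<close> to a far point, arbitrarily many disjoint balls of half the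
  radius. The class in \<open>G_convex\<close> asks only for finite volume, whereas compactness
  arguments need boundedness.\<close>

lemma finite_measure_convex_bounded:
  fixes \<Omega> :: "'a::euclidean_space set"
  assumes \<Omega>: "open \<Omega>" "convex \<Omega>" and fin: "emeasure lebesgue \<Omega> < \<infinity>"
  shows "bounded \<Omega>"
proof (rule ccontr)
  assume unb: "\<not> bounded \<Omega>"
  then obtain c where "c \<in> \<Omega>" by (metis bounded_empty ex_in_conv)
  then obtain r where r: "r > 0" "cball c r \<subseteq> \<Omega>" using \<Omega>(1) open_contains_cball by blast
  define V where "V = measure lebesgue (ball (0::'a) (r/2))"
  have V: "V > 0" using r by (simp add: V_def content_ball_pos)
  have lm: "\<Omega> \<in> lmeasurable" using fin \<Omega>(1) by (simp add: fmeasurable_def)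
  have "real n * V \<le> measure lebesgue \<Omega>" for n
  proof -
    have "\<exists>x\<in>\<Omega>. norm (x - c) > 2 * r * real (Suc n)"
    proof (rule ccontr)
      assume "\<not> ?thesis"
      hence "\<forall>x\<in>\<Omega>. dist c x \<le> 2 * r * real (Suc n)"
        by (simp add: not_less dist_norm norm_minus_commute)
      thus False using unb unfolding bounded_def by blast
    qed
    then obtain x where x: "x \<in> \<Omega>" "norm (x - c) > 2 * r * real (Suc n)" by blast
    define D where "D = norm (x - c)"
    have "0 \<le> 2 * r * real (Suc n)" using r by simp
    hence D: "D > 0" using x(2) unfolding D_def by linarith
    \<comment> \<open>The centres lie at distances \<open>i * r\<close> from \<open>c\<close>, hence
      \<open>r\<close> apart. As \<open>x\<close> is farther than \<open>2 * r * (n + 1)\<close>,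
      all \<open>n\<close> of them stay in the first half of the segment.\<close>
    define \<tau> where "\<tau> i = real i * r / D" for i
    define y where "y i = c + \<tau> i *\<^sub>R (x - c)" for i
    have dist_y: "dist (y i) (y j) = \<bar>real i - real j\<bar> * r" for i j
    proof -
      have "y i - y j = (\<tau> i - \<tau> j) *\<^sub>R (x - c)" by (simp add: y_def scaleR_left_diff_distrib)
      moreover have "\<tau> i - \<tau> j = (real i - real j) * r / D"
        by (simp add: \<tau>_def diff_divide_distrib left_diff_distrib)
      ultimately have "dist (y i) (y j) = \<bar>(real i - real j) * r / D\<bar> * D"
        by (simp add: dist_norm D_def)
      thus ?thesis using D r by (simp add: abs_mult)
    qed
    have sub: "ball (y i) (r/2) \<subseteq> \<Omega>" if "i \<in> {..<n}" for i
    proof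
      fix z assume z: "z \<in> ball (y i) (r/2)"
      have \<tau>: "0 \<le> \<tau> i" "\<tau> i \<le> 1/2"
      proof -
        show "0 \<le> \<tau> i" using r D by (simp add: \<tau>_def)
        have "2 * r * real i \<le> 2 * r * real (Suc n)" using that r by (intro mult_left_mono) auto
        hence "2 * r * real i \<le> D" using x(2) unfolding D_def by linarith
        hence "real i * r \<le> 1/2 * D" by argo
        thus "\<tau> i \<le> 1/2" unfolding \<tau>_def using D by (subst pos_divide_le_eq)
      qed
      \<comment> \<open>\<open>z\<close> is the convex combination of \<open>c'\<close> and the far
        point \<open>x\<close> with weight \<open>\<tau> i\<close>; since
        \<open>\<tau> i \<le> 1/2\<close>, a deviation below \<open>r / 2\<close> from
        \<open>y i\<close> places \<open>c'\<close> in the ball of radius \<open>r\<close> about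
        \<open>c\<close>.\<close>
      define c' where "c' = c + (z - y i) /\<^sub>R (1 - \<tau> i)"
      have "norm (z - y i) \<le> r * (1 - \<tau> i)"
      proof -
        have "norm (z - y i) \<le> r * (1/2)" using z by (simp add: dist_norm norm_minus_commute)
        also have "\<dots> \<le> r * (1 - \<tau> i)" using \<tau> r by (intro mult_left_mono) auto
        finally show ?thesis .
      qed
      moreover have \<tau>1: "1 - \<tau> i > 0" using \<tau> by linarith
      ultimately have "norm (z - y i) / (1 - \<tau> i) \<le> r" by (subst pos_divide_le_eq)
      moreover have "norm (c' - c) = norm (z - y i) / (1 - \<tau> i)"
      proof -
        have "norm (c' - c) = \<bar>inverse (1 - \<tau> i)\<bar> * norm (z - y i)" by (simp add: c'_def)
        thus ?thesis using \<tau>1 by (simp add: divide_inverse mult.commute)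
      qed
      ultimately have "c' \<in> cball c r" by (simp add: dist_norm norm_minus_commute)
      hence "c' \<in> \<Omega>" using r(2) by blast
      moreover have "(1 - \<tau> i) *\<^sub>R c' = (1 - \<tau> i) *\<^sub>R c + (z - y i)"
        using \<tau>1 by (simp add: c'_def scaleR_add_right)
      hence "(1 - \<tau> i) *\<^sub>R c' + \<tau> i *\<^sub>R x = z" by (simp add: y_def algebra_simps)
      ultimately show "z \<in> \<Omega>" using convexD[OF \<Omega>(2), of c' x "1 - \<tau> i" "\<tau> i"] x \<tau> by simp
    qed
    have disj: "disjoint_family_on (\<lambda>i. ball (y i) (r/2)) {..<n}"
      unfolding disjoint_family_on_def
    proof (intro ballI impI)
      fix i j :: nat assume "i \<noteq> j"
      hence "\<bar>real i - real j\<bar> \<ge> 1" by linarith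
      hence "dist (y i) (y j) \<ge> r" using dist_y r by simp
      thus "ball (y i) (r/2) \<inter> ball (y j) (r/2) = {}"
        by (intro disjoint_ballI) simp
    qed
    have "real n * V = (\<Sum>i<n. measure lebesgue (ball (y i) (r/2)))"
    proof -
      have "measure lebesgue (ball (y i) (r/2)) = V" for i
        using measure_translation[of "y i" "ball 0 (r/2)"] by (simp add: V_def ball_translation image_add_ball)
      thus ?thesis by simp
    qed
    also have "\<dots> = measure lebesgue (\<Union>i<n. ball (y i) (r/2))"
    proof (intro measure_finite_Union[symmetric] disj)
      show "emeasure lebesgue (ball (y i) (r/2)) \<noteq> \<infinity>" for i
        using emeasure_lborel_ball_finite[of "y i" "r/2"] by simp
    qed auto
    also have "\<dots> \<le> measure lebesgue \<Omega>"
      using sub lm by (intro measure_mono_fmeasurable) auto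
    finally show ?thesis .
  qed
  moreover obtain n where "measure lebesgue \<Omega> / V < real n" using reals_Archimedean2 by blast
  hence "measure lebesgue \<Omega> < real n * V" using V by (simp add: pos_divide_less_eq)
  ultimately show False by (meson linorder_not_less)
qed

section \<open>Volumes of and integrals over ellipsoids\<close>

lemma continuous_on_norm_linear:
  fixes L :: "'a::euclidean_space \<Rightarrow> 'b::euclidean_space"
  assumes "linear L"
  shows "continuous_on A (\<lambda>x. norm (L (x - c)))"
proof -
  have "continuous_on UNIV L" using assms by (simp add: linear_continuous_on linear_linear)
  hence "continuous_on A (\<lambda>x. L (x - c))"
    by (rule continuous_on_compose2) (auto intro!: continuous_on_diff)
  thus ?thesis by (rule continuous_on_norm)
qed

lemma open_ellipsoid:
  fixes L :: "'a::euclidean_space \<Rightarrow> 'b::euclidean_space"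
  assumes "linear L"
  shows "open {x. norm (L (x - c)) < r}"
  by (intro open_Collect_less continuous_on_norm_linear assms continuous_on_const)

lemma emeasure_ellipsoid:
  fixes L :: "'a::euclidean_space \<Rightarrow> 'a"
  assumes L: "linear L" and r: "r > 0"
  shows "emeasure lebesgue {x. norm (L (x - c)) < r} = ennreal (r ^ DIM('a)) * emeasure lebesgue {x. norm (L (x - c)) < 1}"
proof -
  let ?f = "\<lambda>x. r *\<^sub>R x + (c - r *\<^sub>R c)"
  have f: "?f x - c = r *\<^sub>R (x - c)" for x by (simp add: algebra_simps)
  have n: "norm (L (?f x - c)) = r * norm (L (x - c))" for x
    unfolding f using r by (simp add: linear_scale[OF L])
  have "{x. norm (L (x - c)) < r} = ?f ` {x. norm (L (x - c)) < 1}"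
  proof (intro subset_antisym subsetI)
    fix y assume y: "y \<in> {x. norm (L (x - c)) < r}"
    define x where "x = c + (y - c) /\<^sub>R r"
    have xy: "?f x = y" using r by (simp add: x_def algebra_simps)
    hence "r * norm (L (x - c)) < r" using n[of x] y by simp
    hence "norm (L (x - c)) < 1" using r by simp
    thus "y \<in> ?f ` {x. norm (L (x - c)) < 1}" using xy by (intro image_eqI[of _ _ x]) auto
  next
    fix y assume "y \<in> ?f ` {x. norm (L (x - c)) < 1}"
    thus "y \<in> {x. norm (L (x - c)) < r}" using n r by auto
  qed
  thus ?thesis using r by (simp add: emeasure_lebesgue_affine ennreal_power)
qed

lemma has_integral_powr_tail:
  fixes a p :: real
  assumes "a \<le> 1" "p > 0"
  shows "((\<lambda>s. p * (1 - s) powr (p - 1)) has_integral (1 - a) powr p) {a..1}"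
proof -
  have "((\<lambda>s. p * (1 - s) powr (p - 1)) has_integral (- ((1 - 1) powr p) - - ((1 - a) powr p))) {a..1}"
  proof (rule fundamental_theorem_of_calculus_interior)
    show "continuous_on {a..1} (\<lambda>s. - ((1 - s) powr p))"
      using assms by (intro continuous_intros continuous_on_powr') auto
    show "((\<lambda>s. - ((1 - s) powr p)) has_vector_derivative p * (1 - s) powr (p - 1)) (at s)"
      if "s \<in> {a<..<1}" for s
      using that unfolding has_real_derivative_iff_has_vector_derivative[symmetric]
      by (auto intro!: derivative_eq_intros)
  qed (use assms in auto)
  thus ?thesis by simp
qed

text \<open>The layer cake weight: \<open>(1 - \<rho>) powr p\<close> is the integral of its
  negative derivative over the levels above \<open>\<rho>\<close>. The empty interval for
  \<open>a \<ge> 1\<close> later supplies the indicator of the ellipsoid.\<close>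

lemma nn_integral_powr_tail:
  fixes a p :: real
  assumes "p > 0"
  shows "(\<integral>\<^sup>+s. ennreal (p * (1 - s) powr (p - 1)) * indicator {a<..<1} s \<partial>lborel) =
    (if a < 1 then ennreal ((1 - a) powr p) else 0)"
proof (cases "a < 1")
  case True
  have "((\<lambda>s. p * (1 - s) powr (p - 1)) has_integral (1 - a) powr p) {a<..<1}"
    using has_integral_powr_tail[of a p] True assms by (simp add: has_integral_Icc_iff_Ioo)
  from nn_integral_has_integral_lebesgue[OF _ this] assms
  have "(\<integral>\<^sup>+s. ennreal (indicator {a<..<1} s * (p * (1 - s) powr (p - 1))) \<partial>lborel) = ennreal ((1 - a) powr p)"
    by simp
  moreover have "ennreal (indicator {a<..<1} s * (p * (1 - s) powr (p - 1))) =
      ennreal (p * (1 - s) powr (p - 1)) * indicator {a<..<1} s" for s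
    by (simp split: split_indicator)
  ultimately show ?thesis using True by simp
next
  case False
  hence "{a<..<1} = {}" by auto
  thus ?thesis using False by simp
qed

text \<open>Layer cake: the superlevel sets of \<open>1 - norm (L (x - c))\<^sup>2\<close> are dilates of one ellipsoid, so the integral
  reduces to a Beta integral.\<close>

lemma nn_integral_ellipsoid:
  fixes L :: "'a::euclidean_space \<Rightarrow> 'a" and c :: 'a
  assumes L: "linear L" and p: "p > 0"
  defines "E \<equiv> {x. norm (L (x - c)) < 1}"
  shows "(\<integral>\<^sup>+x. ennreal ((1 - (norm (L (x - c)))\<^sup>2) powr p) * indicator E x \<partial>lborel) =
    ennreal (Gamma (real DIM('a) / 2 + 1) * Gamma (p + 1) / Gamma (real DIM('a) / 2 + p + 1)) * emeasure lborel E"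
proof -
  define m where "m = real DIM('a)"
  have m: "m > 0" by (simp add: m_def)
  have contL: "continuous_on UNIV (\<lambda>x. norm (L (x - c)))"
    by (rule continuous_on_norm_linear[OF L])
  define \<rho> where "\<rho> x = (norm (L (x - c)))\<^sup>2" for x
  have [measurable]: "\<rho> \<in> borel_measurable borel"
    unfolding \<rho>_def[abs_def] by (intro borel_measurable_continuous_onI continuous_on_power contL)
  have E: "E = {x. \<rho> x < 1}" by (auto simp: E_def \<rho>_def power_less_one_iff abs_square_less_1)
  define k where "k s = ennreal (p * (1 - s) powr (p - 1))" for s :: real
  have [measurable]: "k \<in> borel_measurable borel" unfolding k_def[abs_def] by measurable
  have \<rho>0: "\<rho> x \<ge> 0" for x by (simp add: \<rho>_def)
  \<comment> \<open>\<open>\<rho>\<close> is a squared norm, so level \<open>s\<close> corresponds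
    to dilation by \<open>sqrt s\<close>; this is the source of the exponent \<open>m / 2\<close> in
    the Beta integral.\<close>
  have lev: "emeasure lborel {x. \<rho> x < s} = ennreal (s powr (m/2)) * emeasure lborel E" if s: "s > 0" for s
  proof -
    have "{x. \<rho> x < s} = {x. norm (L (x - c)) < sqrt s}"
    proof -
      have "(norm (L (x - c)))\<^sup>2 < s \<longleftrightarrow> norm (L (x - c)) < sqrt s" for x
        using real_sqrt_less_iff[of "(norm (L (x - c)))\<^sup>2" s] by simp
      thus ?thesis by (simp add: \<rho>_def)
    qed
    hence "emeasure lebesgue {x. \<rho> x < s} = ennreal (sqrt s ^ DIM('a)) * emeasure lebesgue E"
      using emeasure_ellipsoid[OF L, of "sqrt s" c] s by (simp add: E_def)
    moreover have "sqrt s ^ DIM('a) = s powr (m/2)"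
      using s by (simp add: m_def powr_half_sqrt[symmetric] powr_realpow[symmetric] powr_powr)
    moreover have "{x. \<rho> x < s} \<in> sets borel" "E \<in> sets borel" unfolding E by measurable
    ultimately show ?thesis by simp
  qed
  have "(\<integral>\<^sup>+x. ennreal ((1 - (norm (L (x - c)))\<^sup>2) powr p) * indicator E x \<partial>lborel)
      = (\<integral>\<^sup>+x. (\<integral>\<^sup>+s. k s * indicator {\<rho> x<..<1} s \<partial>lborel) \<partial>lborel)"
    unfolding k_def nn_integral_powr_tail[OF p] by (intro nn_integral_cong) (auto simp: E \<rho>_def)
  also have "\<dots> = (\<integral>\<^sup>+s. (\<integral>\<^sup>+x. k s * indicator {\<rho> x<..<1} s \<partial>lborel) \<partial>lborel)"
  proof (rule lborel_pair.Fubini'[symmetric])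
    have "case_prod (\<lambda>x s. k s * indicator {\<rho> x<..<1} s) =
        (\<lambda>z. k (snd z) * indicator {z. \<rho> (fst z) < snd z \<and> snd z < 1} z)"
      by (auto simp: fun_eq_iff split: split_indicator)
    moreover have "(\<lambda>z. k (snd z) * indicator {z. \<rho> (fst z) < snd z \<and> snd z < 1} z)
        \<in> borel_measurable (lborel \<Otimes>\<^sub>M lborel)" by measurable
    ultimately show "case_prod (\<lambda>x s. k s * indicator {\<rho> x<..<1} s) \<in> borel_measurable (lborel \<Otimes>\<^sub>M lborel)"
      by simp
  qed
  also have "\<dots> = (\<integral>\<^sup>+s. ennreal (indicator {0..1} s * (p * (s powr (m/2 + 1 - 1) * (1 - s) powr (p - 1)))) * emeasure lborel E \<partial>lborel)"
  proof (rule nn_integral_cong_AE)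
    have "AE s in lborel. s \<noteq> (0::real)" "AE s in lborel. s \<noteq> (1::real)" by (rule AE_lborel_singleton)+
    thus "AE s in lborel. (\<integral>\<^sup>+x. k s * indicator {\<rho> x<..<1} s \<partial>lborel) =
        ennreal (indicator {0..1} s * (p * (s powr (m/2 + 1 - 1) * (1 - s) powr (p - 1)))) * emeasure lborel E"
    proof eventually_elim
      fix s :: real assume s: "s \<noteq> 0" "s \<noteq> 1"
      show "(\<integral>\<^sup>+x. k s * indicator {\<rho> x<..<1} s \<partial>lborel) =
        ennreal (indicator {0..1} s * (p * (s powr (m/2 + 1 - 1) * (1 - s) powr (p - 1)))) * emeasure lborel E"
      proof (cases "0 < s \<and> s < 1")
        case True
        have "(\<integral>\<^sup>+x. k s * indicator {\<rho> x<..<1} s \<partial>lborel) = (\<integral>\<^sup>+x. k s * indicator {x. \<rho> x < s} x \<partial>lborel)"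
          using True by (intro nn_integral_cong) (auto split: split_indicator)
        also have "\<dots> = k s * emeasure lborel {x. \<rho> x < s}"
          by (rule nn_integral_cmult_indicator) measurable
        also have "\<dots> = ennreal (p * (1 - s) powr (p - 1) * s powr (m/2)) * emeasure lborel E"
          using True p by (simp add: lev k_def ennreal_mult mult.assoc)
        finally show ?thesis using True by (simp add: mult_ac)
      next
        case False
        have "\<rho> x < s \<Longrightarrow> s < 1 \<Longrightarrow> False" for x using False \<rho>0[of x] by linarith
        hence "indicator {\<rho> x<..<1} s = (0::ennreal)" for x by (fastforce split: split_indicator)
        moreover have "s \<notin> {0..1}" using False s by auto
        ultimately show ?thesis by simp
      qed
    qed
  qed
  also have "\<dots> = (\<integral>\<^sup>+s. ennreal (indicator {0..1} s * (p * (s powr (m/2 + 1 - 1) * (1 - s) powr (p - 1)))) \<partial>lborel) * emeasure lborel E"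
    by (rule nn_integral_multc) measurable
  also have "(\<integral>\<^sup>+s. ennreal (indicator {0..1} s * (p * (s powr (m/2 + 1 - 1) * (1 - s) powr (p - 1)))) \<partial>lborel)
      = ennreal (p * Beta (m/2 + 1) p)"
    using p m by (intro nn_integral_has_integral_lebesgue has_integral_mult_right has_integral_Beta_real) auto
  also have "p * Beta (m/2 + 1) p = Gamma (m / 2 + 1) * Gamma (p + 1) / Gamma (m / 2 + p + 1)"
  proof -
    have "p \<notin> \<int>\<^sub>\<le>\<^sub>0" using p by (auto elim!: nonpos_Ints_cases)
    hence "Gamma (p + 1) = p * Gamma p" by (rule Gamma_plus1)
    moreover have eq: "m / 2 + 1 + p = m / 2 + p + 1" by simp
    ultimately show ?thesis unfolding Beta_def eq by simp
  qed
  finally show ?thesis by (simp add: m_def)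
qed

text \<open>Jensen's inequality through the tangent of \<open>y powr r\<close> at 1: with
  \<open>r = q / p\<close>, the function \<open>f powr p\<close> divided by its mean
  \<open>A\<close> has mean 1, so the linear term of \<open>1 + r * (y - 1)\<close> integrates to
  0.\<close>

lemma power_mean_mono:
  fixes f :: "'a \<Rightarrow> real"
  assumes fin: "finite_measure M" and \<mu>: "measure M (space M) > 0" and pq: "0 < p" "p \<le> q"
    and f: "\<And>x. f x \<ge> 0" and ip: "integrable M (\<lambda>x. f x powr p)" and iq: "integrable M (\<lambda>x. f x powr q)"
  shows "(\<integral>x. f x powr p \<partial>M) powr (1 / p) / measure M (space M) powr (1 / p) \<le>
         (\<integral>x. f x powr q \<partial>M) powr (1 / q) / measure M (space M) powr (1 / q)"
proof -
  interpret finite_measure M by fact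
  define \<mu> where "\<mu> = measure M (space M)"
  have \<mu>0: "\<mu> > 0" using assms by (simp add: \<mu>_def)
  define A where "A = (\<integral>x. f x powr p \<partial>M) / \<mu>"
  define B where "B = (\<integral>x. f x powr q \<partial>M) / \<mu>"
  have A0: "A \<ge> 0" and B0: "B \<ge> 0" using \<mu>0 by (auto simp: A_def B_def)
  have "A powr (1 / p) \<le> B powr (1 / q)"
  proof (cases "A = 0")
    case True
    thus ?thesis by simp
  next
    case False
    hence A: "A > 0" using A0 by simp
    define r where "r = q / p"
    have r: "r \<ge> 1" using pq by (simp add: r_def)
    have bern: "1 + r * (y - 1) \<le> y powr r" if "y \<ge> 0" for y
    proof (cases "y = 0")
      case True thus ?thesis using r by simp
    next
      case False
      hence y: "y > 0" using that by simp
      show ?thesis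
      proof (cases "y = 1")
        case False
        have conv: "convex_on {0<..} (\<lambda>y. y powr r)"
          using r by (intro convex_on_subset[OF powr_convex]) auto
        have d: "((\<lambda>y. y powr r) has_real_derivative r * 1 powr (r - 1)) (at 1)"
          by (auto intro!: derivative_eq_intros)
        have "r * 1 powr (r - 1) * (y - 1) \<le> y powr r - 1 powr r"
          by (rule convex_on_imp_above_tangent[OF conv _ _ _ has_field_derivative_at_within[OF d]])
            (use y in \<open>auto simp: interior_open connected_Ioi\<close>)
        thus ?thesis by simp
      qed simp
    qed
    have "\<mu> = (\<integral>x. 1 + r * (f x powr p / A - 1) \<partial>M)"
    proof -
      have "(\<integral>x. f x powr p \<partial>M) = A * \<mu>" using \<mu>0 by (simp add: A_def)
      hence "(\<integral>x. f x powr p / A \<partial>M) = \<mu>" using A by simp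
      thus ?thesis using ip by (simp add: \<mu>_def)
    qed
    also have "\<dots> \<le> (\<integral>x. f x powr q / A powr r \<partial>M)"
    proof (rule integral_mono)
      show "integrable M (\<lambda>x. 1 + r * (f x powr p / A - 1))" using ip by simp
      show "integrable M (\<lambda>x. f x powr q / A powr r)" using iq by simp
      fix x
      have "(f x powr p / A) powr r = f x powr q / A powr r"
        using f[of x] A pq by (simp add: powr_divide powr_powr r_def)
      thus "1 + r * (f x powr p / A - 1) \<le> f x powr q / A powr r"
        using bern[of "f x powr p / A"] A by simp
    qed
    also have "\<dots> = \<mu> * B / A powr r" using \<mu>0 by (simp add: B_def)
    finally have "A powr r \<le> B" using A \<mu>0 by (simp add: field_simps)
    hence "(A powr r) powr (1 / q) \<le> B powr (1 / q)" using pq by (intro powr_mono2) auto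
    moreover have "(A powr r) powr (1 / q) = A powr (1 / p)" using pq by (simp add: powr_powr r_def)
    ultimately show ?thesis by simp
  qed
  thus ?thesis using \<mu>0 A0 B0 unfolding \<mu>_def[symmetric] A_def B_def by (simp add: powr_divide)
qed

section \<open>Convex domains between two ellipsoids\<close>

lemma adjoint_inner:
  fixes L :: "'a::euclidean_space \<Rightarrow> 'b::euclidean_space"
  assumes "linear L"
  shows "adjoint L y \<bullet> x = L x \<bullet> y"
  using adjoint_works[OF assms, of x y] by (simp add: inner_commute)

lemma poincare_ellipsoid:
  fixes L :: "'a::euclidean_space \<Rightarrow> 'a"
  assumes L: "linear L" "inj L" and m: "m > 0"
    and \<Omega>: "\<And>x. x \<in> \<Omega> \<Longrightarrow> norm (L (x - c)) \<le> m" and t: "test_fun \<Omega> \<phi>"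
  shows "pi\<^sup>2 / (4 * m\<^sup>2) * (\<Sum>i\<in>Basis. (norm (L i))\<^sup>2) * (\<integral>x. (\<phi> x)\<^sup>2 \<partial>lborel)
    \<le> (\<integral>x. (norm (grad \<phi> x))\<^sup>2 \<partial>lborel)"
proof -
  let ?X = "\<integral>x. (\<phi> x)\<^sup>2 \<partial>lborel"
  have dir: "pi\<^sup>2 / (4 * m\<^sup>2) * (norm (L e))\<^sup>2 * ?X \<le> (\<integral>x. (grad \<phi> x \<bullet> e)\<^sup>2 \<partial>lborel)" if e: "e \<in> Basis" for e
  proof -
    have "L e \<noteq> 0"
      using e nonzero_Basis[OF e] linear_injective_0[OF L(1)] L(2) by blast
    hence n: "norm (L e) > 0" by simp
    \<comment> \<open>The functional with \<open>a \<bullet> e = 1\<close> that is constant on the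
      directions \<open>h\<close> with \<open>L h\<close> orthogonal to \<open>L e\<close>. By
      Cauchy-Schwarz it confines \<open>\<Omega>\<close> to a slab of half-width
      \<open>m / norm (L e)\<close> about \<open>c\<close>, which takes the place of the chord
      lengths.\<close>
    define a where "a = adjoint L (L e) /\<^sub>R (norm (L e))\<^sup>2"
    have a: "a \<bullet> x = (L x \<bullet> L e) / (norm (L e))\<^sup>2" for x
      by (simp add: a_def adjoint_inner[OF L(1)] divide_inverse mult.commute)
    have ae: "a \<bullet> e = 1" using n by (simp add: a power2_norm_eq_inner[symmetric])
    have r: "\<bar>a \<bullet> x + - (a \<bullet> c)\<bar> \<le> m / norm (L e)" if "x \<in> \<Omega>" for x
    proof -
      have "\<bar>a \<bullet> x + - (a \<bullet> c)\<bar> = \<bar>L (x - c) \<bullet> L e\<bar> / (norm (L e))\<^sup>2"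
        by (simp add: a linear_diff[OF L(1)] inner_diff_left diff_divide_distrib[symmetric] abs_divide)
      also have "\<dots> \<le> (norm (L (x - c)) * norm (L e)) / (norm (L e))\<^sup>2"
        by (intro divide_right_mono Cauchy_Schwarz_ineq2) auto
      also have "\<dots> = norm (L (x - c)) / norm (L e)" using n by (simp add: power2_eq_square)
      also have "\<dots> \<le> m / norm (L e)" using n \<Omega>[OF that] by (intro divide_right_mono) auto
      finally show ?thesis .
    qed
    \<comment> \<open>\<open>k0 * (m / norm (L e))\<close> equals \<open>pi / 2\<close>, the
      endpoint excluded in \<open>poincare_direction\<close>. The sharp constant is therefore
      reached through \<open>sqrt z * k0\<close> with \<open>z < 1\<close> arbitrary.\<close>
    define k0 where "k0 = pi * norm (L e) / (2 * m)"
    have k0: "k0 > 0" using n m by (simp add: k0_def)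
    have "k0\<^sup>2 * ?X \<le> (\<integral>x. (grad \<phi> x \<bullet> e)\<^sup>2 \<partial>lborel)"
    proof (rule field_le_mult_one_interval)
      fix z :: real assume z: "0 < z" "z < 1"
      define k where "k = sqrt z * k0"
      have k: "k > 0" using z k0 by (simp add: k_def)
      have "k * (m / norm (L e)) = sqrt z * (pi / 2)" using n m by (simp add: k_def k0_def)
      also have "\<dots> < pi / 2" using z by simp
      finally have kr: "k * (m / norm (L e)) < pi / 2" .
      have "k\<^sup>2 * ?X \<le> (\<integral>x. (grad \<phi> x \<bullet> e)\<^sup>2 \<partial>lborel)"
        by (rule poincare_direction[OF t ae r k kr])
      thus "z * (k0\<^sup>2 * ?X) \<le> (\<integral>x. (grad \<phi> x \<bullet> e)\<^sup>2 \<partial>lborel)"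
        using z by (simp add: k_def power_mult_distrib mult.assoc)
    qed
    moreover have "k0\<^sup>2 = pi\<^sup>2 / (4 * m\<^sup>2) * (norm (L e))\<^sup>2"
      by (simp add: k0_def power_divide power_mult_distrib)
    ultimately show ?thesis by simp
  qed
  have int: "integrable lborel (\<lambda>x. (grad \<phi> x \<bullet> e)\<^sup>2)" for e
    by (rule integrable_test_fun_cont[OF t]) (auto intro!: continuous_intros test_fun_continuous[OF t])
  have "pi\<^sup>2 / (4 * m\<^sup>2) * (\<Sum>i\<in>Basis. (norm (L i))\<^sup>2) * ?X =
      (\<Sum>i\<in>Basis. pi\<^sup>2 / (4 * m\<^sup>2) * (norm (L i))\<^sup>2 * ?X)"
    by (simp add: sum_distrib_left sum_distrib_right)
  also have "\<dots> \<le> (\<Sum>i\<in>Basis. \<integral>x. (grad \<phi> x \<bullet> i)\<^sup>2 \<partial>lborel)"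
    by (intro sum_mono dir)
  also have "\<dots> = (\<integral>x. (\<Sum>i\<in>Basis. (grad \<phi> x \<bullet> i)\<^sup>2) \<partial>lborel)"
    using int by (simp add: Bochner_Integration.integral_sum)
  also have "(\<lambda>x. \<Sum>i\<in>Basis. (grad \<phi> x \<bullet> i)\<^sup>2) = (\<lambda>x. (norm (grad \<phi> x))\<^sup>2)"
    by (auto simp: norm_grad_sq grad_inner_Basis)
  finally show ?thesis .
qed

section \<open>Barriers for the torsion function from below and from above\<close>

definition ellipsoid_torsion :: "('a::euclidean_space \<Rightarrow> 'a) \<Rightarrow> 'a \<Rightarrow> 'a \<Rightarrow> real" where
  "ellipsoid_torsion L c x = (1 - (norm (L (x - c)))\<^sup>2) / (2 * (\<Sum>i\<in>Basis. (norm (L i))\<^sup>2))"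

lemma smooth_ellipsoid_torsion:
  assumes "linear L"
  shows "smooth (ellipsoid_torsion L c)"
proof -
  have sq: "(norm (L (x - c)))\<^sup>2 = (\<Sum>j\<in>Basis. (adjoint L j \<bullet> x - L c \<bullet> j) * (adjoint L j \<bullet> x - L c \<bullet> j))" for x
    unfolding power2_norm_eq_inner
    by (subst euclidean_inner) (simp add: linear_diff[OF assms] adjoint_inner[OF assms] inner_diff_left)
  have eq: "ellipsoid_torsion L c = (\<lambda>x. 1 / (2 * (\<Sum>i\<in>Basis. (norm (L i))\<^sup>2)) *
      (1 - (\<Sum>j\<in>Basis. (adjoint L j \<bullet> x - L c \<bullet> j) * (adjoint L j \<bullet> x - L c \<bullet> j))))"
    unfolding ellipsoid_torsion_def[abs_def] sq by simp
  show ?thesis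
    unfolding eq by (intro smooth_mult smooth_diff smooth_sum smooth_const smooth_inner)
qed

text \<open>The second derivative of \<open>|L (x - c)|^2\<close> in direction \<open>i\<close> is
  \<open>2 * |L i|^2\<close>, so dividing by \<open>2 * S\<close> normalises the trace of the
  Hessian. The shift by \<open>\<delta>\<close> is carried along because the comparison uses the
  lowered quadratic.\<close>

lemma laplacian_ellipsoid_torsion:
  fixes L :: "'a::euclidean_space \<Rightarrow> 'a"
  assumes L: "linear L" and S: "(\<Sum>i\<in>Basis. (norm (L i))\<^sup>2) > 0"
  shows "laplacian (\<lambda>x. ellipsoid_torsion L c x - \<delta>) x = -1"
proof -
  let ?S = "\<Sum>i\<in>Basis. (norm (L i))\<^sup>2"
  have bl: "bounded_linear L" using L linear_conv_bounded_linear by blast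
  have dL: "((\<lambda>x. L (x - c)) has_derivative L) (at x)" for x
    by (auto intro!: derivative_eq_intros bounded_linear.has_derivative[OF bl])
  have div: "((\<lambda>x. f x / k) has_derivative (\<lambda>h. f' h / k)) (at x)"
    if "(f has_derivative f') (at x)" for f f' and x :: 'a and k :: real
    by (rule bounded_linear.has_derivative[OF bounded_linear_divide that])
  have d1: "((\<lambda>x. (1 - L (x - c) \<bullet> L (x - c)) / (2 * ?S) - \<delta>) has_derivative
      (\<lambda>h. (0 - (L (x - c) \<bullet> L h + L h \<bullet> L (x - c))) / (2 * ?S) - 0)) (at x)" for x
    by (rule has_derivative_diff[OF div[OF has_derivative_diff[OF
          has_derivative_const has_derivative_inner[OF dL dL]]] has_derivative_const])
  have e1: "(0 - (L y \<bullet> L h + L h \<bullet> L y)) / (2 * ?S) - 0 = - (L y \<bullet> L h) / ?S" for y h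
    by (simp add: inner_commute)
  have p1: "partial_deriv i (\<lambda>x. ellipsoid_torsion L c x - \<delta>) = (\<lambda>x. - (L (x - c) \<bullet> L i) / ?S)" for i
  proof
    fix x
    show "partial_deriv i (\<lambda>x. ellipsoid_torsion L c x - \<delta>) x = - (L (x - c) \<bullet> L i) / ?S"
      using has_derivative_partial[OF d1, of i x]
      unfolding ellipsoid_torsion_def power2_norm_eq_inner by (simp only: e1[unfolded power2_norm_eq_inner])
  qed
  have d2: "((\<lambda>x. - (L (x - c) \<bullet> L i) / ?S) has_derivative (\<lambda>h. - (L h \<bullet> L i) / ?S)) (at x)" for i x
    by (rule div[OF has_derivative_minus[OF has_derivative_inner_left[OF dL]]])
  have p2: "partial_deriv i (partial_deriv i (\<lambda>x. ellipsoid_torsion L c x - \<delta>)) x = - (norm (L i))\<^sup>2 / ?S" for i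
    unfolding p1 has_derivative_partial[OF d2] by (simp add: power2_norm_eq_inner)
  show ?thesis
    unfolding laplacian_def p2 using S by (simp add: sum_negf sum_divide_distrib[symmetric])
qed

text \<open>The superlevel set at 0 is the closed ellipsoid and may reach the boundary of
  \<open>\<Omega>\<close>; at a positive level it lies inside the open ellipsoid and can serve as
  support of a test function.\<close>

lemma compact_ellipsoid_torsion_superlevel:
  fixes L :: "'a::euclidean_space \<Rightarrow> 'a"
  assumes L: "linear L" and S: "(\<Sum>i\<in>Basis. (norm (L i))\<^sup>2) > 0" and \<delta>: "\<delta> > 0"
    and sub: "{x. norm (L (x - c)) < 1} \<subseteq> \<Omega>" and bdd: "bounded \<Omega>"
  shows "compact {x. ellipsoid_torsion L c x \<ge> \<delta>}" "{x. ellipsoid_torsion L c x \<ge> \<delta>} \<subseteq> \<Omega>"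
proof -
  have *: "{x. ellipsoid_torsion L c x \<ge> \<delta>} \<subseteq> {x. norm (L (x - c)) < 1}"
  proof
    fix x assume "x \<in> {x. ellipsoid_torsion L c x \<ge> \<delta>}"
    hence "0 < (1 - (norm (L (x - c)))\<^sup>2) / (2 * (\<Sum>i\<in>Basis. (norm (L i))\<^sup>2))"
      using \<delta> by (simp add: ellipsoid_torsion_def)
    hence "(norm (L (x - c)))\<^sup>2 < 1" using S by (simp add: zero_less_divide_iff)
    thus "x \<in> {x. norm (L (x - c)) < 1}" by (simp add: abs_square_less_1)
  qed
  thus sub': "{x. ellipsoid_torsion L c x \<ge> \<delta>} \<subseteq> \<Omega>" using sub by blast
  have "continuous_on UNIV (ellipsoid_torsion L c)"
    by (rule smooth_continuous[OF smooth_ellipsoid_torsion[OF L]])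
  hence "closed {x. ellipsoid_torsion L c x \<ge> \<delta>}"
    by (intro closed_Collect_le continuous_on_const)
  thus "compact {x. ellipsoid_torsion L c x \<ge> \<delta>}"
    using bounded_subset[OF bdd sub'] compact_eq_bounded_closed by blast
qed

text \<open>The comparison is run with the quadratic lowered by \<open>1 / (n + 1)\<close>, so that
  truncations stay test functions; the countably many exceptional null sets are united before
  \<open>n\<close> tends to infinity.\<close>

lemma torsion_ge_ellipsoid_torsion:
  fixes \<Omega> :: "'a::euclidean_space set" and L :: "'a \<Rightarrow> 'a"
  assumes \<Omega>: "\<Omega> \<in> sets lebesgue" "bounded \<Omega>" and C: "C > 0"
    and P: "\<And>\<phi>. test_fun \<Omega> \<phi> \<Longrightarrow> C * (\<integral>x. (\<phi> x)\<^sup>2 \<partial>lborel) \<le> (\<integral>x. (norm (grad \<phi> x))\<^sup>2 \<partial>lborel)"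
    and v: "is_torsion \<Omega> v" and L: "linear L" and S: "(\<Sum>i\<in>Basis. (norm (L i))\<^sup>2) > 0"
    and sub: "{x. norm (L (x - c)) < 1} \<subseteq> \<Omega>"
  shows "AE x in lebesgue_on \<Omega>. ellipsoid_torsion L c x \<le> v x"
proof -
  let ?w = "ellipsoid_torsion L c"
  have "AE x in lebesgue_on \<Omega>. ?w x - inverse (real (Suc n)) \<le> v x" for n
  proof -
    define \<delta> where "\<delta> = inverse (real (Suc n))"
    have \<delta>: "\<delta> > 0" by (simp add: \<delta>_def)
    have sq: "smooth (\<lambda>x. ?w x - \<delta>)" by (intro smooth_diff smooth_const smooth_ellipsoid_torsion L)
    have "AE x in lebesgue_on \<Omega>. (-1) * (v x - (?w x - \<delta>)) \<le> 0"
    proof (rule torsion_comparison[OF \<Omega> C P v sq])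
      fix \<phi> assume t: "test_fun \<Omega> \<phi>"
      show "test_fun \<Omega> (\<lambda>x. softplus (-1 * (\<phi> x - (?w x - \<delta>))))"
      proof (rule test_funI_supp[where K = "supp \<phi> \<union> {x. ?w x \<ge> \<delta>}"])
        show "smooth (\<lambda>x. softplus (-1 * (\<phi> x - (?w x - \<delta>))))"
          by (intro smooth_softplus smooth_mult smooth_const smooth_diff sq test_funD(1)[OF t])
        show "compact (supp \<phi> \<union> {x. ?w x \<ge> \<delta>})" "supp \<phi> \<union> {x. ?w x \<ge> \<delta>} \<subseteq> \<Omega>"
          using test_funD[OF t] compact_ellipsoid_torsion_superlevel[OF L S \<delta> sub \<Omega>(2)] by auto
        show "softplus (-1 * (\<phi> x - (?w x - \<delta>))) = 0" if "x \<notin> supp \<phi> \<union> {x. ?w x \<ge> \<delta>}" for x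
          using that not_in_supp(1)[of x \<phi>] by (simp add: softplus_eq_0_iff)
      qed
    qed (simp_all add: laplacian_ellipsoid_torsion[OF L S])
    thus ?thesis by (simp add: \<delta>_def algebra_simps)
  qed
  hence "AE x in lebesgue_on \<Omega>. \<forall>n. ?w x - inverse (real (Suc n)) \<le> v x"
    by (simp add: AE_all_countable)
  thus ?thesis
  proof (rule eventually_mono)
    fix x assume h: "\<forall>n. ?w x - inverse (real (Suc n)) \<le> v x"
    have "(\<lambda>n. ?w x - inverse (real (Suc n))) \<longlonglongrightarrow> ?w x - 0"
      by (intro tendsto_diff tendsto_const LIMSEQ_inverse_real_of_nat)
    thus "?w x \<le> v x" using h LIMSEQ_le_const2 by fastforce
  qed
qed

text \<open>A barrier must be nonnegative on the whole space for truncation by it to preserve test functions,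
  which rules out quadratics; a shifted cosine of one coordinate works.\<close>

lemma torsion_bounded_above:
  fixes \<Omega> :: "'a::euclidean_space set"
  assumes \<Omega>: "\<Omega> \<in> sets lebesgue" "bounded \<Omega>" and C: "C > 0"
    and P: "\<And>\<phi>. test_fun \<Omega> \<phi> \<Longrightarrow> C * (\<integral>x. (\<phi> x)\<^sup>2 \<partial>lborel) \<le> (\<integral>x. (norm (grad \<phi> x))\<^sup>2 \<partial>lborel)"
    and v: "is_torsion \<Omega> v"
  obtains B where "AE x in lebesgue_on \<Omega>. v x \<le> B"
proof -
  obtain R where R: "R > 0" "\<And>x. x \<in> \<Omega> \<Longrightarrow> norm x \<le> R"
    using \<Omega>(2) unfolding bounded_pos by blast
  obtain e :: 'a where e: "e \<in> Basis" using nonempty_Basis by blast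
  define \<theta> where "\<theta> x = (e /\<^sub>R R) \<bullet> x" for x
  have cos1: "cos (1::real) > 0" using pi_gt3 by (intro cos_gt_zero) auto
  \<comment> \<open>On \<open>\<Omega>\<close> one has \<open>\<bar>\<theta> x\<bar> \<le> 1\<close>
    and hence \<open>cos (\<theta> x) \<ge> cos 1\<close>, so this amplitude makes the Laplacian
    \<open>- A * cos (\<theta> x) / R^2\<close> at most -1.\<close>
  define A where "A = R\<^sup>2 / cos 1"
  have A: "A > 0" using R cos1 by (simp add: A_def)
  define W where "W x = A * (1 + cos (\<theta> x))" for x
  have s\<theta>: "smooth \<theta>" unfolding \<theta>_def[abs_def] by (rule smooth_inner)
  have sW: "smooth W" unfolding W_def[abs_def]
    by (intro smooth_mult smooth_add smooth_const smooth_cos s\<theta>)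
  have W0: "W x \<ge> 0" for x
  proof -
    have "0 \<le> 1 + cos (\<theta> x)" using cos_ge_minus_one[of "\<theta> x"] by linarith
    thus ?thesis using A by (simp add: W_def)
  qed
  have d\<theta>: "(\<theta> has_derivative (\<lambda>h. (e /\<^sub>R R) \<bullet> h)) (at x)" for x
    unfolding \<theta>_def[abs_def] by (auto intro!: derivative_eq_intros)
  have "(W has_derivative (\<lambda>h. A * (- sin (\<theta> x) * ((e /\<^sub>R R) \<bullet> h)))) (at x)" for x
    unfolding W_def[abs_def]
    by (rule has_derivative_eq_rhs, rule has_derivative_mult_right[OF has_derivative_add[OF
          has_derivative_const has_derivative_cos[OF d\<theta>]]]) auto
  hence p1: "partial_deriv i W = (\<lambda>x. A * (- sin (\<theta> x) * ((e /\<^sub>R R) \<bullet> i)))" for i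
    using has_derivative_partial by blast
  have d2: "((\<lambda>x. A * (- sin (\<theta> x) * ((e /\<^sub>R R) \<bullet> i))) has_derivative
      (\<lambda>h. A * (- (cos (\<theta> x) * ((e /\<^sub>R R) \<bullet> h)) * ((e /\<^sub>R R) \<bullet> i)))) (at x)" for i x
    by (rule has_derivative_eq_rhs, rule has_derivative_mult_right[OF has_derivative_mult_left[OF
          has_derivative_minus[OF has_derivative_sin[OF d\<theta>]]]]) (auto simp: algebra_simps)
  have p2: "partial_deriv i (partial_deriv i W) x = - A * cos (\<theta> x) * ((e /\<^sub>R R) \<bullet> i)\<^sup>2" for i x
    unfolding p1 has_derivative_partial[OF d2] by (simp add: power2_eq_square)
  have "(\<Sum>i\<in>Basis. ((e /\<^sub>R R) \<bullet> i)\<^sup>2) = (norm (e /\<^sub>R R))\<^sup>2"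
    unfolding power2_norm_eq_inner by (subst euclidean_inner) (simp add: power2_eq_square)
  also have "\<dots> = 1 / R\<^sup>2" using e R by (simp add: power_inverse divide_inverse)
  finally have sumB: "(\<Sum>i\<in>Basis. ((e /\<^sub>R R) \<bullet> i)\<^sup>2) = 1 / R\<^sup>2" .
  have lap: "laplacian W x = - cos (\<theta> x) / cos 1" for x
  proof -
    have "laplacian W x = - A * cos (\<theta> x) * (\<Sum>i\<in>Basis. ((e /\<^sub>R R) \<bullet> i)\<^sup>2)"
      unfolding laplacian_def p2 by (rule sum_distrib_left[symmetric])
    also have "\<dots> = - cos (\<theta> x) / cos 1"
      unfolding sumB A_def using R by simp
    finally show ?thesis .
  qed
  have "AE x in lebesgue_on \<Omega>. 1 * (v x - W x) \<le> 0"
  proof (rule torsion_comparison[OF \<Omega> C P v sW])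
    fix \<phi> assume t: "test_fun \<Omega> \<phi>"
    show "test_fun \<Omega> (\<lambda>x. softplus (1 * (\<phi> x - W x)))"
    proof (rule test_funI_supp[OF _ test_funD(2,3)[OF t]])
      show "smooth (\<lambda>x. softplus (1 * (\<phi> x - W x)))"
        by (intro smooth_softplus smooth_mult smooth_const smooth_diff sW test_funD(1)[OF t])
      show "softplus (1 * (\<phi> x - W x)) = 0" if "x \<notin> supp \<phi>" for x
        using not_in_supp(1)[OF that] W0[of x] by (simp add: softplus_eq_0_iff)
    qed
  next
    fix x assume "x \<in> \<Omega>"
    have "\<bar>\<theta> x\<bar> \<le> norm (e /\<^sub>R R) * norm x" unfolding \<theta>_def by (rule Cauchy_Schwarz_ineq2)
    also have "\<dots> \<le> 1" using R(1) R(2)[OF \<open>x \<in> \<Omega>\<close>] e by (simp add: field_simps)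
    finally have "cos 1 \<le> cos \<bar>\<theta> x\<bar>" using pi_gt3 by (intro cos_monotone_0_pi_le) auto
    hence "cos 1 \<le> cos (\<theta> x)" by simp
    thus "1 * (laplacian W x + 1) \<le> 0" unfolding lap using cos1 by (simp add: field_simps)
  qed auto
  hence "AE x in lebesgue_on \<Omega>. v x \<le> 2 * A"
  proof (rule eventually_mono)
    fix x assume "1 * (v x - W x) \<le> 0"
    moreover have "A * (1 + cos (\<theta> x)) \<le> A * 2" using A by (intro mult_left_mono) auto
    ultimately show "v x \<le> 2 * A" by (simp add: W_def)
  qed
  thus ?thesis by (rule that)
qed

lemma exists_john_ellipsoid_open:
  fixes \<Omega> :: "'a::euclidean_space set"
  assumes \<Omega>: "open \<Omega>" "convex \<Omega>" "\<Omega> \<noteq> {}" "bounded \<Omega>"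
  obtains c and L :: "'a \<Rightarrow> 'a" where "linear L" "inj L"
    "{x. norm (L (x - c)) < 1} \<subseteq> \<Omega>" "\<Omega> \<subseteq> {x. norm (L (x - c)) < DIM('a)}"
proof -
  have "compact (closure \<Omega>)" "convex (closure \<Omega>)" using \<Omega> by (auto intro: convex_closure)
  moreover have "interior (closure \<Omega>) \<noteq> {}"
    using \<Omega> by (simp add: convex_interior_closure interior_open)
  ultimately obtain c and L :: "'a \<Rightarrow> 'a" where L: "linear L" "inj L"
    and in1: "\<And>x. norm (L (x - c)) \<le> 1 \<Longrightarrow> x \<in> closure \<Omega>"
    and out: "\<And>x. x \<in> closure \<Omega> \<Longrightarrow> norm (L (x - c)) \<le> DIM('a)"
    by (rule john_ellipsoid) blast
  have "open {x. norm (L (x - c)) < 1}" by (rule open_ellipsoid[OF L(1)])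
  moreover have "{x. norm (L (x - c)) < 1} \<subseteq> closure \<Omega>" using in1 by auto
  ultimately have "{x. norm (L (x - c)) < 1} \<subseteq> interior (closure \<Omega>)" by (rule interior_maximal[rotated])
  hence inn: "{x. norm (L (x - c)) < 1} \<subseteq> \<Omega>"
    using \<Omega> by (simp add: convex_interior_closure interior_open)
  \<comment> \<open>Strictness comes from openness: if equality held at \<open>x\<close>, a small
    push away from \<open>c\<close> would stay in \<open>\<Omega>\<close> and leave the closed outer
    ellipsoid.\<close>
  have "norm (L (x - c)) < DIM('a)" if x: "x \<in> \<Omega>" for x
  proof (rule ccontr)
    assume "\<not> ?thesis"
    hence ge: "norm (L (x - c)) \<ge> DIM('a)" by simp
    obtain \<epsilon> where \<epsilon>: "\<epsilon> > 0" "ball x \<epsilon> \<subseteq> \<Omega>" using \<Omega>(1) x open_contains_ball by blast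
    define s where "s = \<epsilon> / (2 * (norm (x - c) + 1))"
    have pos: "2 * (norm (x - c) + 1) > 0" by (simp add: add_nonneg_pos)
    have s: "s > 0" using \<epsilon> pos by (simp add: s_def)
    have "s * (2 * (norm (x - c) + 1)) = \<epsilon>" using pos by (simp add: s_def)
    hence "s * norm (x - c) < \<epsilon>" using s \<epsilon> by (simp add: algebra_simps)
    hence "x + s *\<^sub>R (x - c) \<in> ball x \<epsilon>" using s by (simp add: dist_norm)
    hence "x + s *\<^sub>R (x - c) \<in> closure \<Omega>" using \<epsilon> closure_subset by blast
    from out[OF this] have "norm (L ((1 + s) *\<^sub>R (x - c))) \<le> DIM('a)"
      by (simp add: algebra_simps)
    hence "(1 + s) * norm (L (x - c)) \<le> DIM('a)" using s by (simp add: linear_scale[OF L(1)])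
    moreover have "(1 + s) * norm (L (x - c)) \<ge> (1 + s) * DIM('a)" using ge s by (intro mult_left_mono) auto
    ultimately have "(1 + s) * DIM('a) \<le> 1 * DIM('a)" by linarith
    thus False using s DIM_positive[where 'a = 'a] by (simp add: mult_le_cancel_right)
  qed
  thus ?thesis using that[OF L inn] by blast
qed

text \<open>Convexity enters the estimates through boundedness and this pair of homothetic
  ellipsoids with ratio \<open>DIM('a)\<close>.\<close>

locale convex_domain =
  fixes \<Omega> :: "'a::euclidean_space set" and L :: "'a \<Rightarrow> 'a" and c :: 'a
  assumes opn: "open \<Omega>" and bdd: "bounded \<Omega>" and L: "linear L" "inj L"
    and inner_ell: "{x. norm (L (x - c)) < 1} \<subseteq> \<Omega>"
    and outer_ell: "\<Omega> \<subseteq> {x. norm (L (x - c)) < DIM('a)}"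
begin

definition "S = (\<Sum>i\<in>Basis. (norm (L i))\<^sup>2)"

abbreviation "E \<equiv> {x. norm (L (x - c)) < 1}"

abbreviation "M \<equiv> lebesgue_on \<Omega>"

lemma S_pos: "S > 0"
  unfolding S_def
proof (rule sum_pos)
  fix i :: 'a assume "i \<in> Basis"
  hence "L i \<noteq> 0" using nonzero_Basis linear_injective_0[OF L(1)] L(2) by blast
  thus "0 < (norm (L i))\<^sup>2" by simp
qed auto

lemma sets_Omega: "\<Omega> \<in> sets lebesgue"
  using opn by simp

lemma c_in: "c \<in> \<Omega>"
  using inner_ell linear_0[OF L(1)] by auto

lemma finite_M: "finite_measure M"
  using sets_Omega bdd by (intro finite_measure_lebesgue_on) (simp add: bounded_set_imp_lmeasurable)

definition "\<Lambda> = pi\<^sup>2 / (4 * (real DIM('a))\<^sup>2) * S"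

lemma \<Lambda>_pos: "\<Lambda> > 0"
  using S_pos by (simp add: \<Lambda>_def)

lemma poincare: "test_fun \<Omega> \<phi> \<Longrightarrow> \<Lambda> * (\<integral>x. (\<phi> x)\<^sup>2 \<partial>lborel) \<le> (\<integral>x. (norm (grad \<phi> x))\<^sup>2 \<partial>lborel)"
  unfolding \<Lambda>_def S_def
  by (rule poincare_ellipsoid[OF L]) (use outer_ell in \<open>auto intro: less_imp_le\<close>)

text \<open>\<open>lambda1\<close> is an infimum of a set of reals, so a lower bound for it requires
  that at least one Rayleigh quotient exists.\<close>

lemma exists_nontrivial_test_fun:
  obtains \<phi> where "test_fun \<Omega> \<phi>" "(\<integral>x. (\<phi> x)\<^sup>2 \<partial>M) \<noteq> 0"
proof -
  let ?w = "ellipsoid_torsion L c"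
  \<comment> \<open>Half of the maximum \<open>1 / (2 * S)\<close> that the quadratic attains at the
    centre \<open>c\<close>.\<close>
  define \<delta> where "\<delta> = 1 / (4 * S)"
  have \<delta>: "\<delta> > 0" using S_pos by (simp add: \<delta>_def)
  define \<phi> where "\<phi> x = softplus (?w x - \<delta>)" for x
  have t: "test_fun \<Omega> \<phi>"
  proof (rule test_funI_supp)
    show "smooth \<phi>" unfolding \<phi>_def[abs_def]
      by (intro smooth_softplus smooth_diff smooth_const smooth_ellipsoid_torsion L)
    show "compact {x. ?w x \<ge> \<delta>}" "{x. ?w x \<ge> \<delta>} \<subseteq> \<Omega>"
      using compact_ellipsoid_torsion_superlevel[OF L(1) S_pos[unfolded S_def] \<delta> inner_ell bdd] by blast+
    show "\<phi> x = 0" if "x \<notin> {x. ?w x \<ge> \<delta>}" for x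
      using that by (simp add: \<phi>_def softplus_eq_0_iff)
  qed
  have "?w c = 1 / (2 * S)" by (simp add: ellipsoid_torsion_def S_def linear_0[OF L(1)])
  hence "?w c - \<delta> > 0" using S_pos by (simp add: \<delta>_def field_simps)
  hence \<phi>c: "\<phi> c \<noteq> 0" by (simp add: \<phi>_def softplus_eq_0_iff)
  have c: "continuous_on UNIV \<phi>" by (rule test_fun_continuous[OF t])
  have c2: "continuous_on UNIV (\<lambda>x. (\<phi> x)\<^sup>2)" by (intro continuous_on_power c)
  have "(\<integral>x. (\<phi> x)\<^sup>2 \<partial>M) \<noteq> 0"
  proof
    assume "(\<integral>x. (\<phi> x)\<^sup>2 \<partial>M) = 0"
    hence "(\<integral>x. (\<phi> x)\<^sup>2 \<partial>lborel) = 0"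
      using lebesgue_on_eq_lborel(1)[OF sets_Omega borel_measurable_continuous_onI[OF c2]] test_fun_outside(1)[OF t]
      by simp
    moreover have "integrable lborel (\<lambda>x. (\<phi> x)\<^sup>2)"
      by (rule integrable_test_fun_cont[OF t c2]) simp
    ultimately have "AE x in lborel. (\<phi> x)\<^sup>2 = 0"
      using integral_nonneg_eq_0_iff_AE[of lborel "\<lambda>x. (\<phi> x)\<^sup>2"] by simp
    hence AE: "AE x in lborel. \<phi> x = 0" by simp
    have op: "open {x. \<phi> x \<noteq> 0}" by (intro open_Collect_neq c continuous_on_const)
    have "{x. \<phi> x \<noteq> 0} \<in> null_sets lborel"
      using AE AE_iff_null_sets[of "{x. \<phi> x \<noteq> 0}" lborel] op by simp
    hence "negligible {x. \<phi> x \<noteq> 0}"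
      by (simp add: negligible_iff_null_sets null_sets_completionI)
    thus False using open_not_negligible[OF op] \<phi>c by blast
  qed
  thus ?thesis using that t by blast
qed

lemma lambda1_ge: "lambda1 \<Omega> \<ge> \<Lambda>"
  unfolding lambda1_def set_integral_lebesgue_on[OF sets_Omega]
proof (rule cInf_greatest)
  obtain \<phi> where "test_fun \<Omega> \<phi>" "(\<integral>x. (\<phi> x)\<^sup>2 \<partial>M) \<noteq> 0" by (rule exists_nontrivial_test_fun)
  thus "{(\<integral>x. (norm (g x))\<^sup>2 \<partial>M) / (\<integral>x. (u x)\<^sup>2 \<partial>M) |u g. H01 \<Omega> u g \<and> (\<integral>x. (u x)\<^sup>2 \<partial>M) \<noteq> 0} \<noteq> {}"
    using H01_test_fun[OF sets_Omega] by blast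
next
  fix y assume "y \<in> {(\<integral>x. (norm (g x))\<^sup>2 \<partial>M) / (\<integral>x. (u x)\<^sup>2 \<partial>M) |u g. H01 \<Omega> u g \<and> (\<integral>x. (u x)\<^sup>2 \<partial>M) \<noteq> 0}"
  then obtain u g where y: "y = (\<integral>x. (norm (g x))\<^sup>2 \<partial>M) / (\<integral>x. (u x)\<^sup>2 \<partial>M)"
    and H: "H01 \<Omega> u g" and nz: "(\<integral>x. (u x)\<^sup>2 \<partial>M) \<noteq> 0" by blast
  have "(\<integral>x. (u x)\<^sup>2 \<partial>M) > 0" using nz by (simp add: order.not_eq_order_implies_strict)
  thus "\<Lambda> \<le> y" unfolding y using H01_poincare[OF sets_Omega H poincare] by (simp add: pos_le_divide_eq)
qed

lemma is_torsion_torsion: "is_torsion \<Omega> (torsion \<Omega>)"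
  unfolding torsion_def using torsion_exists[OF sets_Omega bdd \<Lambda>_pos poincare] by (rule someI_ex)

lemma torsion_ge: "AE x in M. ellipsoid_torsion L c x \<le> torsion \<Omega> x"
  by (rule torsion_ge_ellipsoid_torsion[OF sets_Omega bdd \<Lambda>_pos poincare is_torsion_torsion L(1)
        S_pos[unfolded S_def] inner_ell])

lemma torsion_measurable: "torsion \<Omega> \<in> borel_measurable M"
  using is_torsion_torsion unfolding is_torsion_def H01_def by (auto intro: measurable_lebesgue_onI)

text \<open>The quadratic subsolution is negative outside the inner ellipsoid, but it is continuous
  on the compact closure of \<open>\<Omega>\<close> and so still gives a lower bound on the whole
  domain.\<close>

lemma torsion_bounded: obtains B where "AE x in M. \<bar>torsion \<Omega> x\<bar> \<le> B"
proof -
  obtain B1 where B1: "AE x in M. torsion \<Omega> x \<le> B1"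
    by (rule torsion_bounded_above[OF sets_Omega bdd \<Lambda>_pos poincare is_torsion_torsion])
  have "compact (closure \<Omega>)" using bdd by simp
  hence "bounded (ellipsoid_torsion L c ` closure \<Omega>)"
    by (intro compact_imp_bounded compact_continuous_image smooth_continuous smooth_ellipsoid_torsion L)
  then obtain B2 where B2: "\<And>x. x \<in> closure \<Omega> \<Longrightarrow> \<bar>ellipsoid_torsion L c x\<bar> \<le> B2"
    unfolding bounded_iff by auto
  have "AE x in M. x \<in> \<Omega>" by (rule AE_I2) (simp add: space_restrict_space)
  hence "AE x in M. \<bar>torsion \<Omega> x\<bar> \<le> max B1 B2"
    using B1 torsion_ge
  proof eventually_elim
    fix x assume h: "x \<in> \<Omega>" "torsion \<Omega> x \<le> B1" "ellipsoid_torsion L c x \<le> torsion \<Omega> x"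
    hence "\<bar>ellipsoid_torsion L c x\<bar> \<le> B2" using B2 closure_subset by blast
    thus "\<bar>torsion \<Omega> x\<bar> \<le> max B1 B2" using h by linarith
  qed
  thus ?thesis by (rule that)
qed

text \<open>A non-integrable power would have integral 0 by convention, which would make
  \<open>Fp\<close> meaningless and break its monotonicity in \<open>p\<close>.\<close>

lemma torsion_powr_integrable:
  assumes "p > 0"
  shows "integrable M (\<lambda>x. \<bar>torsion \<Omega> x\<bar> powr p)"
proof -
  obtain B where B: "AE x in M. \<bar>torsion \<Omega> x\<bar> \<le> B" by (rule torsion_bounded)
  show ?thesis
  proof (rule finite_measure.integrable_const_bound[OF finite_M, of _ "B powr p"])
    show "AE x in M. norm (\<bar>torsion \<Omega> x\<bar> powr p) \<le> B powr p"
      using B by (rule eventually_mono) (use assms in \<open>auto intro!: powr_mono2\<close>)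
    show "(\<lambda>x. \<bar>torsion \<Omega> x\<bar> powr p) \<in> borel_measurable M" using torsion_measurable by measurable
  qed
qed

lemma Fp_eq: "Fp p \<Omega> = (\<integral>x. \<bar>torsion \<Omega> x\<bar> powr p \<partial>M) powr (1 / p) / measure M (space M) powr (1 / p) * lambda1 \<Omega>"
proof -
  have "measure M (space M) = measure lebesgue \<Omega>"
    using sets_Omega by (simp add: space_restrict_space measure_restrict_space)
  thus ?thesis unfolding Fp_def set_integral_lebesgue_on[OF sets_Omega] by simp
qed

lemma lambda1_nonneg: "lambda1 \<Omega> \<ge> 0"
  using lambda1_ge \<Lambda>_pos by linarith

lemma Fp_nonneg: "Fp p \<Omega> \<ge> 0"
  unfolding Fp_eq using lambda1_nonneg by simp

lemma measure_Omega_pos: "measure M (space M) > 0"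
proof -
  have "emeasure lebesgue \<Omega> \<noteq> 0"
    using open_not_negligible[OF opn] c_in sets_Omega by (auto simp: negligible_iff_null_sets null_sets_def)
  moreover have "emeasure M (space M) = emeasure lebesgue \<Omega>"
    using sets_Omega by (simp add: space_restrict_space emeasure_restrict_space del: emeasure_completion)
  ultimately show ?thesis
    using finite_measure.emeasure_eq_measure[OF finite_M, of "space M"]
    by (metis ennreal_0 measure_nonneg order_less_le)
qed

lemma Fp_mono:
  assumes "1 \<le> p" "p \<le> q"
  shows "Fp p \<Omega> \<le> Fp q \<Omega>"
  unfolding Fp_eq
  by (intro mult_right_mono lambda1_nonneg power_mean_mono finite_M measure_Omega_pos torsion_powr_integrable)
    (use assms in auto)

text \<open>On the inner ellipsoid the quadratic is positive, so its \<open>p\<close>-th power is a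
  lower bound for the integrand; the rest of \<open>\<Omega>\<close> contributes a nonnegative
  amount. The integral over the ellipsoid is the Beta integral of
  \<open>nn_integral_ellipsoid\<close>.\<close>

lemma torsion_norm_ge:
  fixes p :: real
  assumes p: "p \<ge> 1"
  shows "(1 / (2 * S)) powr p * (Gamma (real DIM('a) / 2 + 1) * Gamma (p + 1) / Gamma (real DIM('a) / 2 + p + 1))
      * measure lebesgue E \<le> (\<integral>x. \<bar>torsion \<Omega> x\<bar> powr p \<partial>M)"
proof -
  let ?G = "Gamma (real DIM('a) / 2 + 1) * Gamma (p + 1) / Gamma (real DIM('a) / 2 + p + 1)"
  let ?I = "\<integral>x. \<bar>torsion \<Omega> x\<bar> powr p \<partial>M"
  let ?f = "\<lambda>x. ennreal ((1 - (norm (L (x - c)))\<^sup>2) powr p) * indicator E x"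
  have G: "?G > 0" using p by (intro divide_pos_pos mult_pos_pos Gamma_real_pos) auto
  have contw: "continuous_on UNIV (ellipsoid_torsion L c)"
    by (rule smooth_continuous[OF smooth_ellipsoid_torsion[OF L(1)]])
  have normL: "(norm (L (x - c)))\<^sup>2 = 1 - 2 * S * ellipsoid_torsion L c x" for x
    using S_pos by (simp add: ellipsoid_torsion_def S_def)
  have E_eq: "E = {x. ellipsoid_torsion L c x > 0}"
  proof -
    have "norm (L (x - c)) < 1 \<longleftrightarrow> ellipsoid_torsion L c x > 0" for x
    proof -
      have "norm (L (x - c)) < 1 \<longleftrightarrow> (norm (L (x - c)))\<^sup>2 < 1" by (simp add: abs_square_less_1)
      also have "\<dots> \<longleftrightarrow> 2 * S * ellipsoid_torsion L c x > 0" unfolding normL by simp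
      finally show ?thesis using S_pos by (simp add: zero_less_mult_iff)
    qed
    thus ?thesis by auto
  qed
  have openE: "open E" by (rule open_ellipsoid[OF L(1)])
  hence Eb: "E \<in> sets borel" by simp
  have [measurable]: "?f \<in> borel_measurable borel"
    unfolding normL using borel_measurable_continuous_onI[OF contw] Eb by measurable
  have Efin: "emeasure lborel E = ennreal (measure lebesgue E)"
  proof -
    have "E \<in> lmeasurable" using bounded_subset[OF bdd inner_ell] openE
      by (simp add: bounded_set_imp_lmeasurable)
    hence "emeasure lebesgue E = ennreal (measure lebesgue E)" by (simp add: emeasure_eq_measure2 del: emeasure_completion)
    thus ?thesis using Eb by simp
  qed
  have "ennreal ((1 / (2 * S)) powr p * ?G * measure lebesgue E)
      = ennreal ((1 / (2 * S)) powr p) * (ennreal ?G * emeasure lborel E)"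
  proof -
    have "ennreal (a * g * e) = ennreal a * (ennreal g * ennreal e)" if "a \<ge> 0" "g \<ge> 0" "e \<ge> 0" for a g e
      using that by (simp add: ennreal_mult mult.assoc)
    thus ?thesis unfolding Efin using G by (metis less_imp_le measure_nonneg powr_ge_zero)
  qed
  also have "\<dots> = ennreal ((1 / (2 * S)) powr p) * (\<integral>\<^sup>+x. ?f x \<partial>lborel)"
    using p by (subst nn_integral_ellipsoid[OF L(1)]) auto
  also have "\<dots> = (\<integral>\<^sup>+x. ennreal ((1 / (2 * S)) powr p) * ?f x \<partial>lborel)"
    by (rule nn_integral_cmult[symmetric]) simp
  also have "\<dots> = (\<integral>\<^sup>+x. ennreal ((1 / (2 * S)) powr p) * ?f x \<partial>lebesgue)"
    by (rule nn_integral_completion[symmetric])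
  also have "\<dots> = (\<integral>\<^sup>+x. (ennreal ((1 / (2 * S)) powr p) * ?f x) * indicator \<Omega> x \<partial>lebesgue)"
    using inner_ell by (intro nn_integral_cong) (auto split: split_indicator)
  also have "\<dots> = (\<integral>\<^sup>+x. ennreal ((1 / (2 * S)) powr p) * ?f x \<partial>M)"
    using sets_Omega by (simp add: nn_integral_restrict_space)
  also have "\<dots> \<le> (\<integral>\<^sup>+x. ennreal (\<bar>torsion \<Omega> x\<bar> powr p) \<partial>M)"
  proof (rule nn_integral_mono_AE, rule eventually_mono[OF torsion_ge])
    fix x assume h: "ellipsoid_torsion L c x \<le> torsion \<Omega> x"
    show "ennreal ((1 / (2 * S)) powr p) * ?f x \<le> ennreal (\<bar>torsion \<Omega> x\<bar> powr p)"
    proof (cases "x \<in> E")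
      case True
      have w: "0 < ellipsoid_torsion L c x" using True unfolding E_eq by simp
      have "(1 / (2 * S)) powr p * (1 - (norm (L (x - c)))\<^sup>2) powr p = ellipsoid_torsion L c x powr p"
        unfolding normL using S_pos w by (subst powr_mult[symmetric]) auto
      also have "\<dots> \<le> \<bar>torsion \<Omega> x\<bar> powr p" using w h p by (intro powr_mono2) auto
      finally have "ennreal ((1 / (2 * S)) powr p * (1 - (norm (L (x - c)))\<^sup>2) powr p) \<le> ennreal (\<bar>torsion \<Omega> x\<bar> powr p)"
        by (rule ennreal_leI)
      thus ?thesis using True by (simp add: ennreal_mult)
    qed simp
  qed
  also have "\<dots> = ennreal ?I"
    using torsion_powr_integrable p by (intro nn_integral_eq_integral) auto
  finally show ?thesis by (simp add: ennreal_le_iff)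
qed

lemma measure_Omega_le: "measure M (space M) \<le> real DIM('a) ^ DIM('a) * measure lebesgue E"
proof -
  have lE: "E \<in> lmeasurable"
    using bounded_subset[OF bdd inner_ell] open_ellipsoid[OF L(1)] by (simp add: bounded_set_imp_lmeasurable)
  have "ennreal (measure M (space M)) = emeasure lebesgue \<Omega>"
    using finite_measure.emeasure_eq_measure[OF finite_M, of "space M"] sets_Omega
    by (simp add: space_restrict_space emeasure_restrict_space del: emeasure_completion)
  also have "\<dots> \<le> emeasure lebesgue {x. norm (L (x - c)) < real DIM('a)}"
    by (rule emeasure_mono[OF outer_ell]) (use open_ellipsoid[OF L(1)] in simp)
  also have "\<dots> = ennreal (real DIM('a) ^ DIM('a)) * emeasure lebesgue E"
    by (rule emeasure_ellipsoid[OF L(1)]) simp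
  also have "\<dots> = ennreal (real DIM('a) ^ DIM('a) * measure lebesgue E)"
    using lE by (simp add: emeasure_eq_measure2 ennreal_mult del: emeasure_completion)
  finally show ?thesis by (simp add: ennreal_le_iff)
qed

text \<open>The factor \<open>2 powr (-3)\<close> is 1/2 from the normalisation
  \<open>1 / (2 * S)\<close> of the quadratic times 1/4 from the half-width in the Poincare constant
  \<open>\<Lambda>\<close>. The exponent of the dimension collects -2 from \<open>\<Lambda>\<close>
  and \<open>- m / p\<close> from the \<open>p\<close>-th root of the volume ratio
  \<open>m ^ m\<close>.\<close>

lemma Fp_ge:
  fixes p :: real
  assumes p: "p \<ge> 1"
  shows "2 powr (-3) * pi\<^sup>2 * real DIM('a) powr (- (real DIM('a) + 2 * p) / p)
     * (Gamma (real DIM('a) / 2 + 1) * Gamma (p + 1) / Gamma (real DIM('a) / 2 + p + 1)) powr (1 / p) \<le> Fp p \<Omega>"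
proof -
  define m where "m = real DIM('a)"
  define G where "G = Gamma (m / 2 + 1) * Gamma (p + 1) / Gamma (m / 2 + p + 1)"
  define e where "e = measure lebesgue E"
  define \<mu> where "\<mu> = measure M (space M)"
  define I where "I = (\<integral>x. \<bar>torsion \<Omega> x\<bar> powr p \<partial>M)"
  have m: "m \<ge> 1" using DIM_positive[where 'a = 'a] unfolding m_def by linarith
  have G: "G > 0" unfolding G_def using p m by (intro divide_pos_pos mult_pos_pos Gamma_real_pos) auto
  have \<mu>: "\<mu> > 0" "\<mu> \<le> m powr m * e"
    using measure_Omega_pos measure_Omega_le m by (simp_all add: \<mu>_def m_def e_def powr_realpow)
  have "e \<noteq> 0" using \<mu> by auto
  hence e: "e > 0" unfolding e_def by (simp add: zero_less_measure_iff)
  have I: "(1 / (2 * S)) powr p * G * e \<le> I"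
    using torsion_norm_ge[OF p] by (simp add: G_def m_def e_def I_def)
  have p0: "p > 0" using p by simp
  have "(1 / (2 * S)) * G powr (1/p) * m powr (- m / p) = ((1 / (2 * S)) powr p * G * e / (m powr m * e)) powr (1 / p)"
  proof -
    have "(1 / (2 * S)) powr p * G * e / (m powr m * e) = (1 / (2 * S)) powr p * G * m powr (- m)"
      using e m by (simp add: powr_minus_divide)
    also have "\<dots> powr (1 / p) = ((1 / (2 * S)) powr p) powr (1 / p) * G powr (1 / p) * (m powr (- m)) powr (1 / p)"
      using G S_pos by (simp add: powr_mult)
    also have "\<dots> = (1 / (2 * S)) * G powr (1 / p) * m powr (- m / p)"
      using p0 S_pos by (simp add: powr_powr)
    finally show ?thesis by simp
  qed
  also have "\<dots> \<le> (I / \<mu>) powr (1 / p)"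
  proof (rule powr_mono2)
    have "0 \<le> (1 / (2 * S)) powr p * G * e" using G e by simp
    thus "0 \<le> (1 / (2 * S)) powr p * G * e / (m powr m * e)"
      using e by (intro divide_nonneg_nonneg) auto
    show "(1 / (2 * S)) powr p * G * e / (m powr m * e) \<le> I / \<mu>"
      using I \<mu> \<open>0 \<le> (1 / (2 * S)) powr p * G * e\<close> by (intro frac_le) auto
  qed (use p0 in simp)
  also have "\<dots> = I powr (1 / p) / \<mu> powr (1 / p)"
    using \<mu> by (simp add: powr_divide I_def)
  finally have main: "(1 / (2 * S)) * G powr (1/p) * m powr (- m / p) \<le> I powr (1 / p) / \<mu> powr (1 / p)" .
  have "2 powr (-3) * pi\<^sup>2 * m powr (- (m + 2 * p) / p) * G powr (1 / p)
      = ((1 / (2 * S)) * G powr (1/p) * m powr (- m / p)) * \<Lambda>"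
  proof -
    have "- (m + 2 * p) / p = - m / p + (- 2)" using p0 by (simp add: field_simps)
    hence "m powr (- (m + 2 * p) / p) = m powr (- m / p) * m powr (- 2)" by (simp only: powr_add)
    moreover have "m powr (- 2) = 1 / m\<^sup>2" using m by (simp add: powr_neg_numeral)
    moreover have "(2::real) powr (-3) = 1 / 8" by (simp add: powr_neg_numeral)
    ultimately show ?thesis unfolding \<Lambda>_def m_def[symmetric] using S_pos m by (simp add: field_simps)
  qed
  also have "\<dots> \<le> (I powr (1 / p) / \<mu> powr (1 / p)) * lambda1 \<Omega>"
    using \<Lambda>_pos lambda1_ge by (intro mult_mono main) auto
  also have "\<dots> = Fp p \<Omega>" by (simp add: Fp_eq I_def \<mu>_def)
  finally show ?thesis by (simp add: G_def m_def)
qed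

end

section \<open>Passage to the infimum over all convex domains\<close>

lemma convex_domain_exists:
  fixes \<Omega> :: "'a::euclidean_space set"
  assumes "open \<Omega>" "convex \<Omega>" "0 < emeasure lebesgue \<Omega>" "emeasure lebesgue \<Omega> < \<infinity>"
  shows "\<exists>L c. convex_domain \<Omega> L c"
proof -
  have ne: "\<Omega> \<noteq> {}" using assms(3) by (metis emeasure_empty order_less_irrefl)
  have bdd: "bounded \<Omega>" by (rule finite_measure_convex_bounded[OF assms(1,2,4)])
  obtain c and L :: "'a \<Rightarrow> 'a" where "linear L" "inj L"
    "{x. norm (L (x - c)) < 1} \<subseteq> \<Omega>" "\<Omega> \<subseteq> {x. norm (L (x - c)) < DIM('a)}"
    by (rule exists_john_ellipsoid_open[OF assms(1,2) ne bdd])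
  thus ?thesis using assms bdd by (auto simp: convex_domain_def)
qed

theorem theorem2:
  fixes m :: nat
  defines "m \<equiv> DIM('a::euclidean_space)"
  shows "mono_on {1..} (G_convex TYPE('a))
    \<and> (\<forall>p::real. 1 \<le> p \<longrightarrow>
         G_convex TYPE('a) p \<ge> 2 powr (-3) * pi\<^sup>2 * real m powr (- (real m + 2 * p) / p)
            * (Gamma (real m / 2 + 1) * Gamma (p + 1) / Gamma (real m / 2 + p + 1)) powr (1 / p))"
proof -
  define D where "D = {\<Omega>::'a set. open \<Omega> \<and> convex \<Omega> \<and> 0 < emeasure lebesgue \<Omega> \<and> emeasure lebesgue \<Omega> < \<infinity>}"
  have G: "G_convex TYPE('a) p = Inf (Fp p ` D)" for p
    unfolding G_convex_def D_def by (rule arg_cong[of _ _ Inf]) auto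
  have dom: "\<exists>L c. convex_domain \<Omega> L c" if "\<Omega> \<in> D" for \<Omega>
    using that convex_domain_exists unfolding D_def by blast
  \<comment> \<open>The unit ball makes the class non-empty; together with the lower bound 0 for
    \<open>Fp\<close> this lets the real \<open>Inf\<close> be handled as a genuine infimum.\<close>
  have "ball (0::'a) 1 \<in> D"
  proof -
    have "emeasure lebesgue (ball (0::'a) 1) \<noteq> 0"
      using open_not_negligible[of "ball (0::'a) 1"] by (auto simp: negligible_iff_null_sets null_sets_def)
    moreover have "emeasure lebesgue (ball (0::'a) 1) < \<infinity>"
      using emeasure_lborel_ball_finite[of "0::'a" 1] by simp
    ultimately show ?thesis unfolding D_def by (simp add: zero_less_iff_neq_zero del: emeasure_completion)
  qed
  hence ne: "Fp p ` D \<noteq> {}" for p by blast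
  have bb: "bdd_below (Fp p ` D)" for p
    using dom convex_domain.Fp_nonneg by (intro bdd_belowI2[of _ 0]) blast
  have "mono_on {1..} (G_convex TYPE('a))"
  proof (rule mono_onI)
    fix p q :: real assume pq: "p \<in> {1..}" "q \<in> {1..}" "p \<le> q"
    show "G_convex TYPE('a) p \<le> G_convex TYPE('a) q"
      unfolding G
    proof (rule cINF_mono[OF _ bb])
      show "D \<noteq> {}" using ne by blast
      show "\<exists>\<Omega>'\<in>D. Fp p \<Omega>' \<le> Fp q \<Omega>" if "\<Omega> \<in> D" for \<Omega>
        using dom[OF that] convex_domain.Fp_mono[of \<Omega> _ _ p q] pq that by auto
    qed
  qed
  moreover have "2 powr (-3) * pi\<^sup>2 * real m powr (- (real m + 2 * p) / p)
      * (Gamma (real m / 2 + 1) * Gamma (p + 1) / Gamma (real m / 2 + p + 1)) powr (1 / p) \<le> G_convex TYPE('a) p"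
    if "1 \<le> p" for p :: real
    unfolding G m_def using dom convex_domain.Fp_ge[OF _ that] by (intro cINF_greatest[OF ne[of p, simplified image_is_empty]]) blast
  ultimately show ?thesis by blast
qed

end
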